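(* Let $d,m\ge1$ be integers, let $H=\sum_{|\alpha|\le m}c_\alpha D^\alpha$ be an elliptic constant-coefficient differential operator of order $m$ on $\mathbb{R}^d$ with real coefficients $c_\alpha\in\mathbb{R}$, let $\varepsilon>0$, $r>0$, and let $(M_\beta)_{\beta\in\mathbb{N}^d}$ be a family of nonnegative real numbers. Then there is a constant $C$, depending only on $d,r,\varepsilon,H$ and $(M_\beta)$, such that for every open set $\Omega\subset\mathbb{R}^d$, every $V\in C^\infty(\Omega,\mathbb{C})$, every $\lambda\in\mathbb{C}$ with $|\lambda|\ge1$, every $\psi_\lambda\in C^\infty(\Omega,\mathbb{C})$ satisfying $(H+V)\psi_\lambda=\lambda\psi_\lambda$ on $\Omega$, and every ball $B(x,r)\subset\Omega$ with $\sup_{B(x,r)}|D^\beta V|\le M_\beta$ for all $\beta\in\mathbb{N}^d$, $$|\psi_\lambda(x)|\le C\,|\lambda|^{\frac{d-1}{2m}+\varepsilon}\,\|\psi_\lambda\|_{L^2(B(x,r))}.$$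
   Context: Notation: $\mathbb{N}=\{0,1,2,\dots\}$; for a multi-index $\alpha\in\mathbb{N}^d$, $|\alpha|=\alpha_1+\dots+\alpha_d$, $D^\alpha=(-i\partial_{x_1})^{\alpha_1}\cdots(-i\partial_{x_d})^{\alpha_d}$ and $\xi^\alpha=\xi_1^{\alpha_1}\cdots\xi_d^{\alpha_d}$. $H$ is elliptic if $\sum_{|\alpha|=m}c_\alpha\xi^\alpha\ne0$ for all $\xi\in\mathbb{R}^d\setminus\{0\}$. $B(x,r)$ is the closed Euclidean ball of center $x$ and radius $r$. *)

theory Defs
  imports "HOL-Analysis.Analysis"
begin

definition mi_abs :: "nat ^ 'd \<Rightarrow> nat"
  where "mi_abs \<alpha> = (\<Sum>i\<in>UNIV. \<alpha> $ i)"

definition mi_power :: "real ^ 'd \<Rightarrow> nat ^ 'd \<Rightarrow> real"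
  where "mi_power \<xi> \<alpha> = (\<Prod>i\<in>UNIV. (\<xi> $ i) ^ (\<alpha> $ i))"

lemma finite_mi_abs_le: "finite {\<alpha> :: nat ^ 'd. mi_abs \<alpha> \<le> m}"
proof -
  have "{\<alpha> :: nat ^ 'd. mi_abs \<alpha> \<le> m} \<subseteq> vec_lambda ` (PiE UNIV (\<lambda>_. {..m}))"
  proof
    fix \<alpha> :: "nat ^ 'd"
    assume "\<alpha> \<in> {\<alpha>. mi_abs \<alpha> \<le> m}"
    then have le: "(\<Sum>i\<in>UNIV. \<alpha> $ i) \<le> m" by (simp add: mi_abs_def)
    have "\<alpha> $ i \<le> m" for i
      using member_le_sum[of i UNIV "\<lambda>i. \<alpha> $ i"] le by simp
    then have "vec_nth \<alpha> \<in> PiE UNIV (\<lambda>_. {..m})" by auto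
    then show "\<alpha> \<in> vec_lambda ` (PiE UNIV (\<lambda>_. {..m}))"
      by (metis image_eqI vec_nth_inverse)
  qed
  then show ?thesis
    by (rule finite_subset) (intro finite_imageI finite_PiE; simp)
qed

definition partial_deriv :: "'d \<Rightarrow> (real ^ 'd \<Rightarrow> complex) \<Rightarrow> real ^ 'd \<Rightarrow> complex"
  where "partial_deriv i f x = frechet_derivative f (at x) (axis i 1)"

primrec Ck_on :: "nat \<Rightarrow> (real ^ 'd) set \<Rightarrow> (real ^ 'd \<Rightarrow> complex) \<Rightarrow> bool"
  where
    "Ck_on 0 \<Omega> f \<longleftrightarrow> continuous_on \<Omega> f"
  | "Ck_on (Suc k) \<Omega> f \<longleftrightarrow>
      (\<forall>x\<in>\<Omega>. f differentiable (at x)) \<and> (\<forall>i. Ck_on k \<Omega> (partial_deriv i f))"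

text \<open>Functions on an open set \<open>\<Omega>\<close> are represented by total functions; their values outside
  \<open>\<Omega>\<close> are irrelevant, since the derivatives at a point of \<open>\<Omega>\<close> depend only on the germ there.\<close>

definition smooth_on :: "(real ^ 'd) set \<Rightarrow> (real ^ 'd \<Rightarrow> complex) \<Rightarrow> bool"
  where "smooth_on \<Omega> f \<longleftrightarrow> (\<forall>k. Ck_on k \<Omega> f)"

text \<open>An index type \<open>'d\<close> carries no order, so the order in which the coordinate derivatives
  are composed is an arbitrary fixed enumeration. On smooth functions the choice is immaterial,
  because mixed partial derivatives commute.\<close>

definition coords :: "'d::finite list"
  where "coords = (SOME xs. distinct xs \<and> set xs = UNIV)"

lemma coords: "distinct (coords :: 'd::finite list)" "set (coords :: 'd list) = UNIV"
proof -
  have "\<exists>xs :: 'd list. distinct xs \<and> set xs = UNIV"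
    using finite_distinct_list[OF finite_class.finite_UNIV] by blast
  then have "distinct (coords :: 'd list) \<and> set (coords :: 'd list) = UNIV"
    unfolding coords_def by (rule someI_ex)
  then show "distinct (coords :: 'd list)" "set (coords :: 'd list) = UNIV" by auto
qed

definition D_coord :: "'d \<Rightarrow> (real ^ 'd \<Rightarrow> complex) \<Rightarrow> real ^ 'd \<Rightarrow> complex"
  where "D_coord i f = (\<lambda>x. - \<i> * partial_deriv i f x)"

definition D_multi :: "nat ^ 'd \<Rightarrow> (real ^ 'd \<Rightarrow> complex) \<Rightarrow> real ^ 'd \<Rightarrow> complex"
  where "D_multi \<alpha> f = foldr (\<lambda>i. D_coord i ^^ (\<alpha> $ i)) coords f"

definition diff_op ::
    "nat \<Rightarrow> (nat ^ 'd \<Rightarrow> real) \<Rightarrow> (real ^ 'd \<Rightarrow> complex) \<Rightarrow> real ^ 'd \<Rightarrow> complex"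
  where "diff_op m c f x = (\<Sum>\<alpha> | mi_abs \<alpha> \<le> m. complex_of_real (c \<alpha>) * D_multi \<alpha> f x)"

definition elliptic :: "nat \<Rightarrow> (nat ^ 'd \<Rightarrow> real) \<Rightarrow> bool"
  where "elliptic m c \<longleftrightarrow>
    (\<forall>\<xi> :: real ^ 'd. \<xi> \<noteq> 0 \<longrightarrow> (\<Sum>\<alpha> | mi_abs \<alpha> = m. c \<alpha> * mi_power \<xi> \<alpha>) \<noteq> 0)"

definition L2_norm_on :: "(real ^ 'd) set \<Rightarrow> (real ^ 'd \<Rightarrow> complex) \<Rightarrow> real"
  where "L2_norm_on S f = sqrt (LINT y:S|lborel. (cmod (f y))\<^sup>2)"

end

theory Submission
  imports Defs
begin

text \<open>Multiply \<open>\<psi>\<close> by a test function \<open>a\<close> supported in the ball and write \<open>\<xi>\<close> for a frequency. Integrating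
  by parts in the equation gives \<open>(H(\<xi>) - \<lambda>) F(a \<psi>)(\<xi>)\<close> as a sum of transforms of further test
  functions times \<open>\<psi>\<close>, with coefficients of size \<open>(1 + |\<xi>|)^(m-1)\<close>. So wherever
  \<open>|H(\<xi>) - \<lambda>| \<ge> (1 + |\<xi>|)^(m-1+\<delta>)\<close> every iteration gains a factor \<open>(1 + |\<xi>|)^(-\<delta>)\<close>, and the
  transform of \<open>a \<psi>\<close> is negligible there. The remaining resonant frequencies form a shell of radius
  \<open>|\<lambda>|^(1/m)\<close> and thickness about \<open>|\<lambda>|^(\<delta>/m)\<close>. Expanding \<open>a \<psi>\<close> in a Fourier series on a cube
  around the ball, Cauchy-Schwarz and Bessel bound the resonant part by the square root of the number of
  resonant lattice points, that is by \<open>|\<lambda>|^((d-1+\<delta>)/(2m))\<close>, provided that the side of the cube is chosen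
  well: averaging over the side replaces a lattice point count on a fixed lattice.\<close>

section \<open>Partial derivatives and smooth functions\<close>

text \<open>No derivative of \<open>\<psi>\<close> is ever estimated: every integration by parts
  moves derivatives onto the test function, so only the \<open>L2\<close> norm of
  \<open>\<psi>\<close> survives. The loss \<epsilon> is the price of the iteration: the commutator
  of \<open>H\<close> with a test function has order \<open>m - 1\<close>, so dividing by
  \<open>H(\<xi>) - \<lambda>\<close> gains nothing unless the threshold for resonance lies a power
  \<delta> above that order, and this thickens the shell by the same power. For fixed \<delta> the
  number of steps depends on \<open>d\<close> and \<delta> alone. Each step replaces the test
  function by its derivatives or by its product with \<open>V\<close>, which is how bounds on
  derivatives of \<open>V\<close> enter. To keep the constant uniform in the domain, the ball and
  \<open>V\<close>, a test function is known to the estimates only through a sequence of bounds for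
  its derivatives. The value at \<open>x\<close> is recovered without any convergence theorem for
  Fourier series: powers of a nonnegative trigonometric polynomial that peaks at \<open>x\<close>
  turn a bound on the sum of the moduli of the coefficients into a bound at
  \<open>x\<close>.\<close>

lemma partial_deriv_eq:
  assumes "(f has_derivative f') (at x)"
  shows "partial_deriv i f x = f' (axis i 1)"
  using frechet_derivative_at[OF assms] by (simp add: partial_deriv_def)

text \<open>Holds at points of non-differentiability too: \<open>frechet_derivative\<close> is a
  choice among the derivatives of a function, and \<open>f\<close> and \<open>g\<close> have the
  same derivatives at \<open>x\<close>.\<close>

lemma partial_deriv_cong:
  assumes "open S" "x \<in> S" "\<And>y. y \<in> S \<Longrightarrow> f y = g y"
  shows "partial_deriv i f x = partial_deriv i g x"
proof -
  have "(f has_derivative f') (at x) \<longleftrightarrow> (g has_derivative f') (at x)" for f'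
    using has_derivative_transform_within_open[of f f' x UNIV S g]
      has_derivative_transform_within_open[of g f' x UNIV S f] assms by auto
  then show ?thesis by (simp add: partial_deriv_def frechet_derivative_def)
qed

lemma differentiable_cong_open:
  assumes "open S" "x \<in> S" "\<And>y. y \<in> S \<Longrightarrow> f y = g y" "f differentiable (at x)"
  shows "g differentiable (at x)"
  using assms has_derivative_transform_within_open[of f _ x UNIV S g]
  unfolding differentiable_def by blast

lemma partial_deriv_const [simp]: "partial_deriv i (\<lambda>_. c) x = 0"
  by (subst partial_deriv_eq[of _ "\<lambda>_. 0"]) auto

lemma partial_deriv_add:
  assumes "f differentiable (at x)" "g differentiable (at x)"
  shows "partial_deriv i (\<lambda>y. f y + g y) x = partial_deriv i f x + partial_deriv i g x"
  using has_derivative_add[OF assms[unfolded frechet_derivative_works]]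
  by (subst partial_deriv_eq, assumption) (simp add: partial_deriv_def)

lemma partial_deriv_mult:
  assumes "f differentiable (at x)" "g differentiable (at x)"
  shows "partial_deriv i (\<lambda>y. f y * g y) x = partial_deriv i f x * g x + f x * partial_deriv i g x"
  using has_derivative_mult[OF assms[unfolded frechet_derivative_works]]
  by (subst partial_deriv_eq, assumption) (simp add: partial_deriv_def)

lemma partial_deriv_shift:
  "partial_deriv i (\<lambda>y. f (y - a)) x = partial_deriv i f (x - a)"
proof -
  have 1: "((\<lambda>y. g (y - b)) has_derivative f') (at z)" if "(g has_derivative f') (at (z - b))"
    for g :: "real ^ 'b \<Rightarrow> complex" and f' z b
  proof -
    have "((\<lambda>y. y - b) has_derivative (\<lambda>y. y)) (at z)"
      by (auto intro!: derivative_eq_intros)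
    then show ?thesis using has_derivative_compose[of "\<lambda>y. y - b" "\<lambda>y. y" z UNIV g f'] that by simp
  qed
  have "((\<lambda>y. f (y - a)) has_derivative f') (at x) \<longleftrightarrow> (f has_derivative f') (at (x - a))" for f'
    using 1[of f f' x a] 1[of "\<lambda>y. f (y - a)" f' "x - a" "- a"] by auto
  then show ?thesis by (simp add: partial_deriv_def frechet_derivative_def)
qed

lemma Ck_on_cong:
  assumes "open \<Omega>" "\<And>y. y \<in> \<Omega> \<Longrightarrow> f y = g y"
  shows "Ck_on k \<Omega> f \<Longrightarrow> Ck_on k \<Omega> g"
  using assms(2)
proof (induction k arbitrary: f g)
  case 0
  then show ?case using continuous_on_cong[of \<Omega> \<Omega> f g] by simp
next
  case (Suc k)
  have "Ck_on k \<Omega> (partial_deriv i g)" for i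
    using Suc.IH[of "partial_deriv i f" "partial_deriv i g"] Suc.prems
      partial_deriv_cong[OF \<open>open \<Omega>\<close>, of _ f g] by simp
  moreover have "g differentiable (at x)" if "x \<in> \<Omega>" for x
    using differentiable_cong_open[OF \<open>open \<Omega>\<close> that] Suc.prems that by auto
  ultimately show ?case by simp
qed

lemma Ck_on_Suc_imp: "Ck_on (Suc k) \<Omega> f \<Longrightarrow> Ck_on k \<Omega> f"
  by (induction k arbitrary: f)
    (auto intro!: differentiable_imp_continuous_on differentiable_at_imp_differentiable_on)

lemma Ck_on_add:
  assumes "open \<Omega>"
  shows "Ck_on k \<Omega> f \<Longrightarrow> Ck_on k \<Omega> g \<Longrightarrow> Ck_on k \<Omega> (\<lambda>x. f x + g x)"
proof (induction k arbitrary: f g)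
  case 0
  then show ?case by (auto intro: continuous_intros)
next
  case (Suc k)
  have "Ck_on k \<Omega> (partial_deriv i (\<lambda>x. f x + g x))" for i
    by (rule Ck_on_cong[OF assms _ Suc.IH[of "partial_deriv i f" "partial_deriv i g"]])
      (use Suc.prems in \<open>auto simp: partial_deriv_add\<close>)
  then show ?case using Suc.prems by (auto intro: differentiable_add)
qed

lemma Ck_on_mult:
  assumes "open \<Omega>"
  shows "Ck_on k \<Omega> f \<Longrightarrow> Ck_on k \<Omega> g \<Longrightarrow> Ck_on k \<Omega> (\<lambda>x. f x * g x)"
proof (induction k arbitrary: f g)
  case 0
  then show ?case by (auto intro: continuous_intros)
next
  case (Suc k)
  have "Ck_on k \<Omega> (partial_deriv i (\<lambda>x. f x * g x))" for i
    by (rule Ck_on_cong[OF assms _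
          Ck_on_add[OF assms Suc.IH[of "partial_deriv i f" g] Suc.IH[of f "partial_deriv i g"]]])
      (use Suc.prems Ck_on_Suc_imp[OF Suc.prems(1)] Ck_on_Suc_imp[OF Suc.prems(2)]
       in \<open>auto simp: partial_deriv_mult\<close>)
  then show ?case using Suc.prems by (auto intro: differentiable_mult)
qed

lemma Ck_on_const: "Ck_on k \<Omega> (\<lambda>_. c)"
proof (induction k arbitrary: c)
  case (Suc k)
  have "partial_deriv i (\<lambda>_. c) = (\<lambda>_. 0)" for i :: 'a by auto
  then show ?case using Suc by simp
qed simp

lemma smooth_on_differentiable: "smooth_on \<Omega> f \<Longrightarrow> x \<in> \<Omega> \<Longrightarrow> f differentiable (at x)"
  unfolding smooth_on_def using Ck_on.simps(2) by blast

lemma smooth_on_continuous: "smooth_on \<Omega> f \<Longrightarrow> continuous_on \<Omega> f"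
  unfolding smooth_on_def using Ck_on.simps(1) by blast

lemma smooth_on_partial: "smooth_on \<Omega> f \<Longrightarrow> smooth_on \<Omega> (partial_deriv i f)"
  unfolding smooth_on_def using Ck_on.simps(2) by blast

lemma smooth_on_mult:
  "open \<Omega> \<Longrightarrow> smooth_on \<Omega> f \<Longrightarrow> smooth_on \<Omega> g \<Longrightarrow> smooth_on \<Omega> (\<lambda>x. f x * g x)"
  unfolding smooth_on_def using Ck_on_mult by blast

lemma smooth_on_const: "smooth_on \<Omega> (\<lambda>_. c)"
  unfolding smooth_on_def using Ck_on_const by blast

lemma smooth_on_D_coord: "open \<Omega> \<Longrightarrow> smooth_on \<Omega> f \<Longrightarrow> smooth_on \<Omega> (D_coord i f)"
  unfolding D_coord_def by (intro smooth_on_mult smooth_on_const smooth_on_partial)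

lemma D_coord_cong:
  assumes "open S" "x \<in> S" "\<And>y. y \<in> S \<Longrightarrow> f y = g y"
  shows "D_coord i f x = D_coord i g x"
  unfolding D_coord_def using partial_deriv_cong[OF assms] by simp

lemma D_coord_mult:
  assumes "f differentiable (at x)" "g differentiable (at x)"
  shows "D_coord i (\<lambda>y. f y * g y) x = D_coord i f x * g x + f x * D_coord i g x"
  unfolding D_coord_def partial_deriv_mult[OF assms] by (simp add: algebra_simps)

lemma D_coord_add:
  assumes "f differentiable (at x)" "g differentiable (at x)"
  shows "D_coord i (\<lambda>y. f y + g y) x = D_coord i f x + D_coord i g x"
  unfolding D_coord_def partial_deriv_add[OF assms] by (simp add: algebra_simps)

section \<open>Iterated derivatives along words of coordinates\<close>

text \<open>Words instead of multi-indices let an induction peel off one derivative at either end.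
  The head of the word is the derivative applied last.\<close>

definition D_word :: "'d list \<Rightarrow> (real ^ 'd \<Rightarrow> complex) \<Rightarrow> real ^ 'd \<Rightarrow> complex"
  where "D_word w f = foldr D_coord w f"

lemma D_word_simps [simp]:
  "D_word [] f = f" "D_word (i # w) f = D_coord i (D_word w f)"
  "D_word (v @ w) f = D_word v (D_word w f)"
  by (simp_all add: D_word_def)

lemma smooth_on_D_word: "open \<Omega> \<Longrightarrow> smooth_on \<Omega> f \<Longrightarrow> smooth_on \<Omega> (D_word w f)"
  by (induction w) (auto intro: smooth_on_D_coord)

lemma D_word_cong:
  assumes "open S" "\<And>y. y \<in> S \<Longrightarrow> f y = g y"
  shows "x \<in> S \<Longrightarrow> D_word w f x = D_word w g x"
proof (induction w arbitrary: x)
  case (Cons i w)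
  then show ?case using D_coord_cong[OF \<open>open S\<close>, of x "D_word w f" "D_word w g"] by simp
qed (use assms in auto)

lemma D_word_add:
  assumes "open \<Omega>" "smooth_on \<Omega> f" "smooth_on \<Omega> g"
  shows "x \<in> \<Omega> \<Longrightarrow> D_word w (\<lambda>y. f y + g y) x = D_word w f x + D_word w g x"
proof (induction w arbitrary: x)
  case (Cons i w)
  have "D_coord i (D_word w (\<lambda>y. f y + g y)) x = D_coord i (\<lambda>y. D_word w f y + D_word w g y) x"
    using Cons by (intro D_coord_cong[OF assms(1)]) auto
  also have "\<dots> = D_coord i (D_word w f) x + D_coord i (D_word w g) x"
    using Cons.prems assms
    by (intro D_coord_add smooth_on_differentiable[of \<Omega>] smooth_on_D_word)
  finally show ?case by simp
qed simp

lemma D_word_shift: "D_word w (\<lambda>y. f (y - a)) = (\<lambda>x. D_word w f (x - a))"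
  by (induction w) (auto simp: D_coord_def partial_deriv_shift)

lemma D_word_eq_0_off:
  assumes "closed K" "\<And>y. y \<notin> K \<Longrightarrow> f y = 0" "x \<notin> K"
  shows "D_word w f x = 0"
proof -
  have z: "D_word w (\<lambda>_. 0) = (\<lambda>_. 0)" by (induction w) (auto simp: D_coord_def)
  have "D_word w f x = D_word w (\<lambda>_. 0) x"
    by (rule D_word_cong[of "- K"]) (use assms in auto)
  then show ?thesis using z by simp
qed

text \<open>A crude Leibniz rule: each derivative splits a product in two, whence the power of
  \<open>2\<close>. The induction peels the end of the word, the derivative applied first, so that
  the product rule meets \<open>f * g\<close> itself and the hypothesis applies to the two resulting
  pairs of factors.\<close>

lemma norm_D_word_mult_le:
  assumes "open \<Omega>" "x \<in> \<Omega>" "A \<ge> 0" "B \<ge> 0"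
  shows "smooth_on \<Omega> f \<Longrightarrow> smooth_on \<Omega> g \<Longrightarrow>
     (\<And>v. length v \<le> length w \<Longrightarrow> cmod (D_word v f x) \<le> A) \<Longrightarrow>
     (\<And>v. length v \<le> length w \<Longrightarrow> cmod (D_word v g x) \<le> B) \<Longrightarrow>
     cmod (D_word w (\<lambda>y. f y * g y) x) \<le> 2 ^ length w * A * B"
proof (induction w arbitrary: f g rule: rev_induct)
  case Nil
  show ?case using Nil.prems(3)[of "[]"] Nil.prems(4)[of "[]"] assms
    by (auto simp: norm_mult intro!: mult_mono)
next
  case (snoc i w)
  let ?f = "D_coord i f" and ?g = "D_coord i g"
  have sm: "smooth_on \<Omega> ?f" "smooth_on \<Omega> ?g"
    using snoc.prems assms by (auto intro: smooth_on_D_coord)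
  have f: "cmod (D_word v ?f x) \<le> A" if "length v \<le> length w" for v
    using snoc.prems(3)[of "v @ [i]"] that by simp
  have g: "cmod (D_word v ?g x) \<le> B" if "length v \<le> length w" for v
    using snoc.prems(4)[of "v @ [i]"] that by simp
  have "D_word (w @ [i]) (\<lambda>y. f y * g y) x = D_word w (\<lambda>y. ?f y * g y + f y * ?g y) x"
    using snoc.prems(1,2) \<open>open \<Omega>\<close> \<open>x \<in> \<Omega>\<close>
    by (auto intro!: D_word_cong[OF \<open>open \<Omega>\<close>] D_coord_mult smooth_on_differentiable[of \<Omega>])
  also have "\<dots> = D_word w (\<lambda>y. ?f y * g y) x + D_word w (\<lambda>y. f y * ?g y) x"
    using snoc.prems(1,2) \<open>open \<Omega>\<close> \<open>x \<in> \<Omega>\<close> sm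
    by (auto intro!: D_word_add[of \<Omega>] smooth_on_mult)
  also have "cmod \<dots> \<le> 2 ^ length w * A * B + 2 ^ length w * A * B"
    by (intro norm_triangle_mono snoc.IH sm snoc.prems(1,2) f g)
      (use snoc.prems(3,4) in auto)
  finally show ?case by (simp add: algebra_simps)
qed

lemma smooth_on_shift:
  assumes "smooth_on UNIV f"
  shows "smooth_on \<Omega> (\<lambda>y. f (y - a))"
proof -
  have "Ck_on k UNIV f \<Longrightarrow> Ck_on k \<Omega> (\<lambda>y. f (y - a))" for k
  proof (induction k arbitrary: f)
    case 0
    then show ?case
      by (auto intro!: continuous_on_compose2[of UNIV f] continuous_intros)
  next
    case (Suc k)
    have "(\<lambda>y. f (y - a)) differentiable (at x)" for x
      using differentiable_compose[of f "\<lambda>y. y - a" x] Suc.prems by (auto intro: differentiable_diff)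
    moreover have "Ck_on k \<Omega> (partial_deriv i (\<lambda>y. f (y - a)))" for i
      unfolding partial_deriv_shift using Suc by simp
    ultimately show ?case by simp
  qed
  then show ?thesis using assms by (simp add: smooth_on_def)
qed

section \<open>Symmetry of mixed partial derivatives\<close>

text \<open>The mean value inequality applied to \<open>g t - t *\<^sub>R A\<close>; for
  \<open>A = 0\<close> it is the Lipschitz bound.\<close>

lemma mean_value_linearization:
  fixes g :: "real \<Rightarrow> 'a::real_normed_vector"
  assumes "\<And>t. t \<in> {0..h} \<Longrightarrow> (g has_vector_derivative g' t) (at t)"
    and "\<And>t. t \<in> {0..h} \<Longrightarrow> norm (g' t - A) \<le> e" and "h \<ge> 0"
  shows "norm (g h - g 0 - h *\<^sub>R A) \<le> e * h"
proof -
  have "norm ((g h - h *\<^sub>R A) - (g 0 - 0 *\<^sub>R A)) \<le> e * norm (h - 0)"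
  proof (rule differentiable_bound[where S = "{0..h}" and f' = "\<lambda>t u. u *\<^sub>R (g' t - A)"])
    fix t assume t: "t \<in> {0..h}"
    show "((\<lambda>t. g t - t *\<^sub>R A) has_derivative (\<lambda>u. u *\<^sub>R (g' t - A))) (at t within {0..h})"
      using has_derivative_at_withinI[OF assms(1)[OF t, unfolded has_vector_derivative_def]]
      by (auto intro!: derivative_eq_intros simp: scaleR_diff_right)
    show "onorm (\<lambda>u. u *\<^sub>R (g' t - A)) \<le> e"
      using assms(2)[OF t] by (intro onorm_le) (auto simp: mult.commute[of e] intro!: mult_left_mono)
  qed (use assms(3) in auto)
  then show ?thesis using assms(3) by (simp add: algebra_simps)
qed

lemma partial_deriv_along_axis:
  assumes "f differentiable (at (p + t *\<^sub>R axis j 1))"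
  shows "((\<lambda>t. f (p + t *\<^sub>R axis j 1)) has_vector_derivative
           partial_deriv j f (p + t *\<^sub>R axis j 1)) (at t)"
proof -
  let ?f' = "frechet_derivative f (at (p + t *\<^sub>R axis j 1))"
  have f': "(f has_derivative ?f') (at (p + t *\<^sub>R axis j 1))"
    using assms frechet_derivative_works by blast
  have g: "((\<lambda>t. p + t *\<^sub>R axis j 1) has_derivative (\<lambda>u. u *\<^sub>R axis j (1::real))) (at t)"
    by (auto intro!: derivative_eq_intros)
  have "((\<lambda>t. f (p + t *\<^sub>R axis j 1)) has_derivative (\<lambda>u. ?f' (u *\<^sub>R axis j 1))) (at t)"
    using has_derivative_compose[OF g f'] .
  moreover have "?f' (u *\<^sub>R axis j 1) = u *\<^sub>R partial_deriv j f (p + t *\<^sub>R axis j 1)" for u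
    using linear_scale[OF has_derivative_linear[OF f']] by (simp add: partial_deriv_def)
  ultimately show ?thesis by (simp add: has_vector_derivative_def)
qed

text \<open>The second difference over a square of side \<open>h\<close> is linearized in direction
  \<open>j\<close> and then in direction \<open>i\<close>, the mixed derivative being within
  \<open>e\<close> of its value at \<open>x\<close> on the square. The difference is symmetric in
  \<open>i\<close> and \<open>j\<close>, and this forces the mixed derivatives to agree.\<close>

lemma second_difference_bound:
  fixes f :: "real ^ 'd \<Rightarrow> complex"
  assumes "open \<Omega>" "smooth_on \<Omega> f" "x \<in> \<Omega>" "e > 0"
  shows "\<exists>d>0. \<forall>h. 0 < h \<and> h < d \<longrightarrow>
     norm (f (x + h *\<^sub>R axis i 1 + h *\<^sub>R axis j 1) - f (x + h *\<^sub>R axis i 1) - f (x + h *\<^sub>R axis j 1) + f x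
        - h\<^sup>2 *\<^sub>R partial_deriv j (partial_deriv i f) x) \<le> e * h\<^sup>2"
proof -
  let ?e = "\<lambda>i. axis i (1::real) :: real ^ 'd"
  let ?F = "partial_deriv i f" and ?G = "partial_deriv j (partial_deriv i f)"
  have F: "smooth_on \<Omega> ?F" and G: "smooth_on \<Omega> ?G"
    using assms smooth_on_partial by blast+
  have "isCont ?G x"
    using smooth_on_continuous[OF G] assms continuous_on_eq_continuous_at by blast
  then obtain d1 where d1: "d1 > 0" "\<And>y. dist y x < d1 \<Longrightarrow> dist (?G y) (?G x) < e"
    using \<open>e > 0\<close> unfolding continuous_at_eps_delta by blast
  obtain d2 where d2: "d2 > 0" "ball x d2 \<subseteq> \<Omega>"
    using assms open_contains_ball by blast
  \<comment> \<open>Points of the square are at distance at most \<open>s + t < 2 * d\<close> from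
    \<open>x\<close>, hence the half.\<close>
  define d where "d = min d1 d2 / 2"
  have in_range: "x + s *\<^sub>R ?e i + t *\<^sub>R ?e j \<in> \<Omega>"
     "norm (?G (x + s *\<^sub>R ?e i + t *\<^sub>R ?e j) - ?G x) \<le> e"
    if "0 \<le> s" "s < d" "0 \<le> t" "t < d" for s t
  proof -
    have "dist (x + s *\<^sub>R ?e i + t *\<^sub>R ?e j) x = norm (s *\<^sub>R ?e i + t *\<^sub>R ?e j)"
      by (simp add: dist_norm add.assoc)
    also have "\<dots> \<le> s + t"
      using norm_triangle_ineq[of "s *\<^sub>R ?e i" "t *\<^sub>R ?e j"] that by simp
    finally have "dist (x + s *\<^sub>R ?e i + t *\<^sub>R ?e j) x < min d1 d2" using that by (simp add: d_def)
    then show "x + s *\<^sub>R ?e i + t *\<^sub>R ?e j \<in> \<Omega>"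
      "norm (?G (x + s *\<^sub>R ?e i + t *\<^sub>R ?e j) - ?G x) \<le> e"
      using d1(2)[of "x + s *\<^sub>R ?e i + t *\<^sub>R ?e j"] d2(2)
      by (auto simp: dist_norm[of "?G _"] dist_commute norm_minus_commute less_imp_le)
  qed
  have "norm (f (x + h *\<^sub>R ?e i + h *\<^sub>R ?e j) - f (x + h *\<^sub>R ?e i) - f (x + h *\<^sub>R ?e j) + f x
        - h\<^sup>2 *\<^sub>R ?G x) \<le> e * h\<^sup>2" if h: "0 < h" "h < d" for h
  proof -
    have inner: "norm (?F (x + s *\<^sub>R ?e i + h *\<^sub>R ?e j) - ?F (x + s *\<^sub>R ?e i) - h *\<^sub>R ?G x) \<le> e * h"
      if s: "s \<in> {0..h}" for s
    proof -
      have "((\<lambda>t. ?F (x + s *\<^sub>R ?e i + t *\<^sub>R ?e j)) has_vector_derivative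
          ?G (x + s *\<^sub>R ?e i + t *\<^sub>R ?e j)) (at t)" if "t \<in> {0..h}" for t
        using in_range(1)[of s t] s h that
        by (intro partial_deriv_along_axis smooth_on_differentiable[OF F]) auto
      from mean_value_linearization[OF this in_range(2)] show ?thesis using s h by auto
    qed
    have der: "((\<lambda>s. f (x + s *\<^sub>R ?e i + h *\<^sub>R ?e j) - f (x + s *\<^sub>R ?e i)) has_vector_derivative
        (?F (x + s *\<^sub>R ?e i + h *\<^sub>R ?e j) - ?F (x + s *\<^sub>R ?e i))) (at s)" if s: "s \<in> {0..h}" for s
    proof -
      have 1: "f differentiable (at ((x + h *\<^sub>R ?e j) + s *\<^sub>R ?e i))" "f differentiable (at (x + s *\<^sub>R ?e i))"
        using in_range(1)[of s h] in_range(1)[of s 0] s h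
        by (auto intro!: smooth_on_differentiable[OF assms(2)] simp: algebra_simps)
      show ?thesis
        using has_vector_derivative_diff[OF partial_deriv_along_axis[OF 1(1)] partial_deriv_along_axis[OF 1(2)]]
        by (simp add: add_ac)
    qed
    have "norm ((f (x + h *\<^sub>R ?e i + h *\<^sub>R ?e j) - f (x + h *\<^sub>R ?e i)) -
        (f (x + 0 *\<^sub>R ?e i + h *\<^sub>R ?e j) - f (x + 0 *\<^sub>R ?e i)) - h *\<^sub>R (h *\<^sub>R ?G x)) \<le> e * h * h"
      by (rule mean_value_linearization[of h "\<lambda>s. f (x + s *\<^sub>R ?e i + h *\<^sub>R ?e j) - f (x + s *\<^sub>R ?e i)"])
        (use der inner h in auto)
    then show ?thesis by (simp add: power2_eq_square algebra_simps)
  qed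
  moreover have "d > 0" using d1 d2 by (simp add: d_def)
  ultimately show ?thesis by blast
qed

lemma partial_deriv_commute:
  assumes "open \<Omega>" "smooth_on \<Omega> f" "x \<in> \<Omega>"
  shows "partial_deriv i (partial_deriv j f) x = partial_deriv j (partial_deriv i f) x"
proof (rule ccontr)
  let ?A = "partial_deriv i (partial_deriv j f) x" and ?B = "partial_deriv j (partial_deriv i f) x"
  assume "?A \<noteq> ?B"
  \<comment> \<open>Both mixed derivatives approximate the same second difference, which gives
    \<open>norm (?A - ?B) \<le> 2 * e\<close>, half of the true value.\<close>
  define e where "e = norm (?A - ?B) / 4"
  have "e > 0" using \<open>?A \<noteq> ?B\<close> by (simp add: e_def)
  obtain d1 where d1: "d1 > 0" "\<And>h. 0 < h \<Longrightarrow> h < d1 \<Longrightarrow>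
     norm (f (x + h *\<^sub>R axis i 1 + h *\<^sub>R axis j 1) - f (x + h *\<^sub>R axis i 1) - f (x + h *\<^sub>R axis j 1) + f x
        - h\<^sup>2 *\<^sub>R ?B) \<le> e * h\<^sup>2"
    using second_difference_bound[OF assms \<open>e > 0\<close>, of i j] by blast
  obtain d2 where d2: "d2 > 0" "\<And>h. 0 < h \<Longrightarrow> h < d2 \<Longrightarrow>
     norm (f (x + h *\<^sub>R axis j 1 + h *\<^sub>R axis i 1) - f (x + h *\<^sub>R axis j 1) - f (x + h *\<^sub>R axis i 1) + f x
        - h\<^sup>2 *\<^sub>R ?A) \<le> e * h\<^sup>2"
    using second_difference_bound[OF assms \<open>e > 0\<close>, of j i] by blast
  define h where "h = min d1 d2 / 2"
  have h: "0 < h" "h < d1" "h < d2" using d1 d2 by (auto simp: h_def)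
  define T where "T = f (x + h *\<^sub>R axis i 1 + h *\<^sub>R axis j 1) - f (x + h *\<^sub>R axis i 1) - f (x + h *\<^sub>R axis j 1) + f x"
  have "norm (T - h\<^sup>2 *\<^sub>R ?B) \<le> e * h\<^sup>2" using d1(2) h by (simp add: T_def)
  moreover have "norm (T - h\<^sup>2 *\<^sub>R ?A) \<le> e * h\<^sup>2"
    using d2(2)[of h] h by (simp add: T_def algebra_simps)
  ultimately have "norm ((T - h\<^sup>2 *\<^sub>R ?B) - (T - h\<^sup>2 *\<^sub>R ?A)) \<le> e * h\<^sup>2 + e * h\<^sup>2"
    by (rule norm_triangle_le_diff[OF add_mono])
  moreover have "(T - h\<^sup>2 *\<^sub>R ?B) - (T - h\<^sup>2 *\<^sub>R ?A) = h\<^sup>2 *\<^sub>R (?A - ?B)"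
    by (simp add: algebra_simps)
  ultimately have "norm (h\<^sup>2 *\<^sub>R (?A - ?B)) \<le> e * h\<^sup>2 + e * h\<^sup>2" by metis
  moreover have "norm (h\<^sup>2 *\<^sub>R (?A - ?B)) = h\<^sup>2 * norm (?A - ?B)" by (simp only: norm_scaleR) simp
  moreover have "e * h\<^sup>2 + e * h\<^sup>2 = h\<^sup>2 * (2 * e)" by simp
  ultimately have "h\<^sup>2 * norm (?A - ?B) \<le> h\<^sup>2 * (2 * e)" by metis
  then have "norm (?A - ?B) \<le> 2 * e" using h by simp
  then show False using \<open>e > 0\<close> by (simp add: e_def)
qed

lemma D_coord_commute:
  assumes "open \<Omega>" "smooth_on \<Omega> f" "x \<in> \<Omega>"
  shows "D_coord i (D_coord j f) x = D_coord j (D_coord i f) x"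
proof -
  have "D_coord i (D_coord j f) x = - partial_deriv i (partial_deriv j f) x" for i j
    using smooth_on_differentiable[OF smooth_on_partial[OF assms(2)] assms(3)]
    unfolding D_coord_def by (subst partial_deriv_mult) auto
  then show ?thesis using partial_deriv_commute[OF assms] by simp
qed

lemma D_word_move_front:
  assumes "open \<Omega>" "smooth_on \<Omega> f"
  shows "x \<in> \<Omega> \<Longrightarrow> D_word (p @ i # q) f x = D_word (i # p @ q) f x"
proof (induction p arbitrary: x)
  case (Cons j p)
  have "D_word ((j # p) @ i # q) f x = D_coord j (D_word (i # p @ q) f) x"
    using D_coord_cong[OF assms(1) Cons.prems Cons.IH] by simp
  also have "\<dots> = D_coord i (D_coord j (D_word (p @ q) f)) x"
    using D_coord_commute[OF assms(1) smooth_on_D_word[OF assms, of "p @ q"] Cons.prems, of j i] by simp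
  finally show ?case by simp
qed simp

lemma D_word_permute:
  assumes "open \<Omega>" "smooth_on \<Omega> f"
  shows "mset w = mset w' \<Longrightarrow> x \<in> \<Omega> \<Longrightarrow> D_word w f x = D_word w' f x"
proof (induction w arbitrary: w' x)
  case (Cons i w)
  then have "i \<in> set w'" by (metis list.set_intros(1) set_mset_mset)
  then obtain p q where w': "w' = p @ i # q" by (meson split_list)
  then have "mset w = mset (p @ q)" using Cons.prems(1) by simp
  then have "D_word (i # w) f x = D_word (i # p @ q) f x"
    using D_coord_cong[OF assms(1) Cons.prems(2) Cons.IH[OF \<open>mset w = mset (p @ q)\<close>]] by simp
  then show ?case using D_word_move_front[OF assms Cons.prems(2)] w' by simp
qed simp

section \<open>Words and multi-indices\<close>

text \<open>Spelled in the order of \<open>coords\<close>, so that \<open>D_multi\<close> is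
  \<open>D_word\<close> of this word before any derivatives are commuted.\<close>

definition mi_word :: "nat ^ 'd \<Rightarrow> 'd::finite list"
  where "mi_word \<alpha> = concat (map (\<lambda>i. replicate (\<alpha> $ i) i) coords)"

lemma D_multi_eq_D_word: "D_multi \<alpha> f = D_word (mi_word \<alpha>) f"
proof -
  have r: "D_word (replicate n i) f = (D_coord i ^^ n) f" for n i and f :: "real ^ 'a \<Rightarrow> complex"
    by (induction n) auto
  have "foldr (\<lambda>i. D_coord i ^^ (\<alpha> $ i)) xs f = D_word (concat (map (\<lambda>i. replicate (\<alpha> $ i) i) xs)) f" for xs
    by (induction xs) (auto simp: r)
  then show ?thesis by (simp add: D_multi_def mi_word_def)
qed

lemma count_mi_word: "count (mset (mi_word \<alpha>)) i = \<alpha> $ i"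
proof -
  have "count (mset (concat (map (\<lambda>i. replicate (\<alpha> $ i) i) xs))) i = (if i \<in> set xs then \<alpha> $ i else 0)"
    if "distinct xs" for xs
    using that by (induction xs) auto
  from this[OF coords(1)] show ?thesis by (simp add: mi_word_def coords(2))
qed

text \<open>What the symmetry of derivatives is for: \<open>V\<close> is controlled only through the
  ordered derivatives \<open>D_multi\<close>, while the iteration produces derivatives along
  arbitrary words.\<close>

lemma D_word_eq_D_multi:
  assumes "open \<Omega>" "smooth_on \<Omega> f" "x \<in> \<Omega>"
  shows "D_word w f x = D_multi (\<chi> i. count (mset w) i) f x"
  unfolding D_multi_eq_D_word
  by (rule D_word_permute[OF assms(1,2) _ assms(3)]) (simp add: multiset_eq_iff count_mi_word)

lemma length_mi_word: "length (mi_word \<alpha>) = mi_abs \<alpha>"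
  by (simp add: mi_word_def length_concat comp_def mi_abs_def sum_list_distinct_conv_sum_set coords)

lemma prod_list_mi_word: "(\<Prod>i\<leftarrow>mi_word \<alpha>. \<xi> $ i) = mi_power \<xi> \<alpha>"
proof -
  have "(\<Prod>i\<leftarrow>concat (map (\<lambda>i. replicate (\<alpha> $ i) i) xs). \<xi> $ i) = (\<Prod>i\<leftarrow>xs. (\<xi> $ i) ^ (\<alpha> $ i))" for xs
    by (induction xs) (auto simp: prod_list_replicate)
  then show ?thesis
    by (simp add: mi_word_def mi_power_def prod.distinct_set_conv_list[symmetric] coords)
qed

section \<open>A smooth bump function\<close>

text \<open>Dividing by \<open>t ^ j\<close> makes the family closed under differentiation up to
  linear combinations, so one derivative formula yields smoothness of every member.\<close>

definition eta :: "nat \<Rightarrow> real \<Rightarrow> real"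
  where "eta j t = (if t > 0 then exp (- 1 / t) / t ^ j else 0)"

lemma eta_has_derivative: "(eta j has_real_derivative (eta (j + 2) t - real j * eta (j + 1) t)) (at t)"
proof -
  consider "t > 0" | "t < 0" | "t = 0" by linarith
  then show ?thesis
  proof cases
    case 1
    have "((\<lambda>t. exp (- 1 / t) / t ^ j) has_real_derivative
        (exp (- 1 / t) * (1 / t\<^sup>2) * t ^ j - exp (- 1 / t) * (real j * t ^ (j - 1))) / (t ^ j * t ^ j)) (at t)"
      using 1 by (auto intro!: derivative_eq_intros simp: power2_eq_square)
    moreover have "(exp (- 1 / t) * (1 / t\<^sup>2) * t ^ j - exp (- 1 / t) * (real j * t ^ (j - 1))) / (t ^ j * t ^ j)
        = eta (j + 2) t - real j * eta (j + 1) t"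
      using 1 by (cases j) (auto simp: eta_def field_simps power2_eq_square)
    ultimately have "((\<lambda>t. exp (- 1 / t) / t ^ j) has_real_derivative
        eta (j + 2) t - real j * eta (j + 1) t) (at t)" by simp
    then show ?thesis
      by (rule has_field_derivative_transform_within_open[of _ _ _ "{0<..}"])
        (use 1 in \<open>auto simp: eta_def\<close>)
  next
    case 2
    have "((\<lambda>t. 0) has_real_derivative 0) (at t)" by simp
    then have "(eta j has_real_derivative 0) (at t)"
      by (rule has_field_derivative_transform_within_open[of _ _ _ "{..<0}"])
        (use 2 in \<open>auto simp: eta_def\<close>)
    then show ?thesis using 2 by (simp add: eta_def)
  next
    case 3
    \<comment> \<open>At \<open>0\<close> the right-hand difference quotient is
      \<open>x ^ (j + 1) / exp x\<close> taken at \<open>x = inverse h\<close>.\<close>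
    have "((\<lambda>x::real. x ^ (j + 1) / exp x) \<longlongrightarrow> 0) at_top" by (rule tendsto_power_div_exp_0)
    then have "((\<lambda>h::real. inverse h ^ (j + 1) / exp (inverse h)) \<longlongrightarrow> 0) (at_right 0)"
      by (rule filterlim_compose) (rule filterlim_inverse_at_top_right)
    then have r: "((\<lambda>h. eta j h / h) \<longlongrightarrow> 0) (at_right 0)"
      by (rule Lim_transform_eventually)
        (auto simp: eventually_at_right_field eta_def exp_minus field_simps intro!: exI[of _ 1])
    have "((\<lambda>h. 0) \<longlongrightarrow> (0::real)) (at_left 0)" by simp
    then have l: "((\<lambda>h. eta j h / h) \<longlongrightarrow> 0) (at_left 0)"
      by (rule Lim_transform_eventually)
        (auto simp: eventually_at_left_field eta_def intro!: exI[of _ "-1"])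
    have "((\<lambda>h. eta j h / h) \<longlongrightarrow> 0) (at 0)" using l r filterlim_at_split by blast
    then show ?thesis using 3 by (simp add: DERIV_def eta_def)
  qed
qed

text \<open>An algebra of functions that contains the bump and is stable under partial derivatives;
  differentiability of its members therefore gives smoothness at once.\<close>

inductive bump_alg :: "real \<Rightarrow> (real ^ 'd \<Rightarrow> complex) \<Rightarrow> bool" for r where
  const: "bump_alg r (\<lambda>_. c)"
| coord: "bump_alg r (\<lambda>y. complex_of_real (y $ i))"
| eta: "bump_alg r (\<lambda>y. complex_of_real (eta j (r\<^sup>2 - y \<bullet> y)))"
| add: "bump_alg r f \<Longrightarrow> bump_alg r g \<Longrightarrow> bump_alg r (\<lambda>y. f y + g y)"
| mult: "bump_alg r f \<Longrightarrow> bump_alg r g \<Longrightarrow> bump_alg r (\<lambda>y. f y * g y)"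

lemma bump_alg_partial_deriv:
  fixes f :: "real ^ 'd \<Rightarrow> complex"
  shows "bump_alg r f \<Longrightarrow> (\<forall>y. f differentiable (at y)) \<and> (\<forall>i. bump_alg r (partial_deriv i f))"
proof (induction rule: bump_alg.induct)
  case (const c)
  have "partial_deriv i (\<lambda>_. c) = (\<lambda>_. 0)" for i :: 'd by auto
  then show ?case by (simp add: bump_alg.const)
next
  case (coord i)
  have der: "((\<lambda>y. complex_of_real (y $ i)) has_derivative (\<lambda>h. complex_of_real (h $ i))) (at y)" for y :: "real ^ 'd"
    by (intro has_derivative_of_real bounded_linear_imp_has_derivative bounded_linear_vec_nth)
  have "partial_deriv k (\<lambda>y. complex_of_real (y $ i)) = (\<lambda>_. complex_of_real (axis k 1 $ i))" for k
    using partial_deriv_eq[OF der] by auto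
  moreover have "(\<lambda>y. complex_of_real (y $ i)) differentiable (at y)" for y :: "real ^ 'd"
    using der unfolding differentiable_def by blast
  ultimately show ?case by (simp add: bump_alg.const)
next
  case (eta j)
  have der: "((\<lambda>y. complex_of_real (eta j (r\<^sup>2 - y \<bullet> y))) has_derivative
     (\<lambda>h. complex_of_real ((- 2 * (y \<bullet> h)) * (eta (j + 2) (r\<^sup>2 - y \<bullet> y) - real j * eta (j + 1) (r\<^sup>2 - y \<bullet> y))))) (at y)"
    for y :: "real ^ 'd"
  proof -
    have q: "((\<lambda>y. r\<^sup>2 - y \<bullet> y) has_derivative (\<lambda>h. - 2 * (y \<bullet> h))) (at y)"
      by (auto intro!: derivative_eq_intros simp: inner_commute)
    define E where "E = eta (j + 2) (r\<^sup>2 - y \<bullet> y) - real j * eta (j + 1) (r\<^sup>2 - y \<bullet> y)"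
    have "(eta j has_derivative (\<lambda>h. E * h)) (at (r\<^sup>2 - y \<bullet> y))"
      using eta_has_derivative[of j "r\<^sup>2 - y \<bullet> y"] by (simp add: has_field_derivative_def E_def)
    from has_derivative_compose[OF q this]
    have "((\<lambda>y. eta j (r\<^sup>2 - y \<bullet> y)) has_derivative (\<lambda>h. (- 2 * (y \<bullet> h)) * E)) (at y)"
      by (simp add: mult.commute)
    from has_derivative_of_real[OF this] show ?thesis unfolding E_def .
  qed
  have "partial_deriv k (\<lambda>y. complex_of_real (eta j (r\<^sup>2 - y \<bullet> y))) =
     (\<lambda>y. (-2 * complex_of_real (y $ k)) * (complex_of_real (eta (j + 2) (r\<^sup>2 - y \<bullet> y)) +
        (- of_nat j) * complex_of_real (eta (j + 1) (r\<^sup>2 - y \<bullet> y))))" for k :: 'd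
    using partial_deriv_eq[OF der] by (simp add: fun_eq_iff inner_axis)
  moreover have "bump_alg r (\<lambda>y. (-2 * complex_of_real (y $ k)) * (complex_of_real (eta (j + 2) (r\<^sup>2 - y \<bullet> y)) +
        (- of_nat j) * complex_of_real (eta (j + 1) (r\<^sup>2 - y \<bullet> y))))" for k :: 'd
    by (intro bump_alg.mult bump_alg.add bump_alg.const bump_alg.coord bump_alg.eta)
  moreover have "(\<lambda>y. complex_of_real (eta j (r\<^sup>2 - y \<bullet> y))) differentiable (at y)" for y :: "real ^ 'd"
    using der unfolding differentiable_def by blast
  ultimately show ?case by simp
next
  case (add f g)
  have "partial_deriv k (\<lambda>y. f y + g y) = (\<lambda>y. partial_deriv k f y + partial_deriv k g y)" for k
    using add.IH by (auto simp: partial_deriv_add)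
  moreover have "bump_alg r (\<lambda>y. partial_deriv k f y + partial_deriv k g y)" for k
    by (intro bump_alg.add) (use add.IH in blast)+
  moreover have "(\<lambda>y. f y + g y) differentiable (at y)" for y
    by (intro differentiable_add) (use add.IH in blast)+
  ultimately show ?case by simp
next
  case (mult f g)
  have "partial_deriv k (\<lambda>y. f y * g y) = (\<lambda>y. partial_deriv k f y * g y + f y * partial_deriv k g y)" for k
    using mult.IH by (auto simp: partial_deriv_mult)
  moreover have "bump_alg r (\<lambda>y. partial_deriv k f y * g y + f y * partial_deriv k g y)" for k
    by (intro bump_alg.add bump_alg.mult) (use mult in blast)+
  moreover have "(\<lambda>y. f y * g y) differentiable (at y)" for y
    by (intro differentiable_mult) (use mult.IH in blast)+
  ultimately show ?case by simp
qed

lemma bump_alg_smooth: "bump_alg r f \<Longrightarrow> smooth_on \<Omega> f"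
proof -
  have "bump_alg r f \<Longrightarrow> Ck_on k \<Omega> f" for k
  proof (induction k arbitrary: f)
    case 0
    then show ?case using bump_alg_partial_deriv
      by (auto intro!: differentiable_imp_continuous_on differentiable_at_imp_differentiable_on)
  next
    case (Suc k)
    then show ?case using bump_alg_partial_deriv by auto
  qed
  then show "bump_alg r f \<Longrightarrow> smooth_on \<Omega> f" by (simp add: smooth_on_def)
qed

lemma bump_function_exists:
  assumes "r > 0"
  shows "\<exists>(b :: real ^ 'd \<Rightarrow> complex) A. (\<forall>\<Omega>. smooth_on \<Omega> b) \<and> b 0 = 1 \<and>
    (\<forall>y. y \<notin> cball 0 r \<longrightarrow> b y = 0) \<and> (\<forall>n. A n \<ge> 0) \<and> (\<forall>w y. cmod (D_word w b y) \<le> A (length w))"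
proof -
  \<comment> \<open>At the centre \<open>eta 0\<close> takes the value
    \<open>exp (- 1 / r\<^sup>2)\<close>; the constant factor normalizes \<open>b 0\<close> to
    \<open>1\<close>.\<close>
  define b :: "real ^ 'd \<Rightarrow> complex"
    where "b = (\<lambda>y. complex_of_real (exp (1 / r\<^sup>2)) * complex_of_real (eta 0 (r\<^sup>2 - y \<bullet> y)))"
  have sm: "smooth_on \<Omega> b" for \<Omega>
    unfolding b_def by (rule bump_alg_smooth[of r]) (intro bump_alg.intros)
  have b0: "b 0 = 1"
  proof -
    have "exp (1 / r\<^sup>2) * eta 0 (r\<^sup>2) = 1"
      using assms by (simp add: eta_def mult_exp_exp)
    moreover have "b 0 = complex_of_real (exp (1 / r\<^sup>2) * eta 0 (r\<^sup>2))" by (simp add: b_def)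
    ultimately show ?thesis by (simp only: of_real_1)
  qed
  have off: "b y = 0" if "y \<notin> cball 0 r" for y
  proof -
    have "norm y > r" using that by simp
    then have "y \<bullet> y \<ge> r\<^sup>2" using assms by (simp add: dot_square_norm power_mono)
    then show ?thesis by (simp add: b_def eta_def)
  qed
  have "\<exists>B\<ge>0. \<forall>y. cmod (D_word w b y) \<le> B" for w
  proof -
    have "continuous_on (cball 0 r) (D_word w b)"
      using continuous_on_subset[OF smooth_on_continuous[OF smooth_on_D_word[OF open_UNIV sm]]] by blast
    then have "compact (D_word w b ` cball 0 r)"
      by (rule compact_continuous_image) (rule compact_cball)
    from compact_imp_bounded[OF this] obtain B where B: "\<forall>v\<in>D_word w b ` cball 0 r. cmod v \<le> B"
      unfolding bounded_iff by auto
    have "cmod (D_word w b y) \<le> \<bar>B\<bar>" for y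
    proof (cases "y \<in> cball 0 r")
      case True
      then have "cmod (D_word w b y) \<le> B" using B by blast
      then show ?thesis by linarith
    next
      case False
      from D_word_eq_0_off[OF closed_cball off this] show ?thesis by simp
    qed
    then show ?thesis by (intro exI[of _ "\<bar>B\<bar>"]) auto
  qed
  then obtain B where B: "\<And>w. B w \<ge> 0" "\<And>w y. cmod (D_word w b y) \<le> B w" by metis
  \<comment> \<open>There are finitely many words of each length, so the bounds can be made to
    depend on the length alone.\<close>
  define A where "A n = (\<Sum>w | length w = n. B w)" for n
  have "cmod (D_word w b y) \<le> A (length w)" for w y
  proof -
    have "finite {v :: 'd list. length v = length w}"
      using finite_lists_length_eq[of "UNIV :: 'd set"] by simp
    then have "B w \<le> A (length w)"
      unfolding A_def using B(1) by (intro member_le_sum) auto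
    then show ?thesis using B(2)[of w y] by linarith
  qed
  moreover have "A n \<ge> 0" for n unfolding A_def using B(1) by (intro sum_nonneg) auto
  ultimately show ?thesis using sm b0 off by (intro exI[of _ b] exI[of _ A]) simp
qed

section \<open>Fourier series on a cube\<close>

text \<open>\<open>lborel\<close> is the image of a product measure indexed by \<open>Basis\<close>;
  apart from Fubini the content is the reindexing of \<open>Basis\<close> by coordinates.\<close>

lemma lborel_integral_prod_vec:
  fixes \<phi> :: "'d::finite \<Rightarrow> real \<Rightarrow> complex"
  assumes int: "\<And>i. integrable lborel (\<phi> i)"
  shows "(LINT y|(lborel :: (real ^ 'd) measure). (\<Prod>i\<in>UNIV. \<phi> i (y $ i))) = (\<Prod>i\<in>UNIV. LINT u|lborel. \<phi> i u)"
proof -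
  interpret product_sigma_finite "\<lambda>_ :: real ^ 'd. lborel :: real measure" ..
  let ?T = "\<lambda>f :: real ^ 'd \<Rightarrow> real. \<Sum>b\<in>Basis. f b *\<^sub>R b"
  have [measurable]: "\<phi> i \<in> borel_measurable borel" for i
    using borel_measurable_integrable[OF int[of i]] by simp
  have B: "(Basis :: (real ^ 'd) set) = (\<lambda>i. axis i 1) ` UNIV" by (auto simp: Basis_vec_def)
  have inj: "inj (\<lambda>i. axis i 1 :: real ^ 'd)" by (auto simp: inj_on_def axis_eq_axis)
  have T: "?T f $ i = f (axis i 1)" for f i
    unfolding B by (subst sum.reindex[OF inj]) (simp add: axis_def if_distrib cong: if_cong)
  have "(LINT y|(lborel :: (real ^ 'd) measure). (\<Prod>i\<in>UNIV. \<phi> i (y $ i)))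
      = (LINT y|distr (\<Pi>\<^sub>M b\<in>(Basis :: (real ^ 'd) set). lborel) borel ?T. (\<Prod>i\<in>UNIV. \<phi> i (y $ i)))"
    using lborel_eq[where 'a = "real ^ 'd"] by simp
  also have "\<dots> = (LINT f|(\<Pi>\<^sub>M b\<in>(Basis :: (real ^ 'd) set). lborel). (\<Prod>i\<in>UNIV. \<phi> i (?T f $ i)))"
    by (rule integral_distr) measurable
  also have "\<dots> = (LINT f|(\<Pi>\<^sub>M b\<in>(Basis :: (real ^ 'd) set). lborel). (\<Prod>b\<in>Basis. \<phi> (axis_index b) (f b)))"
    unfolding T by (subst (2) B, subst prod.reindex[OF inj]) simp
  also have "\<dots> = (\<Prod>b\<in>(Basis :: (real ^ 'd) set). LINT u|lborel. \<phi> (axis_index b) u)"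
    by (rule product_integral_prod) (auto intro: int)
  also have "\<dots> = (\<Prod>i\<in>UNIV. LINT u|lborel. \<phi> i u)"
    by (subst B, subst prod.reindex[OF inj]) simp
  finally show ?thesis .
qed

lemma integral_cis_period:
  fixes n :: int
  assumes "h > 0"
  shows "(LINT u|lborel. indicator {c - h..c + h} u *\<^sub>R cis (pi / h * (of_int n * u))) = (if n = 0 then 2 * h else 0)"
proof (cases "n = 0")
  case True
  then show ?thesis using assms by (simp add: scaleR_conv_of_real)
next
  case False
  define a where "a = pi / h * of_int n"
  have a: "a \<noteq> 0" using False assms by (simp add: a_def)
  have eq: "pi / h * (of_int n * u) = a * u" for u by (simp add: a_def)
  let ?F = "\<lambda>u. cis (a * u) / (\<i> * of_real a)"
  have cis_exp: "cis (a * u) = exp ((\<i> * of_real a) * of_real u)" for u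
    by (simp add: cis_conv_exp mult_ac)
  have der: "(?F has_vector_derivative cis (a * u)) (at u within S)" for u S
  proof -
    have "((\<lambda>z. exp ((\<i> * of_real a) * z) / (\<i> * of_real a)) has_field_derivative exp ((\<i> * of_real a) * of_real u)) (at (of_real u))"
      using a by (auto intro!: derivative_eq_intros)
    from has_vector_derivative_real_field[OF this] show ?thesis
      unfolding cis_exp by simp
  qed
  have "(LINT u|lborel. indicator {c - h..c + h} u *\<^sub>R cis (a * u)) = ?F (c + h) - ?F (c - h)"
    using assms by (intro integral_FTC_atLeastAtMost der) (auto intro!: continuous_intros)
  \<comment> \<open>The endpoints are \<open>2 * h\<close> apart, which is a whole number of
    periods.\<close>
  also have "cis (a * (c + h)) = cis (a * (c - h)) * cis (2 * pi * of_int n)"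
    using assms by (simp add: cis_mult a_def field_simps)
  also have "cis (2 * pi * of_int n) = 1" by (rule cis_multiple_2pi) simp
  finally show ?thesis unfolding eq using False by simp
qed

section \<open>Characters on a cube and Bessel's inequality\<close>

definition cube :: "real ^ 'd \<Rightarrow> real \<Rightarrow> (real ^ 'd) set"
  where "cube x h = {y. \<forall>i. \<bar>y $ i - x $ i\<bar> \<le> h}"

lemma cube_eq_cbox: "cube x h = cbox (\<chi> i. x $ i - h) (\<chi> i. x $ i + h)"
  by (auto simp: cube_def mem_box_cart abs_le_iff algebra_simps)

lemma compact_cube: "compact (cube x h)" by (simp add: cube_eq_cbox)

lemma cball_subset_cube: "cball x h \<subseteq> cube x h"
proof
  fix y assume "y \<in> cball x h"
  then have "norm (y - x) \<le> h" by (simp add: dist_norm norm_minus_commute)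
  then show "y \<in> cube x h"
    using component_le_norm_cart[of "y - x"] by (auto simp: cube_def intro: order_trans)
qed

text \<open>For \<open>t = pi / h\<close> these are periodic with period \<open>2 * h\<close> in
  each coordinate, so \<open>cube x h\<close> is a period cell for every centre \<open>x\<close> and
  the characters need no shift to the centre.\<close>

definition echar :: "real \<Rightarrow> int ^ 'd \<Rightarrow> real ^ 'd \<Rightarrow> complex"
  where "echar t k y = cis (t * (\<Sum>i\<in>UNIV. of_int (k $ i) * y $ i))"

lemma echar_add: "echar t (k + l) y = echar t k y * echar t l y"
  by (simp add: echar_def cis_mult sum.distrib algebra_simps)

lemma echar_uminus: "echar t (- k) y = cnj (echar t k y)"
  by (simp add: echar_def sum_negf cis_cnj)

lemma echar_diff: "echar t (k - l) y = echar t k y * cnj (echar t l y)"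
  using echar_add[of t k "- l"] by (simp add: echar_uminus)

lemma echar_0: "echar t 0 y = 1" by (simp add: echar_def)

lemma norm_echar: "cmod (echar t k y) = 1" by (simp add: echar_def)

lemma continuous_on_echar: "continuous_on S (echar t k)"
  unfolding echar_def by (intro continuous_intros)

lemma integrable_restrict_compact:
  fixes f :: "'a::euclidean_space \<Rightarrow> 'b::{banach, second_countable_topology}"
  assumes "compact Q" "continuous_on Q f"
  shows "integrable (restrict_space lborel Q) f"
  using borel_integrable_compact[OF assms] compact_imp_closed[OF assms(1)]
  by (subst integrable_restrict_space) auto

lemma integral_restrict_support:
  fixes f :: "'a::euclidean_space \<Rightarrow> 'b::{banach, second_countable_topology}"
  assumes "closed Q" "\<And>y. y \<notin> Q \<Longrightarrow> f y = 0"
  shows "(LINT y|restrict_space lborel Q. f y) = (LINT y|lborel. f y)"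
  using assms by (subst integral_restrict_space) (auto intro!: Bochner_Integration.integral_cong split: split_indicator)

lemma echar_orthogonal:
  fixes k :: "int ^ 'd"
  assumes "h > 0"
  shows "(LINT y|restrict_space lborel (cube x h). echar (pi / h) k y) = (if k = 0 then (2 * h) ^ CARD('d) else 0)"
proof -
  let ?\<phi> = "\<lambda>i u. indicator {x $ i - h..x $ i + h} u *\<^sub>R cis (pi / h * (of_int (k $ i) * u))"
  have "(LINT y|restrict_space lborel (cube x h). echar (pi / h) k y) = (LINT y|lborel. indicator (cube x h) y *\<^sub>R echar (pi / h) k y)"
    using borel_closed[OF compact_imp_closed[OF compact_cube]] by (subst integral_restrict_space) simp_all
  also have "\<dots> = (LINT y|lborel. (\<Prod>i\<in>UNIV. ?\<phi> i (y $ i)))"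
  proof (intro Bochner_Integration.integral_cong refl)
    fix y :: "real ^ 'd"
    have "echar (pi / h) k y = (\<Prod>i\<in>UNIV. cis (pi / h * (of_int (k $ i) * y $ i)))"
      by (simp add: echar_def sum_distrib_left cis_conv_exp exp_sum)
    moreover have "indicator (cube x h) y = (\<Prod>i\<in>UNIV. indicator {x $ i - h..x $ i + h} (y $ i) :: real)"
      by (auto simp: cube_eq_cbox mem_box_cart indicator_def)
    ultimately show "indicator (cube x h) y *\<^sub>R echar (pi / h) k y = (\<Prod>i\<in>UNIV. ?\<phi> i (y $ i))"
      by (simp add: scaleR_conv_of_real prod.distrib)
  qed
  also have "\<dots> = (\<Prod>i\<in>UNIV. LINT u|lborel. ?\<phi> i u)"
    using assms by (intro lborel_integral_prod_vec borel_integrable_compact compact_Icc continuous_intros) auto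
  also have "\<dots> = (\<Prod>i\<in>UNIV. if k $ i = 0 then complex_of_real (2 * h) else 0)"
    by (simp only: integral_cis_period[OF assms]) (simp add: if_distrib cong: if_cong)
  also have "\<dots> = (if k = 0 then (2 * h) ^ CARD('d) else 0)"
    using assms by (auto simp: vec_eq_iff)
  finally show ?thesis .
qed

text \<open>The square of \<open>v * f - S\<close> has nonnegative integral, where \<open>v\<close>
  is the volume of the cube and \<open>S / v\<close> the orthogonal projection of \<open>f\<close>
  onto the characters in \<open>F\<close>. The coefficients are not normalized by the volume, which
  is why it appears on the right.\<close>

lemma Bessel_inequality_cube:
  fixes f :: "real ^ 'd \<Rightarrow> complex"
  assumes "h > 0" and f: "continuous_on UNIV f" and off: "\<And>y. y \<notin> cube x h \<Longrightarrow> f y = 0" and "finite F"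
  shows "(\<Sum>k\<in>F. (cmod (LINT y|lborel. f y * echar (pi / h) (- k) y))\<^sup>2)
           \<le> (2 * h) ^ CARD('d) * (LINT y|lborel. (cmod (f y))\<^sup>2)"
proof -
  let ?M = "restrict_space lborel (cube x h)" and ?e = "echar (pi / h)"
  define c where "c k = (LINT y|?M. f y * ?e (- k) y)" for k
  have c_eq: "c k = (LINT y|lborel. f y * ?e (- k) y)" for k
    unfolding c_def using off compact_imp_closed[OF compact_cube]
    by (intro integral_restrict_support) auto
  define v where "v = (2 * h) ^ CARD('d)"
  have v: "v > 0" using assms by (simp add: v_def)
  define S where "S y = (\<Sum>k\<in>F. c k * ?e k y)" for y
  have fc: "continuous_on (cube x h) f" using f continuous_on_subset by blast
  have Sc: "continuous_on A S" for A
    unfolding S_def by (intro continuous_intros continuous_on_echar)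
  note int = integrable_restrict_compact[OF compact_cube]
  have cf: "(LINT y|?M. cnj (S y) * f y) = (\<Sum>k\<in>F. complex_of_real ((cmod (c k))\<^sup>2))"
  proof -
    have "(LINT y|?M. cnj (S y) * f y) = (LINT y|?M. (\<Sum>k\<in>F. cnj (c k) * (f y * ?e (- k) y)))"
      by (simp add: S_def sum_distrib_left sum_distrib_right echar_uminus mult_ac)
    also have "\<dots> = (\<Sum>k\<in>F. cnj (c k) * c k)"
      unfolding c_def
      by (subst Bochner_Integration.integral_sum)
        (intro int continuous_intros fc continuous_on_echar, simp)
    finally show ?thesis by (simp only: complex_norm_square mult.commute)
  qed
  have SS: "(LINT y|?M. cnj (S y) * S y) = v * (\<Sum>k\<in>F. complex_of_real ((cmod (c k))\<^sup>2))"
  proof -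
    have "cnj (S y) * S y = (\<Sum>l\<in>F. \<Sum>k\<in>F. cnj (c k) * c l * ?e (l - k) y)" for y
      by (simp add: S_def sum_product echar_diff mult_ac)
    then have "(LINT y|?M. cnj (S y) * S y) = (LINT y|?M. (\<Sum>l\<in>F. \<Sum>k\<in>F. cnj (c k) * c l * ?e (l - k) y))"
      by simp
    also have "\<dots> = (\<Sum>l\<in>F. \<Sum>k\<in>F. cnj (c k) * c l * (LINT y|?M. ?e (l - k) y))"
      by (subst Bochner_Integration.integral_sum,
          (intro int continuous_intros continuous_on_echar)[1], intro sum.cong refl,
          subst Bochner_Integration.integral_sum,
          (intro int continuous_intros continuous_on_echar)[1]) simp
    also have "\<dots> = (\<Sum>k\<in>F. cnj (c k) * c k * v)"
    proof -
      have "(LINT y|?M. ?e (l - k) y) = (if k = l then complex_of_real v else 0)" for k l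
        using echar_orthogonal[OF \<open>h > 0\<close>, of x "l - k"] by (auto simp: v_def)
      then show ?thesis
        using \<open>finite F\<close> by (simp add: if_distrib[of "\<lambda>u. _ * u"] cong: if_cong)
    qed
    finally show ?thesis by (simp add: complex_norm_square sum_distrib_left mult_ac del: of_real_power)
  qed
  define N where "N = (\<Sum>k\<in>F. (cmod (c k))\<^sup>2)"
  have i1: "integrable ?M (\<lambda>y. complex_of_real ((cmod (f y))\<^sup>2))"
    and i2: "integrable ?M (\<lambda>y. cnj (S y) * f y)" and i3: "integrable ?M (\<lambda>y. cnj (S y) * S y)"
    by (intro int continuous_intros fc Sc)+
  have i2': "integrable ?M (\<lambda>y. cnj (cnj (S y) * f y))" using i2 by (simp only: integrable_cnj)
  have cf': "(LINT y|?M. cnj (cnj (S y) * f y)) = (\<Sum>k\<in>F. complex_of_real ((cmod (c k))\<^sup>2))"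
    by (subst Bochner_Integration.integral_cnj) (simp only: cf cnj_sum complex_cnj_complex_of_real)
  have pw: "complex_of_real ((cmod (v * f y - S y))\<^sup>2) = of_real (v\<^sup>2) * complex_of_real ((cmod (f y))\<^sup>2)
      - of_real v * (cnj (S y) * f y) - of_real v * cnj (cnj (S y) * f y) + cnj (S y) * S y" for y
    unfolding complex_norm_square by (simp add: algebra_simps power2_eq_square)
  have "complex_of_real (LINT y|?M. (cmod (v * f y - S y))\<^sup>2)
      = of_real (v\<^sup>2) * (LINT y|?M. complex_of_real ((cmod (f y))\<^sup>2)) - of_real v * (LINT y|?M. cnj (S y) * f y)
      - of_real v * (LINT y|?M. cnj (cnj (S y) * f y)) + (LINT y|?M. cnj (S y) * S y)"
    unfolding integral_complex_of_real[symmetric] pw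
    using i1 i2 i2' i3
    by (simp only: Bochner_Integration.integral_add Bochner_Integration.integral_diff
        integral_mult_right_zero integrable_mult_right Bochner_Integration.integrable_diff)
  also have "\<dots> = complex_of_real (v\<^sup>2 * (LINT y|?M. (cmod (f y))\<^sup>2) - v * N)"
    unfolding cf' cf SS integral_complex_of_real by (simp add: N_def)
  finally have "(LINT y|?M. (cmod (v * f y - S y))\<^sup>2) = v\<^sup>2 * (LINT y|?M. (cmod (f y))\<^sup>2) - v * N"
    by (simp only: of_real_eq_iff)
  moreover have "0 \<le> (LINT y|?M. (cmod (v * f y - S y))\<^sup>2)" by simp
  ultimately have "0 \<le> v\<^sup>2 * (LINT y|?M. (cmod (f y))\<^sup>2) - v * N" by metis
  then have "0 \<le> v * (v * (LINT y|?M. (cmod (f y))\<^sup>2) - N)"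
    by (simp add: right_diff_distrib power2_eq_square[of v] mult.assoc)
  then have "N \<le> v * (LINT y|?M. (cmod (f y))\<^sup>2)" using v by (simp add: zero_le_mult_iff)
  also have "(LINT y|?M. (cmod (f y))\<^sup>2) = (LINT y|lborel. (cmod (f y))\<^sup>2)"
    using off compact_imp_closed[OF compact_cube] by (intro integral_restrict_support) auto
  finally show ?thesis by (simp add: N_def c_eq v_def)
qed

section \<open>Recovering a point value from Fourier coefficients\<close>

text \<open>Normalized powers of a function with a unique maximum at \<open>x\<close> concentrate at
  \<open>x\<close>, so weighted means of \<open>f\<close> that are all bounded by \<open>s\<close>
  force the bound at \<open>x\<close>.\<close>

lemma peak_kernel_bound:
  fixes \<phi> :: "'a::euclidean_space \<Rightarrow> real" and f :: "'a \<Rightarrow> complex"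
  assumes Q: "compact Q" and x: "x \<in> interior Q" and \<phi>: "continuous_on Q \<phi>" and f: "continuous_on Q f"
    and nn: "\<And>y. y \<in> Q \<Longrightarrow> 0 \<le> \<phi> y" and \<phi>x: "\<phi> x = 1"
    and peak: "\<And>y. y \<in> Q \<Longrightarrow> y \<noteq> x \<Longrightarrow> \<phi> y < 1"
    and bound: "\<And>n. cmod (LINT y|restrict_space lborel Q. of_real (\<phi> y ^ n) * f y)
                  \<le> s * (LINT y|restrict_space lborel Q. \<phi> y ^ n)"
  shows "cmod (f x) \<le> s"
proof (rule ccontr)
  assume "\<not> cmod (f x) \<le> s"
  \<comment> \<open>Half of the assumed excess: one \<open>e\<close> pays for the oscillation of
    \<open>f\<close> near \<open>x\<close>, the other remains and yields the contradiction.\<close>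
  define e where "e = (cmod (f x) - s) / 2"
  have e: "e > 0" using \<open>\<not> _\<close> by (simp add: e_def)
  let ?M = "restrict_space lborel Q"
  have xQ: "x \<in> Q" using x interior_subset by blast
  have clQ: "closed Q" using Q compact_imp_closed by blast
  have spM: "space ?M = Q" by (simp add: space_restrict_space)
  have finM: "emeasure ?M Q < \<infinity>" and emM: "\<And>A. A \<in> sets borel \<Longrightarrow> A \<subseteq> Q \<Longrightarrow> measure ?M A = measure lborel A"
    using clQ emeasure_compact_finite[OF Q] by (auto simp: emeasure_restrict_space measure_restrict_space)
  interpret finite_measure ?M
    using finM by (intro finite_measureI) (simp add: spM)
  note int = integrable_restrict_compact[OF Q]
  obtain d where d: "d > 0" "\<And>y. y \<in> Q \<Longrightarrow> dist y x < d \<Longrightarrow> cmod (f y - f x) < e"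
    using f xQ e unfolding continuous_on_iff dist_norm by blast
  have "compact (Q - ball x d)" using Q by (simp add: compact_diff)
  obtain q where q: "0 \<le> q" "q < 1" "\<And>y. y \<in> Q - ball x d \<Longrightarrow> \<phi> y \<le> q"
  proof (cases "Q - ball x d = {}")
    case True
    then show ?thesis using that[of 0] by (metis empty_iff order_refl zero_less_one)
  next
    case False
    obtain y0 where y0: "y0 \<in> Q - ball x d" "\<And>y. y \<in> Q - ball x d \<Longrightarrow> \<phi> y \<le> \<phi> y0"
      using continuous_attains_sup[OF \<open>compact (Q - ball x d)\<close> False continuous_on_subset[OF \<phi>]] by blast
    then have "y0 \<noteq> x" using d by auto
    then show ?thesis using that[of "\<phi> y0"] y0 nn peak by auto
  qed
  \<comment> \<open>Strictly between \<open>q\<close> and \<open>1\<close>: away from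
    \<open>x\<close> the powers decay like \<open>q ^ n\<close>, while their integral is at least a
    constant times \<open>q' ^ n\<close>, so the far part becomes negligible.\<close>
  define q' where "q' = (1 + q) / 2"
  have q': "q < q'" "q' < 1" "q' > 0" using q by (auto simp: q'_def)
  obtain d' where d': "d' > 0" "\<And>y. y \<in> Q \<Longrightarrow> dist y x < d' \<Longrightarrow> dist (\<phi> y) (\<phi> x) < 1 - q'"
    using \<phi> xQ q' unfolding continuous_on_iff by (metis diff_gt_0_iff_gt)
  obtain d'' where d'': "d'' > 0" "ball x d'' \<subseteq> Q" using x mem_interior by blast
  define U where "U = ball x (min d' d'')"
  define \<mu> where "\<mu> = measure lborel U"
  have \<mu>: "\<mu> > 0" unfolding \<mu>_def U_def using content_ball_pos[of "min d' d''" x] d' d'' by simp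
  have U: "U \<subseteq> Q" "U \<in> sets ?M" "\<And>y. y \<in> U \<Longrightarrow> \<phi> y \<ge> q'"
  proof -
    show "U \<subseteq> Q" using d'' by (auto simp: U_def)
    then show "U \<in> sets ?M" using clQ by (auto simp: sets_restrict_space_iff U_def)
    show "\<phi> y \<ge> q'" if "y \<in> U" for y
      using that d'(2)[of y] \<open>U \<subseteq> Q\<close> \<phi>x by (auto simp: U_def dist_commute dist_real_def)
  qed
  define I where "I n = (LINT y|?M. \<phi> y ^ n)" for n
  have I_ge: "I n \<ge> \<mu> * q' ^ n" for n
  proof -
    have "\<mu> * q' ^ n = (LINT y|?M. q' ^ n * indicator U y)"
      using U emM[of U] by (simp add: \<mu>_def U_def mult.commute)
    also have "\<dots> \<le> I n"
      unfolding I_def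
    proof (rule integral_mono)
      show "integrable ?M (\<lambda>y. q' ^ n * indicator U y)"
        using U(2) by (intro integrable_mult_right integrable_real_indicator) (simp_all add: less_top[symmetric])
      show "integrable ?M (\<lambda>y. \<phi> y ^ n)" by (intro int continuous_intros \<phi>)
      show "q' ^ n * indicator U y \<le> \<phi> y ^ n" if "y \<in> space ?M" for y
        using that U(3)[of y] nn[of y] q' power_mono[of q' "\<phi> y" n]
        by (cases "y \<in> U") (simp_all add: spM)
    qed
    finally show ?thesis .
  qed
  obtain B where B: "\<And>y. y \<in> Q \<Longrightarrow> cmod (f y - f x) \<le> B"
  proof -
    have "bounded ((\<lambda>y. f y - f x) ` Q)"
      by (intro compact_imp_bounded compact_continuous_image continuous_intros f Q)
    then show ?thesis using that unfolding bounded_iff by blast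
  qed
  then have B0: "B \<ge> 0" using xQ norm_ge_zero order_trans by blast
  have key: "e * I n \<le> B * measure lborel Q * q ^ n" for n
  proof -
    have pw: "cmod (of_real (\<phi> y ^ n) * (f y - f x)) \<le> e * \<phi> y ^ n + B * q ^ n" if "y \<in> Q" for y
    proof (cases "y \<in> ball x d")
      case True
      then have "cmod (f y - f x) \<le> e" using d(2)[OF that] by (simp add: dist_commute)
      then have "\<phi> y ^ n * cmod (f y - f x) \<le> \<phi> y ^ n * e"
        using nn[OF that] by (intro mult_left_mono) auto
      moreover have "0 \<le> B * q ^ n" using B0 q by simp
      ultimately show ?thesis using nn[OF that] by (simp add: norm_mult norm_power mult.commute)
    next
      case False
      then have "\<phi> y ^ n * cmod (f y - f x) \<le> q ^ n * B"
        using q nn B that by (intro mult_mono power_mono) auto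
      moreover have "0 \<le> e * \<phi> y ^ n" using e nn[OF that] by simp
      ultimately show ?thesis using nn[OF that] by (simp add: norm_mult norm_power mult.commute)
    qed
    define J where "J = (LINT y|?M. of_real (\<phi> y ^ n) * f y)"
    define D where "D = (LINT y|?M. of_real (\<phi> y ^ n) * (f y - f x))"
    have "D = J - (LINT y|?M. of_real (\<phi> y ^ n) * f x)"
      unfolding D_def J_def right_diff_distrib
      by (rule Bochner_Integration.integral_diff) (intro int continuous_intros \<phi> f)+
    also have "(LINT y|?M. of_real (\<phi> y ^ n) * f x) = of_real (I n) * f x"
      unfolding I_def integral_complex_of_real[symmetric] by (rule integral_mult_left_zero)
    finally have "of_real (I n) * f x = J - D" by simp
    then have "cmod (of_real (I n) * f x) \<le> cmod J + cmod D" by (simp add: norm_triangle_ineq4)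
    also have "cmod J \<le> s * I n" using bound[of n] by (simp only: J_def I_def)
    finally have "cmod (of_real (I n) * f x) \<le> s * I n + cmod D" by simp
    also have "cmod D \<le> (LINT y|?M. cmod (of_real (\<phi> y ^ n) * (f y - f x)))"
      unfolding D_def by (rule integral_norm_bound)
    also have "\<dots> \<le> (LINT y|?M. e * \<phi> y ^ n + B * q ^ n)"
      by (rule integral_mono, (intro int continuous_intros \<phi> f)[1], (intro int continuous_intros \<phi> f)[1])
        (simp only: spM pw)
    also have "\<dots> = e * I n + B * q ^ n * measure lborel Q"
      unfolding I_def using emM[of Q] clQ
      by (subst Bochner_Integration.integral_add, (intro int continuous_intros \<phi> f)[1], (intro int continuous_intros \<phi> f)[1])
        (simp add: spM)
    finally have "cmod (f x) * I n \<le> s * I n + (e * I n + B * q ^ n * measure lborel Q)"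
      using I_ge[of n] mult_pos_pos[OF \<mu> zero_less_power[OF q'(3), of n]]
      by (simp add: norm_mult mult.commute)
    moreover have "cmod (f x) = s + 2 * e" by (simp add: e_def field_simps)
    ultimately show ?thesis by (simp add: algebra_simps)
  qed
  define W where "W = B * measure lborel Q"
  have "(\<lambda>n. W * (q / q') ^ n) \<longlonglongrightarrow> W * 0"
    using q q' by (intro tendsto_mult tendsto_const LIMSEQ_realpow_zero) auto
  moreover have "e * \<mu> > 0" using e \<mu> by simp
  ultimately have "eventually (\<lambda>n. W * (q / q') ^ n < e * \<mu>) sequentially"
    by (intro order_tendstoD(2)[of _ "W * 0"]) auto
  then obtain n where n: "W * (q / q') ^ n < e * \<mu>" by (auto simp: eventually_sequentially)
  have "e * (\<mu> * q' ^ n) \<le> W * q ^ n"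
    using key[of n] mult_left_mono[OF I_ge[of n], of e] e unfolding W_def by linarith
  moreover have "W * q ^ n < e * \<mu> * q' ^ n"
    using n q' by (simp add: power_divide field_simps)
  ultimately show False by simp
qed

definition trigpoly :: "real \<Rightarrow> (real ^ 'd \<Rightarrow> complex) \<Rightarrow> bool"
  where "trigpoly t f \<longleftrightarrow> (\<exists>F \<kappa>. finite F \<and> f = (\<lambda>y. \<Sum>k\<in>F. \<kappa> k * echar t k y))"

lemma trigpoly_monomial: "trigpoly t (\<lambda>y. c * echar t k y)"
  unfolding trigpoly_def by (intro exI[of _ "{k}"] exI[of _ "\<lambda>_. c"]) auto

lemma trigpoly_add:
  assumes "trigpoly t f" "trigpoly t g"
  shows "trigpoly t (\<lambda>y. f y + g y)"
proof -
  obtain F \<kappa> where F: "finite F" "f = (\<lambda>y. \<Sum>k\<in>F. \<kappa> k * echar t k y)"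
    using assms(1) unfolding trigpoly_def by blast
  obtain G \<nu> where G: "finite G" "g = (\<lambda>y. \<Sum>k\<in>G. \<nu> k * echar t k y)"
    using assms(2) unfolding trigpoly_def by blast
  have "f y + g y = (\<Sum>k\<in>F \<union> G. ((if k \<in> F then \<kappa> k else 0) + (if k \<in> G then \<nu> k else 0)) * echar t k y)" for y
  proof -
    have "f y = (\<Sum>k\<in>F \<union> G. (if k \<in> F then \<kappa> k else 0) * echar t k y)"
      unfolding F(2) by (rule sum.mono_neutral_cong_left) (use F G in auto)
    moreover have "g y = (\<Sum>k\<in>F \<union> G. (if k \<in> G then \<nu> k else 0) * echar t k y)"
      unfolding G(2) by (rule sum.mono_neutral_cong_left) (use F G in auto)
    ultimately show ?thesis by (simp add: sum.distrib distrib_right)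
  qed
  then show ?thesis
    unfolding trigpoly_def using F G
    by (intro exI[of _ "F \<union> G"] exI[of _ "\<lambda>k. (if k \<in> F then \<kappa> k else 0) + (if k \<in> G then \<nu> k else 0)"]) auto
qed

lemma trigpoly_mult_monomial:
  assumes "trigpoly t f"
  shows "trigpoly t (\<lambda>y. f y * (c * echar t l y))"
proof -
  obtain F \<kappa> where F: "finite F" "f = (\<lambda>y. \<Sum>k\<in>F. \<kappa> k * echar t k y)"
    using assms(1) unfolding trigpoly_def by blast
  have "f y * (c * echar t l y) = (\<Sum>k\<in>(\<lambda>k. k + l) ` F. (\<kappa> (k - l) * c) * echar t k y)" for y
    unfolding F(2) by (subst sum.reindex) (auto simp: inj_on_def sum_distrib_left sum_distrib_right echar_add mult_ac)
  then show ?thesis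
    unfolding trigpoly_def using F
    by (intro exI[of _ "(\<lambda>k. k + l) ` F"] exI[of _ "\<lambda>k. \<kappa> (k - l) * c"]) auto
qed

lemma trigpoly_mult:
  assumes "trigpoly t f" "trigpoly t g"
  shows "trigpoly t (\<lambda>y. f y * g y)"
proof -
  obtain G \<nu> where G: "finite G" "g = (\<lambda>y. \<Sum>k\<in>G. \<nu> k * echar t k y)"
    using assms(2) unfolding trigpoly_def by blast
  have "trigpoly t (\<lambda>y. f y * (\<Sum>k\<in>G. \<nu> k * echar t k y))"
    using \<open>finite G\<close>
  proof induction
    case empty
    show ?case using trigpoly_monomial[of t 0 0] by simp
  next
    case (insert k G)
    then show ?case
      using trigpoly_add[OF trigpoly_mult_monomial[OF assms(1), of "\<nu> k" k] insert.IH]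
      by (simp add: distrib_left)
  qed
  then show ?thesis by (simp add: G(2))
qed

lemma trigpoly_const: "trigpoly t (\<lambda>_. c)"
  using trigpoly_monomial[of t c 0] by (simp add: echar_0)

lemma trigpoly_prod:
  assumes "\<And>i. i \<in> I \<Longrightarrow> trigpoly t (f i)"
  shows "trigpoly t (\<lambda>y. \<Prod>i\<in>I. f i y)"
  using assms by (induction I rule: infinite_finite_induct) (auto intro: trigpoly_const trigpoly_mult)

lemma trigpoly_power: "trigpoly t f \<Longrightarrow> trigpoly t (\<lambda>y. f y ^ n)"
  by (induction n) (auto intro: trigpoly_const trigpoly_mult)

lemma trigpoly_cos: "trigpoly t (\<lambda>y. complex_of_real ((1 + cos (t * (y $ i - a))) / 2))"
proof -
  have "trigpoly t (\<lambda>y. 1 / 2 + (cis (- (t * a)) / 4 * echar t (axis i 1) y + cis (t * a) / 4 * echar t (- axis i 1) y))"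
    by (intro trigpoly_add trigpoly_const trigpoly_monomial)
  moreover have "1 / 2 + (cis (- (t * a)) / 4 * echar t (axis i 1) y + cis (t * a) / 4 * echar t (- axis i 1) y)
      = complex_of_real ((1 + cos (t * (y $ i - a))) / 2)" for y
  proof -
    have e: "echar t (axis i 1) y = cis (t * y $ i)"
      by (simp add: echar_def axis_def if_distrib[of "\<lambda>u. u * _"] if_distrib[of real_of_int] cong: if_cong)
    have "cis (- (t * a)) / 4 * cis (t * y $ i) + cis (t * a) / 4 * cnj (cis (t * y $ i))
       = (cis (t * (y $ i - a)) + cnj (cis (t * (y $ i - a)))) / 4"
      by (simp add: cis_cnj cis_mult right_diff_distrib add_divide_distrib)
    also have "\<dots> = complex_of_real (cos (t * (y $ i - a)) / 2)"
      by (simp add: complex_eq_iff)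
    finally show ?thesis by (simp add: e echar_uminus add_divide_distrib)
  qed
  ultimately show ?thesis by (simp only:)
qed

text \<open>The peak function is a product of factors \<open>(1 + cos) / 2\<close>, so its powers
  are trigonometric polynomials. Integrating such a power against \<open>f\<close> gives a finite
  combination of Fourier coefficients of \<open>f\<close>, whose weights are at most the integral of
  the power divided by the volume.\<close>

lemma pointwise_le_Fourier_sum:
  fixes f :: "real ^ 'd \<Rightarrow> complex"
  assumes h: "h > 0" and f: "continuous_on UNIV f" and off: "\<And>y. y \<notin> cube x h \<Longrightarrow> f y = 0"
    and S: "\<And>F. finite F \<Longrightarrow> (\<Sum>k\<in>F. cmod (LINT y|lborel. f y * echar (pi / h) (- k) y)) \<le> S"
  shows "cmod (f x) \<le> S / (2 * h) ^ CARD('d)"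
proof -
  define t where "t = pi / h"
  have t: "t > 0" using h by (simp add: t_def)
  define v where "v = (2 * h) ^ CARD('d)"
  have v: "v > 0" using h by (simp add: v_def)
  define \<phi> where "\<phi> y = (\<Prod>i\<in>UNIV. (1 + cos (t * (y $ i - x $ i))) / 2)" for y
  let ?M = "restrict_space lborel (cube x h)"
  note int = integrable_restrict_compact[OF compact_cube]
  have fac: "0 \<le> (1 + cos u) / 2" "(1 + cos u) / 2 \<le> 1" for u :: real
    using cos_ge_minus_one[of u] cos_le_one[of u] by (simp_all del: cos_ge_minus_one cos_le_one)
  have nn: "0 \<le> \<phi> y" for y unfolding \<phi>_def using fac by (intro prod_nonneg) auto
  have \<phi>c: "continuous_on A \<phi>" for A unfolding \<phi>_def by (intro continuous_intros) auto
  have "cmod (f x) \<le> S / v"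
  proof (rule peak_kernel_bound[where Q = "cube x h" and \<phi> = \<phi> and x = x])
    show "x \<in> interior (cube x h)"
      using h cball_subset_cube[of x h] by (auto simp: mem_interior intro!: exI[of _ h] ball_subset_cball[THEN subset_trans])
    \<comment> \<open>Since \<open>t * h = pi\<close>, the arguments of the cosines stay within one
      period on the cube, and \<open>x\<close> is the only peak there.\<close>
    show "\<phi> y < 1" if y: "y \<in> cube x h" "y \<noteq> x" for y
    proof -
      obtain i where i: "y $ i \<noteq> x $ i" using y(2) by (auto simp: vec_eq_iff)
      define u where "u = t * (y $ i - x $ i)"
      have "\<bar>y $ i - x $ i\<bar> \<le> h" using y(1) by (simp add: cube_def)
      then have "t * \<bar>y $ i - x $ i\<bar> \<le> t * h" using t by (intro mult_left_mono) auto
      then have u: "\<bar>u\<bar> \<le> pi" "u \<noteq> 0" using t h i by (auto simp: u_def t_def abs_mult)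
      have "cos \<bar>u\<bar> < cos 0" using u by (intro cos_monotone_0_pi) auto
      then have lt: "(1 + cos u) / 2 < 1" by simp
      have "\<phi> y = (1 + cos u) / 2 * (\<Prod>j\<in>UNIV - {i}. (1 + cos (t * (y $ j - x $ j))) / 2)"
        unfolding \<phi>_def u_def by (rule prod.remove) auto
      also have "\<dots> \<le> (1 + cos u) / 2 * 1"
        using fac by (intro mult_left_mono prod_le_1) auto
      finally show ?thesis using lt by simp
    qed
    show "cmod (LINT y|?M. complex_of_real (\<phi> y ^ n) * f y) \<le> S / v * (LINT y|?M. \<phi> y ^ n)" for n
    proof -
      define I where "I = (LINT y|?M. \<phi> y ^ n)"
      have "trigpoly t (\<lambda>y. (\<Prod>i\<in>UNIV. complex_of_real ((1 + cos (t * (y $ i - x $ i))) / 2)) ^ n)"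
        by (intro trigpoly_power trigpoly_prod trigpoly_cos)
      moreover have "complex_of_real (\<phi> y ^ n) = (\<Prod>i\<in>UNIV. complex_of_real ((1 + cos (t * (y $ i - x $ i))) / 2)) ^ n" for y
        by (simp add: \<phi>_def)
      ultimately obtain F \<kappa> where F: "finite F" "\<And>y. complex_of_real (\<phi> y ^ n) = (\<Sum>k\<in>F. \<kappa> k * echar t k y)"
        unfolding trigpoly_def by metis
      \<comment> \<open>Orthogonality extracts the coefficient. The power is nonnegative and
        characters have modulus \<open>1\<close>, so the integral of the power bounds every
        coefficient.\<close>
      have \<kappa>: "cmod (\<kappa> l) \<le> I / v" if "l \<in> F" for l
      proof -
        have "(LINT y|?M. complex_of_real (\<phi> y ^ n) * echar t (- l) y) = (LINT y|?M. (\<Sum>k\<in>F. \<kappa> k * echar t (k - l) y))"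
          unfolding F(2) by (simp add: sum_distrib_left sum_distrib_right echar_diff echar_uminus mult_ac)
        also have "\<dots> = (\<Sum>k\<in>F. \<kappa> k * (LINT y|?M. echar t (k - l) y))"
          by (subst Bochner_Integration.integral_sum, (intro int continuous_intros continuous_on_echar)[1]) simp
        also have "\<dots> = (\<Sum>k\<in>F. if k = l then \<kappa> k * v else 0)"
          using echar_orthogonal[OF h, of x] by (intro sum.cong) (auto simp: t_def v_def)
        also have "\<dots> = \<kappa> l * v" using F(1) that by simp
        finally have "cmod (\<kappa> l) * v = cmod (LINT y|?M. complex_of_real (\<phi> y ^ n) * echar t (- l) y)"
          using v by (simp add: norm_mult)
        also have "\<dots> \<le> (LINT y|?M. cmod (complex_of_real (\<phi> y ^ n) * echar t (- l) y))"
          by (rule integral_norm_bound)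
        also have "\<dots> = I" unfolding I_def using nn by (simp add: norm_mult norm_echar norm_power)
        finally show ?thesis using v by (simp add: field_simps)
      qed
      have I0: "I \<ge> 0" unfolding I_def using nn by simp
      have "(LINT y|?M. complex_of_real (\<phi> y ^ n) * f y) = (LINT y|?M. (\<Sum>k\<in>F. \<kappa> k * (f y * echar t k y)))"
        unfolding F(2) by (simp add: sum_distrib_left sum_distrib_right mult_ac)
      also have "\<dots> = (\<Sum>k\<in>F. \<kappa> k * (LINT y|?M. f y * echar t k y))"
        by (subst Bochner_Integration.integral_sum,
            (intro int continuous_intros continuous_on_echar continuous_on_subset[OF f] subset_UNIV)[1]) simp
      also have "\<dots> = (\<Sum>k\<in>F. \<kappa> k * (LINT y|lborel. f y * echar t k y))"
        using off compact_imp_closed[OF compact_cube]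
        by (intro sum.cong refl arg_cong[where f = "\<lambda>u. _ * u"] integral_restrict_support) auto
      also have "cmod \<dots> \<le> (\<Sum>k\<in>F. I / v * cmod (LINT y|lborel. f y * echar t k y))"
        using \<kappa> by (intro sum_norm_le) (simp only: norm_mult mult_right_mono norm_ge_zero)
      \<comment> \<open>The expansion pairs \<open>f\<close> with \<open>echar t k\<close>, whereas
        \<open>S\<close> bounds sums over \<open>echar t (- k)\<close>.\<close>
      also have "\<dots> = I / v * (\<Sum>k\<in>uminus ` F. cmod (LINT y|lborel. f y * echar t (- k) y))"
        by (subst sum.reindex) (auto simp: sum_distrib_left)
      also have "\<dots> \<le> I / v * S"
        using S[of "uminus ` F"] F(1) I0 v unfolding t_def by (intro mult_left_mono) auto
      finally show ?thesis by (simp add: I_def mult.commute)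
    qed
  qed (use nn \<phi>c compact_cube continuous_on_subset[OF f] in \<open>auto simp: \<phi>_def\<close>)
  then show ?thesis by (simp add: v_def)
qed

section \<open>Resonant frequencies\<close>

definition symbol :: "nat \<Rightarrow> (nat ^ 'd \<Rightarrow> real) \<Rightarrow> real ^ 'd \<Rightarrow> real"
  where "symbol m c \<xi> = (\<Sum>\<alpha> | mi_abs \<alpha> \<le> m. c \<alpha> * mi_power \<xi> \<alpha>)"

definition principal_symbol :: "nat \<Rightarrow> (nat ^ 'd \<Rightarrow> real) \<Rightarrow> real ^ 'd \<Rightarrow> real"
  where "principal_symbol m c \<xi> = (\<Sum>\<alpha> | mi_abs \<alpha> = m. c \<alpha> * mi_power \<xi> \<alpha>)"

definition coeff_sum :: "nat \<Rightarrow> (nat ^ 'd \<Rightarrow> real) \<Rightarrow> real"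
  where "coeff_sum m c = (\<Sum>\<alpha> | mi_abs \<alpha> \<le> m. \<bar>c \<alpha>\<bar>)"

lemma coeff_sum_nonneg: "coeff_sum m c \<ge> 0"
  by (simp add: coeff_sum_def sum_nonneg)

lemma mi_power_scaleR: "mi_power (s *\<^sub>R \<xi>) \<alpha> = s ^ mi_abs \<alpha> * mi_power \<xi> \<alpha>"
  by (simp add: mi_power_def mi_abs_def power_mult_distrib prod.distrib power_sum)

lemma abs_mi_power_le: "\<bar>mi_power \<xi> \<alpha>\<bar> \<le> norm \<xi> ^ mi_abs \<alpha>"
  unfolding mi_power_def mi_abs_def power_sum abs_prod
  by (intro prod_mono) (simp add: power_abs power_mono component_le_norm_cart)

lemma abs_mi_power_le_one_plus: "mi_abs \<alpha> \<le> n \<Longrightarrow> \<bar>mi_power \<xi> \<alpha>\<bar> \<le> (1 + norm \<xi>) ^ n"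
proof -
  assume n: "mi_abs \<alpha> \<le> n"
  have "\<bar>mi_power \<xi> \<alpha>\<bar> \<le> norm \<xi> ^ mi_abs \<alpha>" by (rule abs_mi_power_le)
  also have "\<dots> \<le> (1 + norm \<xi>) ^ mi_abs \<alpha>" by (intro power_mono) auto
  also have "\<dots> \<le> (1 + norm \<xi>) ^ n" using n by (intro power_increasing) auto
  finally show ?thesis .
qed

lemma principal_symbol_scaleR: "principal_symbol m c (s *\<^sub>R \<xi>) = s ^ m * principal_symbol m c \<xi>"
  by (simp add: principal_symbol_def mi_power_scaleR sum_distrib_left mult_ac)

lemma abs_symbol_le: "\<bar>symbol m c \<xi>\<bar> \<le> coeff_sum m c * (1 + norm \<xi>) ^ m"
proof -
  have "\<bar>symbol m c \<xi>\<bar> \<le> (\<Sum>\<alpha> | mi_abs \<alpha> \<le> m. \<bar>c \<alpha> * mi_power \<xi> \<alpha>\<bar>)"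
    unfolding symbol_def by (rule sum_abs)
  also have "\<dots> \<le> (\<Sum>\<alpha> | mi_abs \<alpha> \<le> m. \<bar>c \<alpha>\<bar> * (1 + norm \<xi>) ^ m)"
    by (intro sum_mono) (auto simp: abs_mult intro!: mult_left_mono abs_mi_power_le_one_plus)
  finally show ?thesis by (simp add: coeff_sum_def sum_distrib_right)
qed

lemma symbol_minus_principal_le:
  fixes c :: "nat ^ 'd \<Rightarrow> real"
  assumes "m \<ge> 1"
  shows "\<bar>symbol m c \<xi> - principal_symbol m c \<xi>\<bar> \<le> coeff_sum m c * (1 + norm \<xi>) ^ (m - 1)"
proof -
  let ?L = "{\<alpha> :: nat ^ 'd. mi_abs \<alpha> < m}"
  have fin: "finite ?L" "finite {\<alpha> :: nat ^ 'd. mi_abs \<alpha> = m}"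
    by (auto intro: finite_subset[OF _ finite_mi_abs_le[of m]])
  have split: "{\<alpha> :: nat ^ 'd. mi_abs \<alpha> \<le> m} = ?L \<union> {\<alpha>. mi_abs \<alpha> = m}" by auto
  have "symbol m c \<xi> = (\<Sum>\<alpha>\<in>?L. c \<alpha> * mi_power \<xi> \<alpha>) + principal_symbol m c \<xi>"
    unfolding symbol_def principal_symbol_def split using fin by (intro sum.union_disjoint) auto
  then have "symbol m c \<xi> - principal_symbol m c \<xi> = (\<Sum>\<alpha>\<in>?L. c \<alpha> * mi_power \<xi> \<alpha>)" by simp
  also have "\<bar>\<dots>\<bar> \<le> (\<Sum>\<alpha>\<in>?L. \<bar>c \<alpha> * mi_power \<xi> \<alpha>\<bar>)" by (rule sum_abs)
  also have "\<dots> \<le> (\<Sum>\<alpha>\<in>?L. \<bar>c \<alpha>\<bar> * (1 + norm \<xi>) ^ (m - 1))"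
    using assms by (intro sum_mono) (auto simp: abs_mult intro!: mult_left_mono abs_mi_power_le_one_plus)
  also have "\<dots> \<le> (\<Sum>\<alpha> | mi_abs \<alpha> \<le> m. \<bar>c \<alpha>\<bar> * (1 + norm \<xi>) ^ (m - 1))"
    using finite_mi_abs_le by (intro sum_mono2) auto
  finally show ?thesis by (simp add: coeff_sum_def sum_distrib_right)
qed

text \<open>The minimum over the compact unit sphere is positive by ellipticity, and homogeneity
  carries it to all frequencies.\<close>

lemma elliptic_lower_bound:
  fixes c :: "nat ^ 'd \<Rightarrow> real"
  assumes "elliptic m c"
  shows "\<exists>c0>0. \<forall>\<xi>. c0 * norm \<xi> ^ m \<le> \<bar>principal_symbol m c \<xi>\<bar>"
proof -
  let ?p = "\<lambda>\<xi>. \<bar>principal_symbol m c \<xi>\<bar>"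
  have "continuous_on (sphere 0 1) ?p"
    unfolding principal_symbol_def mi_power_def by (intro continuous_intros)
  moreover have "sphere (0 :: real ^ 'd) 1 \<noteq> {}" by simp
  ultimately obtain \<xi>0 :: "real ^ 'd" where \<xi>0: "\<xi>0 \<in> sphere 0 1" "\<And>\<xi>. \<xi> \<in> sphere 0 1 \<Longrightarrow> ?p \<xi>0 \<le> ?p \<xi>"
    using continuous_attains_inf[OF compact_sphere, of 0 1 ?p] by blast
  have nz: "principal_symbol m c \<xi> \<noteq> 0" if "\<xi> \<noteq> 0" for \<xi>
    using assms that unfolding elliptic_def principal_symbol_def by blast
  have "\<xi>0 \<noteq> 0" using \<xi>0(1) by auto
  then have pos: "?p \<xi>0 > 0" using nz by simp
  have "?p \<xi>0 * norm \<xi> ^ m \<le> ?p \<xi>" for \<xi>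
  proof (cases "\<xi> = 0")
    case False
    then have "?p \<xi>0 \<le> ?p ((1 / norm \<xi>) *\<^sub>R \<xi>)" by (intro \<xi>0(2)) auto
    then have "?p \<xi>0 \<le> (1 / norm \<xi>) ^ m * ?p \<xi>"
      by (simp add: principal_symbol_scaleR abs_mult)
    then show ?thesis using False by (simp add: power_divide field_simps)
  next
    case True
    then show ?thesis
      using principal_symbol_scaleR[of m c 0 \<xi>0] by (simp add: abs_mult power_abs mult.commute)
  qed
  then show ?thesis using pos by blast
qed

section \<open>Size and radial thickness of the resonant set\<close>

definition resonant :: "nat \<Rightarrow> (nat ^ 'd \<Rightarrow> real) \<Rightarrow> real \<Rightarrow> complex \<Rightarrow> (real ^ 'd) set"
  where "resonant m c \<delta> lam = {\<xi>. cmod (of_real (symbol m c \<xi>) - lam) < (1 + norm \<xi>) powr (real m - 1 + \<delta>)}"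

definition int_vec :: "int ^ 'd \<Rightarrow> real ^ 'd"
  where "int_vec k = (\<chi> i. of_int (k $ i))"

lemma norm_int_vec_ge_1:
  assumes "k \<noteq> 0"
  shows "norm (int_vec k) \<ge> 1"
proof -
  obtain i where "k $ i \<noteq> 0" using assms by (auto simp: vec_eq_iff)
  then have "1 \<le> \<bar>int_vec k $ i\<bar>" by (simp add: int_vec_def flip: of_int_abs)
  then show ?thesis using component_le_norm_cart[of "int_vec k" i] by linarith
qed

lemma power_diff_ge:
  fixes s t :: real
  assumes "0 \<le> l" "l \<le> s" "l \<le> t" "m \<ge> 1"
  shows "l ^ (m - 1) * \<bar>s - t\<bar> \<le> \<bar>s ^ m - t ^ m\<bar>"
proof -
  have *: "l ^ (m - 1) * (s - t) \<le> s ^ m - t ^ m" if "0 \<le> l" "l \<le> t" "t \<le> s" for s t :: real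
  proof -
    have "l ^ (m - 1) * (s - t) \<le> s ^ (m - 1) * (s - t)"
      using that by (intro mult_right_mono power_mono) auto
    also have "\<dots> = s ^ m - s ^ (m - 1) * t"
      using \<open>m \<ge> 1\<close> by (cases m) (simp_all add: algebra_simps)
    also have "\<dots> \<le> s ^ m - t ^ (m - 1) * t"
      using that by (intro diff_left_mono mult_right_mono power_mono) auto
    finally show ?thesis using \<open>m \<ge> 1\<close> by (cases m) (simp_all add: algebra_simps)
  qed
  show ?thesis
  proof (cases "t \<le> s")
    case True
    then have "l ^ (m - 1) * \<bar>s - t\<bar> \<le> s ^ m - t ^ m" using *[of t s] assms by simp
    then show ?thesis by linarith
  next
    case False
    then have "l ^ (m - 1) * \<bar>s - t\<bar> \<le> t ^ m - s ^ m" using *[of s t] assms by simp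
    then show ?thesis by linarith
  qed
qed

text \<open>Because \<open>m - 1 + \<delta> < m\<close>, the resonance error and the lower-order
  terms are absorbed by the principal part at large frequencies. The second bound needs only the
  growth of the symbol; the first uses ellipticity.\<close>

lemma resonant_frequency_bounds:
  fixes c :: "nat ^ 'd \<Rightarrow> real"
  assumes m: "m \<ge> 1" and "elliptic m c" and \<delta>: "0 < \<delta>" "\<delta> < 1"
  shows "\<exists>B\<ge>1. \<forall>lam \<xi>. cmod lam \<ge> 1 \<longrightarrow> \<xi> \<in> resonant m c \<delta> lam \<longrightarrow>
     norm \<xi> \<le> B * cmod lam powr (1 / m) \<and> cmod lam powr (1 / m) \<le> B * (1 + norm \<xi>)"
proof -
  obtain c0 where c0: "c0 > 0" "\<And>\<xi>. c0 * norm \<xi> ^ m \<le> \<bar>principal_symbol m c \<xi>\<bar>"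
    using elliptic_lower_bound[OF assms(2)] by blast
  define C where "C = coeff_sum m c + 1"
  have C: "C \<ge> 1" using coeff_sum_nonneg[of m c] by (simp add: C_def)
  \<comment> \<open>Beyond \<open>Y\<close> the lower-order terms are at most half of the principal
    part: \<open>Y\<close> solves \<open>C * 2 ^ m * Y powr (\<delta> - 1) = c0 / 2\<close>.\<close>
  define Y where "Y = (2 * C * 2 ^ m / c0) powr (1 / (1 - \<delta>))"
  define B where "B = C + 1 + Y + 2 / c0"
  have Y: "Y \<ge> 0" by (simp add: Y_def)
  have B: "B \<ge> 1" "B \<ge> C" "B \<ge> Y" "B \<ge> 1 + 2 / c0" using C c0 Y by (auto simp: B_def)
  have "norm \<xi> \<le> B * cmod lam powr (1 / m)" "cmod lam powr (1 / m) \<le> B * (1 + norm \<xi>)"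
    if lam: "cmod lam \<ge> 1" and res: "\<xi> \<in> resonant m c \<delta> lam" for lam \<xi>
  proof -
    define R where "R = cmod lam powr (1 / m)"
    have R1: "R \<ge> 1" unfolding R_def using lam by (intro ge_one_powr_ge_zero) auto
    have "R ^ m = R powr real m" using R1 by (simp add: powr_realpow)
    then have Rm: "R ^ m = cmod lam" using m lam by (simp add: R_def powr_powr)
    define X where "X = norm \<xi>"
    have X0: "X \<ge> 0" by (simp add: X_def)
    have d: "cmod (of_real (symbol m c \<xi>) - lam) < (1 + X) powr (real m - 1 + \<delta>)"
      using res by (simp add: resonant_def X_def)
    have pw: "(1 + X) powr (real m - 1 + \<delta>) \<le> (1 + X) ^ m"
      using X0 \<delta> by (subst powr_realpow[symmetric]) (auto intro!: powr_mono)
    have pw': "(1 + X) ^ (m - 1) \<le> (1 + X) powr (real m - 1 + \<delta>)"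
      using X0 \<delta> m by (subst powr_realpow[symmetric]) (auto intro!: powr_mono simp: of_nat_diff)
    have "cmod lam \<le> \<bar>symbol m c \<xi>\<bar> + cmod (of_real (symbol m c \<xi>) - lam)"
      using norm_triangle_ineq4[of "of_real (symbol m c \<xi>)" "of_real (symbol m c \<xi>) - lam"] by simp
    also have "\<dots> \<le> coeff_sum m c * (1 + X) ^ m + (1 + X) ^ m"
      using abs_symbol_le[of m c \<xi>] d pw by (simp add: X_def)
    also have "\<dots> = C * (1 + X) ^ m" by (simp add: C_def algebra_simps)
    also have "\<dots> \<le> C ^ m * (1 + X) ^ m"
      using C m X0 by (intro mult_right_mono self_le_power) auto
    finally have "R ^ m \<le> (C * (1 + X)) ^ m" by (simp add: Rm power_mult_distrib)
    then have "R \<le> C * (1 + X)" using m C X0 R1 by (subst (asm) power_mono_iff) auto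
    also have "\<dots> \<le> B * (1 + X)" using B X0 by (intro mult_right_mono) auto
    finally show "cmod lam powr (1 / m) \<le> B * (1 + norm \<xi>)" by (simp add: R_def X_def)
    have "X \<le> B * R"
    proof (cases "X \<le> 1 \<or> X \<le> Y")
      case True
      then have "X \<le> B" using B by auto
      also have "\<dots> \<le> B * R" using B R1 by simp
      finally show ?thesis .
    next
      case False
      then have X1: "X > 1" and XY: "X > Y" by auto
      have "\<bar>principal_symbol m c \<xi>\<bar> \<le> \<bar>symbol m c \<xi>\<bar> + coeff_sum m c * (1 + X) ^ (m - 1)"
        using symbol_minus_principal_le[OF m, of c \<xi>] by (simp add: X_def)
      also have "\<bar>symbol m c \<xi>\<bar> \<le> cmod lam + cmod (of_real (symbol m c \<xi>) - lam)"
        using norm_triangle_ineq[of lam "of_real (symbol m c \<xi>) - lam"] by simp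
      also have "coeff_sum m c * (1 + X) ^ (m - 1) \<le> coeff_sum m c * (1 + X) powr (real m - 1 + \<delta>)"
        using coeff_sum_nonneg pw' by (intro mult_left_mono)
      finally have "c0 * X ^ m \<le> cmod lam + C * (1 + X) powr (real m - 1 + \<delta>)"
        using c0(2)[of \<xi>] d by (simp add: C_def X_def algebra_simps)
      also have "(1 + X) powr (real m - 1 + \<delta>) \<le> (2 * X) powr (real m - 1 + \<delta>)"
        using X1 m \<delta> by (intro powr_mono2) auto
      also have "\<dots> = 2 powr (real m - 1 + \<delta>) * X powr (real m - 1 + \<delta>)"
        using X1 by (simp add: powr_mult)
      also have "\<dots> \<le> 2 ^ m * X powr (real m - 1 + \<delta>)"
        using \<delta> by (subst powr_realpow[symmetric]) (auto intro!: mult_right_mono powr_mono)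
      finally have 1: "c0 * X ^ m \<le> cmod lam + C * (2 ^ m * X powr (real m - 1 + \<delta>))" using C by simp
      have "(2 * C * 2 ^ m / c0) = Y powr (1 - \<delta>)"
        using \<delta> C c0 by (simp add: Y_def powr_powr)
      also have "\<dots> \<le> X powr (1 - \<delta>)" using Y XY \<delta> by (intro powr_mono2) auto
      finally have "2 * C * 2 ^ m \<le> c0 * X powr (1 - \<delta>)" using c0 by (simp add: field_simps)
      then have "(2 * C * 2 ^ m) * X powr (real m - 1 + \<delta>) \<le> (c0 * X powr (1 - \<delta>)) * X powr (real m - 1 + \<delta>)"
        by (intro mult_right_mono) auto
      also have "\<dots> = c0 * X ^ m"
        using X1 by (simp add: mult.assoc powr_add[symmetric] powr_realpow)
      finally have "c0 * X ^ m \<le> 2 * cmod lam" using 1 by simp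
      then have "X ^ m \<le> 2 / c0 * R ^ m" using c0 by (simp add: Rm field_simps)
      also have "\<dots> \<le> (1 + 2 / c0) * R ^ m" using R1 by (intro mult_right_mono) auto
      also have "\<dots> \<le> (1 + 2 / c0) ^ m * R ^ m"
        using c0 m R1 by (intro mult_right_mono self_le_power) auto
      finally have "X ^ m \<le> ((1 + 2 / c0) * R) ^ m" by (simp add: power_mult_distrib)
      then have "X \<le> (1 + 2 / c0) * R" using m X0 c0 R1 by (subst (asm) power_mono_iff) auto
      also have "\<dots> \<le> B * R" using B R1 by (intro mult_right_mono) auto
      finally show ?thesis .
    qed
    then show "norm \<xi> \<le> B * cmod lam powr (1 / m)" by (simp add: R_def X_def)
  qed
  then show ?thesis using B(1) by blast
qed

text \<open>Along the ray through \<open>k\<close> the principal symbol is \<open>u ^ m * P\<close>,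
  with \<open>P\<close> at least of order \<open>norm (int_vec k) ^ m\<close>. Two resonant scales
  make \<open>s ^ m * P\<close> and \<open>t ^ m * P\<close> close to the same \<open>lam\<close>;
  dividing by \<open>P\<close> bounds \<open>s - t\<close>. In frequency space, where lengths are
  larger by the radius, this is the thickness of the shell.\<close>

lemma resonant_scales_close:
  fixes c :: "nat ^ 'd \<Rightarrow> real"
  assumes m: "m \<ge> 1" and "elliptic m c" and \<delta>: "0 < \<delta>" "\<delta> < 1" and \<tau>: "\<tau> > 0"
  shows "\<exists>B\<ge>0. \<forall>lam k s t. cmod lam \<ge> 1 \<longrightarrow> k \<noteq> 0 \<longrightarrow> s \<in> {\<tau> / 2..\<tau>} \<longrightarrow> t \<in> {\<tau> / 2..\<tau>} \<longrightarrow>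
     s *\<^sub>R int_vec k \<in> resonant m c \<delta> lam \<longrightarrow> t *\<^sub>R int_vec k \<in> resonant m c \<delta> lam \<longrightarrow>
     \<bar>s - t\<bar> \<le> B * (cmod lam powr (1 / m)) powr (\<delta> - 1)"
proof -
  obtain c0 where c0: "c0 > 0" "\<And>\<xi>. c0 * norm \<xi> ^ m \<le> \<bar>principal_symbol m c \<xi>\<bar>"
    using elliptic_lower_bound[OF assms(2)] by blast
  obtain B1 where B1: "B1 \<ge> 1" "\<And>lam \<xi>. cmod lam \<ge> 1 \<Longrightarrow> \<xi> \<in> resonant m c \<delta> lam \<Longrightarrow>
      cmod lam powr (1 / m) \<le> B1 * (1 + norm \<xi>)"
    using resonant_frequency_bounds[OF assms(1-4)] by blast
  define C where "C = coeff_sum m c + 1"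
  have C: "C \<ge> 1" using coeff_sum_nonneg[of m c] by (simp add: C_def)
  define L where "L = c0 * (\<tau> / 2) ^ (m - 1)"
  have L: "L > 0" using c0 \<tau> by (simp add: L_def)
  define G where "G = B1 * (1 + \<tau>)"
  have G: "G > 0" using B1 \<tau> by (simp add: G_def)
  define B where "B = 2 * C * (1 + \<tau>) ^ m / L * (1 / G) powr (\<delta> - 1)"
  have B0: "B \<ge> 0" using C L \<tau> by (simp add: B_def)
  have "\<bar>s - t\<bar> \<le> B * (cmod lam powr (1 / m)) powr (\<delta> - 1)"
    if lam: "cmod lam \<ge> 1" and k: "k \<noteq> 0" and st: "s \<in> {\<tau> / 2..\<tau>}" "t \<in> {\<tau> / 2..\<tau>}"
      and res: "s *\<^sub>R int_vec k \<in> resonant m c \<delta> lam" "t *\<^sub>R int_vec k \<in> resonant m c \<delta> lam"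
    for lam k s t
  proof -
    define R where "R = cmod lam powr (1 / m)"
    have R1: "R \<ge> 1" unfolding R_def using lam by (intro ge_one_powr_ge_zero) auto
    define N where "N = norm (int_vec k)"
    have N1: "N \<ge> 1" using norm_int_vec_ge_1[OF k] by (simp add: N_def)
    define P where "P = principal_symbol m c (int_vec k)"
    define e where "e = real m - 1 + \<delta>"
    have e: "0 < e" "e \<le> m" using m \<delta> by (auto simp: e_def)
    have near: "cmod (of_real (u ^ m * P) - lam) \<le> C * ((1 + \<tau>) * N) powr e"
      if u: "u \<in> {\<tau> / 2..\<tau>}" and r: "u *\<^sub>R int_vec k \<in> resonant m c \<delta> lam" for u
    proof -
      define X where "X = norm (u *\<^sub>R int_vec k)"
      have X: "X \<ge> 0" "1 + X \<le> (1 + \<tau>) * N"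
      proof -
        have "X = u * N" using u \<tau> by (simp add: X_def N_def)
        moreover have "u * N \<le> \<tau> * N" using u N1 by (intro mult_right_mono) auto
        ultimately show "1 + X \<le> (1 + \<tau>) * N" using N1 unfolding distrib_right by linarith
      qed (simp add: X_def)
      have pw: "(1 + X) ^ (m - 1) \<le> (1 + X) powr e"
        using X \<delta> m by (subst powr_realpow[symmetric]) (auto intro!: powr_mono simp: of_nat_diff e_def)
      have "of_real (u ^ m * P) - lam = (of_real (symbol m c (u *\<^sub>R int_vec k)) - lam)
          - of_real (symbol m c (u *\<^sub>R int_vec k) - principal_symbol m c (u *\<^sub>R int_vec k))"
        by (simp add: principal_symbol_scaleR P_def)
      also have "cmod \<dots> \<le> cmod (of_real (symbol m c (u *\<^sub>R int_vec k)) - lam)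
          + \<bar>symbol m c (u *\<^sub>R int_vec k) - principal_symbol m c (u *\<^sub>R int_vec k)\<bar>"
        by (metis norm_of_real norm_triangle_ineq4)
      also have "\<dots> \<le> (1 + X) powr e + coeff_sum m c * (1 + X) ^ (m - 1)"
        using r symbol_minus_principal_le[OF m, of c "u *\<^sub>R int_vec k"]
        unfolding resonant_def X_def e_def mem_Collect_eq by linarith
      also have "\<dots> \<le> (1 + X) powr e + coeff_sum m c * (1 + X) powr e"
        using pw coeff_sum_nonneg by (intro add_left_mono mult_left_mono)
      also have "\<dots> = C * (1 + X) powr e" by (simp add: C_def algebra_simps)
      also have "\<dots> \<le> C * ((1 + \<tau>) * N) powr e"
        using X e C by (intro mult_left_mono powr_mono2) auto
      finally show ?thesis .
    qed
    have "\<bar>s ^ m * P - t ^ m * P\<bar> = cmod ((of_real (s ^ m * P) - lam) - (of_real (t ^ m * P) - lam))"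
      by (metis add_diff_cancel_right diff_add_cancel diff_add_eq_diff_diff_swap norm_of_real of_real_diff uminus_add_conv_diff)
    also have "\<dots> \<le> C * ((1 + \<tau>) * N) powr e + C * ((1 + \<tau>) * N) powr e"
      by (rule norm_triangle_le_diff[OF add_mono[OF near[OF st(1) res(1)] near[OF st(2) res(2)]]])
    finally have "\<bar>s ^ m - t ^ m\<bar> * \<bar>P\<bar> \<le> 2 * C * ((1 + \<tau>) * N) powr e"
      by (simp flip: abs_mult add: left_diff_distrib)
    moreover have "L * \<bar>s - t\<bar> * N ^ m \<le> \<bar>s ^ m - t ^ m\<bar> * \<bar>P\<bar>"
    proof -
      have "((\<tau> / 2) ^ (m - 1) * \<bar>s - t\<bar>) * (c0 * N ^ m) \<le> \<bar>s ^ m - t ^ m\<bar> * \<bar>P\<bar>"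
        using st \<tau> m c0 N1 by (intro mult_mono power_diff_ge) (auto simp: N_def P_def)
      then show ?thesis by (simp add: L_def mult_ac)
    qed
    ultimately have "L * \<bar>s - t\<bar> * N ^ m \<le> 2 * C * ((1 + \<tau>) * N) powr e" by linarith
    also have "\<dots> = 2 * C * (1 + \<tau>) powr e * N powr e" using \<tau> N1 by (simp add: powr_mult)
    also have "\<dots> \<le> 2 * C * (1 + \<tau>) ^ m * N powr e"
      using \<tau> e C by (intro mult_right_mono mult_left_mono) (auto simp: powr_realpow[symmetric] intro!: powr_mono)
    also have "N powr e = N powr (\<delta> - 1) * N ^ m"
    proof -
      have "e = (\<delta> - 1) + real m" by (simp add: e_def)
      then show ?thesis using N1 by (simp only: powr_add) (simp add: powr_realpow)
    qed
    finally have "(L * \<bar>s - t\<bar>) * N ^ m \<le> (2 * C * (1 + \<tau>) ^ m * N powr (\<delta> - 1)) * N ^ m"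
      by (simp add: mult.assoc)
    then have "L * \<bar>s - t\<bar> \<le> 2 * C * (1 + \<tau>) ^ m * N powr (\<delta> - 1)" using N1 by simp
    \<comment> \<open>The exponent is negative, so the lower bound for the frequency in terms of
      \<open>R\<close> is the one that counts; \<open>G\<close> collects its constants.\<close>
    also have "N powr (\<delta> - 1) \<le> (1 / G * R) powr (\<delta> - 1)"
    proof (rule powr_mono2')
      have "R \<le> B1 * (1 + norm (s *\<^sub>R int_vec k))" using B1(2)[OF lam res(1)] by (simp add: R_def)
      also have "\<dots> \<le> B1 * ((1 + \<tau>) * N)"
      proof (rule mult_left_mono)
        have "s * N \<le> \<tau> * N" using st N1 by (intro mult_right_mono) auto
        moreover have "norm (s *\<^sub>R int_vec k) = s * N" using st \<tau> by (simp add: N_def)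
        ultimately show "1 + norm (s *\<^sub>R int_vec k) \<le> (1 + \<tau>) * N"
          using N1 unfolding distrib_right by linarith
      qed (use B1 in simp)
      finally show "1 / G * R \<le> N" using G by (simp add: G_def field_simps)
    qed (use \<delta> G R1 in auto)
    also have "(1 / G * R) powr (\<delta> - 1) = (1 / G) powr (\<delta> - 1) * R powr (\<delta> - 1)"
      using G R1 by (simp only: powr_mult)
    finally have "L * \<bar>s - t\<bar> \<le> 2 * C * (1 + \<tau>) ^ m * ((1 / G) powr (\<delta> - 1) * R powr (\<delta> - 1))"
      using C \<tau> by simp
    then have "\<bar>s - t\<bar> \<le> B * R powr (\<delta> - 1)" using L by (simp add: B_def field_simps)
    then show ?thesis by (simp add: R_def)
  qed
  then show ?thesis using B0 by blast
qed

section \<open>Counting resonant lattice points\<close>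

text \<open>The absolute value covers the empty set, for which \<open>D\<close> may be
  negative.\<close>

lemma card_nat_diff_le:
  fixes S :: "nat set"
  assumes "finite S" "\<And>i j. i \<in> S \<Longrightarrow> j \<in> S \<Longrightarrow> \<bar>real i - real j\<bar> \<le> D"
  shows "real (card S) \<le> \<bar>D\<bar> + 1"
proof (cases "S = {}")
  case False
  have "S \<subseteq> {Min S..Max S}" using assms(1) by auto
  then have "card S \<le> card {Min S..Max S}" by (intro card_mono) auto
  also have "\<dots> = Suc (Max S) - Min S" by simp
  finally have "card S \<le> Suc (Max S) - Min S" .
  moreover have "\<bar>real (Max S) - real (Min S)\<bar> \<le> D" using assms False by (intro assms(2)) auto
  moreover have "Min S \<le> Max S" using assms(1) False by (metis Max_ge Min_in)
  ultimately show ?thesis by linarith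
qed simp

lemma card_int_box:
  "finite {k :: int ^ 'd. \<forall>i. \<bar>k $ i\<bar> \<le> int n}"
  "card {k :: int ^ 'd. \<forall>i. \<bar>k $ i\<bar> \<le> int n} \<le> (2 * n + 1) ^ CARD('d)"
proof -
  let ?P = "PiE (UNIV :: 'd set) (\<lambda>_. {- int n..int n})"
  have sub: "{k :: int ^ 'd. \<forall>i. \<bar>k $ i\<bar> \<le> int n} \<subseteq> vec_lambda ` ?P"
  proof
    fix k :: "int ^ 'd" assume "k \<in> {k. \<forall>i. \<bar>k $ i\<bar> \<le> int n}"
    then have "vec_nth k \<in> ?P" by (auto simp: abs_le_iff minus_le_iff)
    then show "k \<in> vec_lambda ` ?P" by (metis image_eqI vec_nth_inverse)
  qed
  have fin: "finite ?P" by (intro finite_PiE) auto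
  then show "finite {k :: int ^ 'd. \<forall>i. \<bar>k $ i\<bar> \<le> int n}" using sub finite_subset by blast
  have "card {k :: int ^ 'd. \<forall>i. \<bar>k $ i\<bar> \<le> int n} \<le> card ?P"
    using sub fin by (meson card_image_le card_mono finite_imageI order_trans)
  also have "\<dots> = (2 * n + 1) ^ CARD('d)"
  proof -
    have "nat (2 * int n) = 2 * n" by linarith
    then show ?thesis by (simp add: card_PiE nat_add_distrib)
  qed
  finally show "card {k :: int ^ 'd. \<forall>i. \<bar>k $ i\<bar> \<le> int n} \<le> (2 * n + 1) ^ CARD('d)" .
qed

text \<open>On a fixed lattice one would need a lattice point estimate for the shell. On average over the
  dilations of the lattice the count is elementary, because each ray meets the resonant set in a short
  interval.\<close>

lemma exists_dilation_few_resonant: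
  fixes c :: "nat ^ 'd \<Rightarrow> real"
  assumes m: "m \<ge> 1" and "elliptic m c" and \<delta>: "0 < \<delta>" "\<delta> < 1" and \<tau>: "\<tau> > 0"
  shows "\<exists>C\<ge>0. \<forall>lam. cmod lam \<ge> 1 \<longrightarrow> (\<exists>t\<in>{\<tau> / 2..\<tau>}.
     finite {k. t *\<^sub>R int_vec k \<in> resonant m c \<delta> lam} \<and>
     real (card {k. t *\<^sub>R int_vec k \<in> resonant m c \<delta> lam}) \<le> C * cmod lam powr ((real CARD('d) - 1 + \<delta>) / m))"
proof -
  obtain B1 where B1: "B1 \<ge> 1" "\<And>lam \<xi>. cmod lam \<ge> 1 \<Longrightarrow> \<xi> \<in> resonant m c \<delta> lam \<Longrightarrow>
      norm \<xi> \<le> B1 * cmod lam powr (1 / m)"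
    using resonant_frequency_bounds[OF assms(1-4)] by blast
  obtain B2 where B2: "B2 \<ge> 0" "\<And>lam k s t. cmod lam \<ge> 1 \<Longrightarrow> k \<noteq> 0 \<Longrightarrow> s \<in> {\<tau> / 2..\<tau>} \<Longrightarrow> t \<in> {\<tau> / 2..\<tau>} \<Longrightarrow>
     s *\<^sub>R int_vec k \<in> resonant m c \<delta> lam \<Longrightarrow> t *\<^sub>R int_vec k \<in> resonant m c \<delta> lam \<Longrightarrow>
     \<bar>s - t\<bar> \<le> B2 * (cmod lam powr (1 / m)) powr (\<delta> - 1)"
    using resonant_scales_close[OF assms] by blast
  let ?d = "CARD('d)"
  define K1 where "K1 = 4 * B1 / \<tau> + 1"
  define K2 where "K2 = 4 * B2 / \<tau> + 1"
  have K: "K1 \<ge> 0" "K2 \<ge> 0" using B1 B2 \<tau> by (auto simp: K1_def K2_def)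
  \<comment> \<open>The summand \<open>1\<close> pays for \<open>k = 0\<close>, whose dilations all
    coincide and which the argument along rays leaves out.\<close>
  define C where "C = 1 + K1 ^ ?d * K2"
  have C0: "C \<ge> 0" using K by (simp add: C_def)
  have "\<exists>t\<in>{\<tau> / 2..\<tau>}. finite {k. t *\<^sub>R int_vec k \<in> resonant m c \<delta> lam} \<and>
     real (card {k. t *\<^sub>R int_vec k \<in> resonant m c \<delta> lam}) \<le> C * cmod lam powr ((real ?d - 1 + \<delta>) / m)"
    if lam: "cmod lam \<ge> 1" for lam
  proof -
    define R where "R = cmod lam powr (1 / m)"
    have R1: "R \<ge> 1" unfolding R_def using lam by (intro ge_one_powr_ge_zero) auto
    \<comment> \<open>The average is taken over about \<open>R\<close> equally spaced dilations.
      Their spacing is of order \<open>1 / R\<close>, against resonant intervals of length of order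
      \<open>R powr (\<delta> - 1)\<close>, so each ray is hit about \<open>R powr \<delta>\<close>
      times.\<close>
    define J where "J = nat \<lceil>R\<rceil>"
    have J: "R \<le> J" "real J \<le> 2 * R" "J > 0" using R1 unfolding J_def by linarith+
    define n where "n = nat \<lfloor>2 * B1 * R / \<tau>\<rfloor>"
    have n: "real n \<le> 2 * B1 * R / \<tau>" using B1 R1 \<tau> by (simp add: n_def)
    define P where "P = {k :: int ^ 'd. \<forall>i. \<bar>k $ i\<bar> \<le> int n}"
    define t where "t j = \<tau> / 2 * (1 + real j / J)" for j
    have t: "t j \<in> {\<tau> / 2..\<tau>}" if "j < J" for j
    proof -
      have "real j / J \<le> 1" using that by simp
      then have "t j \<le> \<tau> / 2 * 2" unfolding t_def using \<tau> by (intro mult_left_mono) auto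
      moreover have "\<tau> / 2 * 1 \<le> t j" unfolding t_def using \<tau> by (intro mult_left_mono) auto
      ultimately show ?thesis by simp
    qed
    define S where "S j = {k. t j *\<^sub>R int_vec k \<in> resonant m c \<delta> lam}" for j
    have SP: "S j \<subseteq> P" if j: "j < J" for j
    proof
      fix k assume "k \<in> S j"
      then have "norm (t j *\<^sub>R int_vec k) \<le> B1 * R"
        using B1(2)[OF lam] unfolding S_def R_def by blast
      moreover have "\<tau> / 2 * norm (int_vec k) \<le> norm (t j *\<^sub>R int_vec k)"
        using mult_right_mono[of "\<tau> / 2" "t j" "norm (int_vec k)"] t[OF j] \<tau> by simp
      ultimately have le: "norm (int_vec k) \<le> 2 * B1 * R / \<tau>" using \<tau> by (simp add: field_simps)
      have "\<bar>k $ i\<bar> \<le> int n" for i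
      proof -
        have "real_of_int \<bar>k $ i\<bar> \<le> 2 * B1 * R / \<tau>"
          using component_le_norm_cart[of "int_vec k" i] le by (simp add: int_vec_def)
        then have "\<bar>k $ i\<bar> \<le> \<lfloor>2 * B1 * R / \<tau>\<rfloor>" by (simp only: le_floor_iff)
        then show ?thesis unfolding n_def by linarith
      qed
      then show "k \<in> P" by (simp add: P_def)
    qed
    have finP: "finite P" unfolding P_def by (rule card_int_box)
    have cardP: "real (card P) \<le> (K1 * R) ^ ?d"
    proof -
      have "real (card P) \<le> real ((2 * n + 1) ^ ?d)" unfolding P_def of_nat_le_iff by (rule card_int_box)
      also have "\<dots> = (2 * real n + 1) ^ ?d" by (simp add: add.commute)
      also have "\<dots> \<le> (K1 * R) ^ ?d"
      proof (rule power_mono)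
        have "2 * real n + 1 \<le> 2 * (2 * B1 * R / \<tau>) + R" using n R1 by linarith
        also have "\<dots> = K1 * R" by (simp add: K1_def algebra_simps)
        finally show "2 * real n + 1 \<le> K1 * R" .
      qed simp
      finally show ?thesis .
    qed
    have each: "real (card {j \<in> {..<J}. k \<in> S j}) \<le> K2 * R powr \<delta>" if k: "k \<noteq> 0" for k
    proof -
      define D where "D = 4 * B2 / \<tau> * R powr \<delta>"
      have "\<bar>real i - real j\<bar> \<le> D" if ij: "i \<in> {j \<in> {..<J}. k \<in> S j}" "j \<in> {j \<in> {..<J}. k \<in> S j}" for i j
      proof -
        have "\<bar>t i - t j\<bar> \<le> B2 * R powr (\<delta> - 1)"
          using ij t k unfolding R_def by (intro B2(2)[OF lam k]) (auto simp: S_def)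
        moreover have "t i - t j = \<tau> / (2 * J) * (real i - real j)"
          using J(3) by (simp add: t_def field_simps)
        ultimately have "\<tau> / (2 * J) * \<bar>real i - real j\<bar> \<le> B2 * R powr (\<delta> - 1)"
          using \<tau> by (simp add: abs_mult)
        then have "\<bar>real i - real j\<bar> \<le> 2 * B2 / \<tau> * R powr (\<delta> - 1) * J"
          using \<tau> J(3) by (simp add: field_simps)
        also have "\<dots> \<le> 2 * B2 / \<tau> * R powr (\<delta> - 1) * (2 * R)"
          using B2(1) \<tau> J(2) by (intro mult_left_mono) auto
        also have "\<dots> = 4 * B2 / \<tau> * (R powr (\<delta> - 1) * R powr 1)" using R1 by simp
        also have "\<dots> = D" unfolding powr_add[symmetric] D_def by simp
        finally show ?thesis .
      qed
      then have "real (card {j \<in> {..<J}. k \<in> S j}) \<le> \<bar>D\<bar> + 1" by (intro card_nat_diff_le) auto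
      also have "\<bar>D\<bar> = D" using B2(1) \<tau> by (simp add: D_def)
      also have "1 \<le> R powr \<delta>" using R1 \<delta> by (intro ge_one_powr_ge_zero) auto
      finally show ?thesis by (simp add: D_def K2_def algebra_simps)
    qed
    \<comment> \<open>Pairs of a dilation and a nonzero resonant \<open>k\<close> are counted in
      both orders. The box has about \<open>R ^ ?d\<close> points, so some dilation sees at most
      \<open>R powr (real ?d - 1 + \<delta>)\<close> of them up to a constant.\<close>
    have "\<exists>j<J. real (card (S j - {0})) * J \<le> (K1 * R) ^ ?d * (K2 * R powr \<delta>)"
    proof (rule ccontr)
      assume "\<not> ?thesis"
      then have gt: "(K1 * R) ^ ?d * (K2 * R powr \<delta>) < real (card (S j - {0})) * J" if "j < J" for j
        using that by auto
      have "(\<Sum>j<J. (K1 * R) ^ ?d * (K2 * R powr \<delta>)) < (\<Sum>j<J. real (card (S j - {0})) * J)"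
        using J(3) gt by (intro sum_strict_mono) auto
      moreover have "(\<Sum>j<J. real (card (S j - {0}))) = (\<Sum>k\<in>P - {0}. real (card {j \<in> {..<J}. k \<in> S j}))"
      proof -
        have "(\<Sum>j<J. real (card (S j - {0}))) = (\<Sum>j<J. \<Sum>k\<in>P - {0}. if k \<in> S j then 1 else 0)"
        proof (intro sum.cong refl)
          fix j assume "j \<in> {..<J}"
          then have "S j - {0} = {k \<in> P - {0}. k \<in> S j}" using SP by auto
          then show "real (card (S j - {0})) = (\<Sum>k\<in>P - {0}. if k \<in> S j then 1 else 0)"
            using finP by (simp add: sum.If_cases Int_def)
        qed
        also have "\<dots> = (\<Sum>k\<in>P - {0}. \<Sum>j<J. if k \<in> S j then 1 else 0)" by (rule sum.swap)
        finally show ?thesis by (simp add: sum.If_cases Int_def)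
      qed
      moreover have "\<dots> \<le> (\<Sum>k\<in>P - {0}. K2 * R powr \<delta>)"
        using each by (intro sum_mono) auto
      moreover have "\<dots> \<le> (K1 * R) ^ ?d * (K2 * R powr \<delta>)"
      proof -
        have "real (card (P - {0})) \<le> real (card P)" using finP by (simp add: card_Diff1_le)
        then show ?thesis using cardP K by (auto intro!: mult_right_mono)
      qed
      ultimately have "J * ((K1 * R) ^ ?d * (K2 * R powr \<delta>)) < ((K1 * R) ^ ?d * (K2 * R powr \<delta>)) * J"
        using J(3) by (auto simp: sum_distrib_right[symmetric] intro: order.strict_trans2 mult_right_mono)
      then show False by simp
    qed
    then obtain j where j: "j < J" "real (card (S j - {0})) * J \<le> (K1 * R) ^ ?d * (K2 * R powr \<delta>)" by blast
    define Q where "Q = R powr (real ?d - 1 + \<delta>)"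
    have d1: "real ?d \<ge> 1" by (simp add: Suc_leI)
    have Q1: "Q \<ge> 1" unfolding Q_def using R1 \<delta> d1 by (intro ge_one_powr_ge_zero) auto
    have "real (card (S j - {0})) * R \<le> real (card (S j - {0})) * J" using J by (intro mult_left_mono) auto
    also have "\<dots> \<le> (K1 ^ ?d * K2) * (R powr real ?d * R powr \<delta>)"
      using j(2) R1 by (simp add: power_mult_distrib powr_realpow mult_ac)
    also have "R powr real ?d * R powr \<delta> = Q * R powr 1"
      unfolding Q_def powr_add[symmetric] by simp
    finally have "real (card (S j - {0})) * R \<le> (K1 ^ ?d * K2 * Q) * R" using R1 by (simp add: mult_ac)
    then have "real (card (S j - {0})) \<le> K1 ^ ?d * K2 * Q" using R1 by simp
    moreover have "card (S j) \<le> card (S j - {0}) + 1"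
      using finite_subset[OF SP[OF j(1)] finP] by (cases "0 \<in> S j") (simp_all add: card_Diff_singleton)
    ultimately have "real (card (S j)) \<le> K1 ^ ?d * K2 * Q + 1" by linarith
    also have "\<dots> \<le> C * Q" using Q1 by (simp add: C_def algebra_simps)
    also have "Q = cmod lam powr ((real ?d - 1 + \<delta>) / m)" by (simp add: Q_def R_def powr_powr)
    finally show ?thesis
      using t[OF j(1)] finite_subset[OF SP[OF j(1)] finP] unfolding S_def by blast
  qed
  then show ?thesis using C0 by blast
qed

section \<open>Decay of the transform off the resonant set\<close>

text \<open>Solutions have arbitrary values outside \<Omega>; a factor vanishing off
  \<open>K\<close> removes them, and the open sets \<Omega> and \<open>- K\<close> cover the
  space.\<close>

lemma continuous_on_UNIV_support:
  fixes f :: "'a::topological_space \<Rightarrow> 'b::{topological_space, zero}"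
  assumes "open \<Omega>" "closed K" "K \<subseteq> \<Omega>" "continuous_on \<Omega> f" "\<And>y. y \<notin> K \<Longrightarrow> f y = 0"
  shows "continuous_on UNIV f"
proof -
  have "continuous_on (- K) f"
    using assms(5) by (intro continuous_on_eq[OF continuous_on_const[of _ 0]]) auto
  then have "continuous_on (\<Omega> \<union> - K) f"
    using assms by (intro continuous_on_open_Un) auto
  moreover have "\<Omega> \<union> - K = UNIV" using assms(3) by auto
  ultimately show ?thesis by simp
qed

lemma differentiable_support:
  assumes "closed K" "\<And>y. y \<in> K \<Longrightarrow> f differentiable (at y)" "\<And>y. y \<notin> K \<Longrightarrow> f y = 0"
  shows "f differentiable (at y)"
proof (cases "y \<in> K")
  case False
  then show ?thesis
    using differentiable_cong_open[of "- K" y "\<lambda>_. 0" f] assms by auto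
qed (use assms in auto)

lemma lborel_integral_translate:
  fixes f :: "'a::euclidean_space \<Rightarrow> complex"
  assumes "f \<in> borel_measurable borel"
  shows "(LINT y|lborel. f (c + y)) = (LINT y|lborel. f y)"
proof -
  have "(LINT y|distr lborel borel ((+) c). f y) = (LINT y|lborel. f (c + y))"
    using assms by (intro integral_distr) auto
  then show ?thesis by (simp add: lborel_distr_plus)
qed

lemma integrable_support:
  fixes f :: "'a::euclidean_space \<Rightarrow> complex"
  assumes "compact K" "continuous_on UNIV f" "\<And>y. y \<notin> K \<Longrightarrow> f y = 0"
  shows "integrable lborel f"
proof -
  have "integrable lborel (\<lambda>y. indicator K y *\<^sub>R f y)"
    by (rule borel_integrable_compact[OF assms(1) continuous_on_subset[OF assms(2)]]) simp
  also have "(\<lambda>y. indicator K y *\<^sub>R f y) = f" using assms(3) by (auto simp: indicator_def)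
  finally show ?thesis .
qed

text \<open>Differentiating the translation-invariant integral of a compactly supported function under the
  integral sign gives the divergence theorem without any use of Fubini.\<close>

lemma integral_partial_deriv_eq_0:
  fixes g :: "real ^ 'd \<Rightarrow> complex"
  assumes K: "compact K" and off: "\<And>y. y \<notin> K \<Longrightarrow> g y = 0"
    and dg: "\<And>y. g differentiable (at y)" and cg: "continuous_on UNIV (partial_deriv i g)"
  shows "(LINT y|lborel. partial_deriv i g y) = 0"
proof -
  let ?v = "axis i (1::real) :: real ^ 'd"
  obtain R where R: "\<And>y. y \<in> K \<Longrightarrow> norm y \<le> R"
    using compact_imp_bounded[OF K] unfolding bounded_iff by auto
  \<comment> \<open>The steps \<open>s n\<close> are at most \<open>1\<close>, so enlarging the
    radius by \<open>1\<close> catches the supports of all difference quotients, and one dominating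
    function serves for every \<open>n\<close>.\<close>
  define K' where "K' = cball (0 :: real ^ 'd) (R + 1)"
  have gc: "continuous_on UNIV g"
    using dg by (intro differentiable_imp_continuous_on differentiable_at_imp_differentiable_on) auto
  have [measurable]: "g \<in> borel_measurable borel" "partial_deriv i g \<in> borel_measurable borel"
    using gc cg by (auto intro: borel_measurable_continuous_onI)
  have pd0: "partial_deriv i g y = 0" if "y \<notin> K" for y
    using partial_deriv_cong[of "- K" y g "\<lambda>_. 0"] that off compact_imp_closed[OF K] by auto
  have "compact (partial_deriv i g ` K)"
    by (intro compact_continuous_image continuous_on_subset[OF cg] K) simp
  from compact_imp_bounded[OF this] obtain B0 where B0: "\<forall>u\<in>partial_deriv i g ` K. norm u \<le> B0"
    unfolding bounded_iff by auto
  define B where "B = \<bar>B0\<bar>"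
  have B: "norm (partial_deriv i g y) \<le> B" for y
    using B0 pd0[of y] by (cases "y \<in> K") (auto simp: B_def intro: order_trans[OF _ abs_ge_self])
  define s where "s n = 1 / real (Suc n)" for n
  have s: "0 < s n" "s n \<le> 1" for n by (auto simp: s_def)
  define u where "u n y = (g (s n *\<^sub>R ?v + y) - g y) / of_real (s n)" for n y
  have int_g: "integrable lborel g" by (rule integrable_support[OF K gc off])
  have int_gs: "integrable lborel (\<lambda>y. g (c + y))" for c
  proof (rule integrable_support)
    show "compact ((\<lambda>y. y - c) ` K)"
      by (intro compact_continuous_image continuous_intros K)
    show "continuous_on UNIV (\<lambda>y. g (c + y))"
      by (rule continuous_on_compose2[OF gc]) (auto intro: continuous_intros)
    show "g (c + y) = 0" if "y \<notin> (\<lambda>y. y - c) ` K" for y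
      using that by (intro off) (auto simp: image_iff)
  qed
  have int_u: "(LINT y|lborel. u n y) = 0" for n
    unfolding u_def by (simp add: int_g int_gs lborel_integral_translate)
  have "(\<lambda>n. LINT y|lborel. u n y) \<longlonglongrightarrow> (LINT y|lborel. partial_deriv i g y)"
  proof (rule integral_dominated_convergence[where w = "\<lambda>y. B * indicator K' y"])
    show "integrable lborel (\<lambda>y. B * indicator K' y)"
      unfolding K'_def by (intro integrable_mult_right integrable_real_indicator) (use emeasure_lborel_cball_finite[of "0 :: real ^ 'd" "R + 1"] in auto)
    show "AE y in lborel. (\<lambda>n. u n y) \<longlonglongrightarrow> partial_deriv i g y"
    proof (rule AE_I2)
      fix y
      let ?A = "partial_deriv i g y"
      show "(\<lambda>n. u n y) \<longlonglongrightarrow> ?A"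
      proof (rule LIMSEQ_I)
        fix e :: real assume "e > 0"
        then obtain d where d: "d > 0" "\<And>z. dist z y < d \<Longrightarrow> dist (partial_deriv i g z) ?A < e / 2"
          using cg unfolding continuous_on_iff by (metis UNIV_I half_gt_zero)
        obtain N where N: "1 / real (Suc N) < d" using nat_approx_posE[OF d(1)] by blast
        have "norm (u n y - ?A) < e" if "n \<ge> N" for n
        proof -
          have "s n \<le> 1 / real (Suc N)" using that by (simp add: s_def field_simps)
          then have "s n < d" using N by simp
          then have "norm (partial_deriv i g (y + t *\<^sub>R ?v) - ?A) \<le> e / 2" if "t \<in> {0..s n}" for t
            using d(2)[of "y + t *\<^sub>R ?v"] that by (simp add: dist_norm less_imp_le)
          then have "norm (g (y + s n *\<^sub>R ?v) - g (y + 0 *\<^sub>R ?v) - s n *\<^sub>R ?A) \<le> e / 2 * s n"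
            using dg s(1)[of n] by (intro mean_value_linearization[OF partial_deriv_along_axis]) auto
          moreover have "g (y + s n *\<^sub>R ?v) - g (y + 0 *\<^sub>R ?v) - s n *\<^sub>R ?A = of_real (s n) * (u n y - ?A)"
            using s(1)[of n] by (simp add: u_def add.commute scaleR_conv_of_real right_diff_distrib diff_divide_distrib)
          ultimately have "s n * norm (u n y - ?A) \<le> s n * (e / 2)"
            using s(1)[of n] by (simp add: norm_mult mult.commute)
          then show ?thesis using s(1)[of n] \<open>e > 0\<close> by simp
        qed
        then show "\<exists>N. \<forall>n\<ge>N. norm (u n y - ?A) < e" by blast
      qed
    qed
    show "AE y in lborel. norm (u n y) \<le> B * indicator K' y" for n
    proof (rule AE_I2)
      fix y
      have "norm (g (y + s n *\<^sub>R ?v) - g (y + 0 *\<^sub>R ?v) - s n *\<^sub>R 0) \<le> B * s n"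
        by (rule mean_value_linearization[OF partial_deriv_along_axis]) (use dg B s[of n] in \<open>auto simp: less_imp_le\<close>)
      then have le: "norm (u n y) \<le> B"
        using s(1)[of n] by (simp add: u_def norm_divide add.commute pos_divide_le_eq)
      have "u n y = 0" if "y \<notin> K'"
      proof -
        have y: "norm y > R + 1" using that by (simp add: K'_def)
        then have "norm (s n *\<^sub>R ?v + y) > R"
          using norm_triangle_ineq4[of "s n *\<^sub>R ?v + y" "s n *\<^sub>R ?v"] s[of n] by simp
        then have "g (s n *\<^sub>R ?v + y) = 0" "g y = 0" using R y by (auto intro!: off dest: R)
        then show ?thesis by (simp add: u_def)
      qed
      then show "norm (u n y) \<le> B * indicator K' y" using le by (cases "y \<in> K'") auto
    qed
  qed (simp_all add: u_def)
  then have "(\<lambda>n. 0) \<longlonglongrightarrow> (LINT y|lborel. partial_deriv i g y)" by (simp add: int_u)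
  then show ?thesis using LIMSEQ_const_iff by metis
qed

section \<open>Integration by parts against an exponential\<close>

text \<open>The Fourier transform of \<open>a * u\<close> at \<xi>, kept as a function of two
  factors because derivatives are moved from \<open>u\<close> to the test function
  \<open>a\<close>.\<close>

definition osc :: "(real ^ 'd \<Rightarrow> complex) \<Rightarrow> (real ^ 'd \<Rightarrow> complex) \<Rightarrow> real ^ 'd \<Rightarrow> complex"
  where "osc a u \<xi> = (LINT y|lborel. a y * u y * cis (- (\<xi> \<bullet> y)))"

lemma osc_integrand:
  fixes a u :: "real ^ 'd \<Rightarrow> complex"
  assumes "open \<Omega>" "compact K" "K \<subseteq> \<Omega>" "continuous_on \<Omega> a" "continuous_on \<Omega> u" "\<And>y. y \<notin> K \<Longrightarrow> a y = 0"
  shows "continuous_on UNIV (\<lambda>y. a y * u y)" "integrable lborel (\<lambda>y. a y * u y * cis (- (\<xi> \<bullet> y)))"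
    "continuous_on UNIV (\<lambda>y. a y * u y * cis (- (\<xi> \<bullet> y)))"
proof -
  show c1: "continuous_on UNIV (\<lambda>y. a y * u y)"
    by (rule continuous_on_UNIV_support[OF assms(1) compact_imp_closed[OF assms(2)] assms(3)])
      (use assms in \<open>auto intro: continuous_on_mult\<close>)
  show c2: "continuous_on UNIV (\<lambda>y. a y * u y * cis (- (\<xi> \<bullet> y)))"
    by (intro continuous_on_mult c1) (intro continuous_intros)
  show "integrable lborel (\<lambda>y. a y * u y * cis (- (\<xi> \<bullet> y)))"
    by (rule integrable_support[OF assms(2) c2]) (simp add: assms)
qed

lemma cis_inner_deriv:
  "((\<lambda>y. cis (- (\<xi> \<bullet> y))) has_derivative (\<lambda>h. - (\<i> * of_real (\<xi> \<bullet> h)) * cis (- (\<xi> \<bullet> y)))) (at y)"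
proof -
  have "((\<lambda>y. \<i> * complex_of_real (- (\<xi> \<bullet> y))) has_derivative (\<lambda>h. \<i> * complex_of_real (- (\<xi> \<bullet> h)))) (at y)"
    by (intro has_derivative_mult_right has_derivative_of_real has_derivative_minus has_derivative_inner_right has_derivative_ident)
  from has_derivative_compose[OF this DERIV_exp[unfolded has_field_derivative_def]] show ?thesis by (simp add: cis_conv_exp mult.commute)
qed

text \<open>The integral of \<open>D_coord i\<close> of \<open>a * u\<close> times the exponential
  vanishes, and the exponential is an eigenfunction of \<open>D_coord i\<close> with eigenvalue
  \<open>- \<xi> $ i\<close>.\<close>

lemma osc_D_coord:
  fixes a u :: "real ^ 'd \<Rightarrow> complex"
  assumes \<Omega>: "open \<Omega>" and K: "compact K" "K \<subseteq> \<Omega>" and a: "smooth_on \<Omega> a" "\<And>y. y \<notin> K \<Longrightarrow> a y = 0" and u: "smooth_on \<Omega> u"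
  shows "osc a (D_coord i u) \<xi> = of_real (\<xi> $ i) * osc a u \<xi> - osc (D_coord i a) u \<xi>"
proof -
  let ?E = "\<lambda>y. cis (- (\<xi> \<bullet> y))"
  have clK: "closed K" using K compact_imp_closed by blast
  have Da0: "D_coord i a y = 0" if "y \<notin> K" for y
    using D_word_eq_0_off[OF clK a(2) that, where w = "[i]"] by simp
  note sm = smooth_on_continuous[OF a(1)] smooth_on_continuous[OF u]
     smooth_on_continuous[OF smooth_on_D_coord[OF \<Omega> a(1)]] smooth_on_continuous[OF smooth_on_D_coord[OF \<Omega> u]]
  define g where "g = (\<lambda>y. (a y * u y) * ?E y)"
  have dE: "?E differentiable (at y)" for y using cis_inner_deriv unfolding differentiable_def by blast
  have dau: "(\<lambda>y. a y * u y) differentiable (at y)" if "y \<in> \<Omega>" for y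
    using that a u by (intro differentiable_mult smooth_on_differentiable)
  have DE: "D_coord i ?E y = - of_real (\<xi> $ i) * ?E y" for y
    using partial_deriv_eq[OF cis_inner_deriv[of \<xi> y], of i] by (simp add: D_coord_def inner_axis flip: mult.assoc)
  have Dg: "D_coord i g y = (D_coord i a y * u y * ?E y + a y * D_coord i u y * ?E y) - of_real (\<xi> $ i) * (a y * u y * ?E y)" for y
  \<comment> \<open>Off \<open>K\<close> the function \<open>u\<close> may fail to be
    differentiable; there both sides vanish.\<close>
  proof (cases "y \<in> K")
    case True
    then have y: "y \<in> \<Omega>" using K by auto
    have "D_coord i g y = (D_coord i a y * u y + a y * D_coord i u y) * ?E y + (a y * u y) * D_coord i ?E y"
      unfolding g_def
      by (simp only: D_coord_mult[OF dau[OF y] dE] D_coord_mult[OF smooth_on_differentiable[OF a(1) y] smooth_on_differentiable[OF u y]])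
    then show ?thesis unfolding DE by (simp add: algebra_simps)
  next
    case False
    have "D_coord i g y = 0"
      using D_word_eq_0_off[OF clK _ False, where f = g and w = "[i]"] a(2) by (simp add: g_def)
    then show ?thesis using a(2)[OF False] Da0[OF False] by simp
  qed
  have i1: "integrable lborel (\<lambda>y. D_coord i a y * u y * ?E y)"
    and i2: "integrable lborel (\<lambda>y. a y * D_coord i u y * ?E y)"
    and i3: "integrable lborel (\<lambda>y. a y * u y * ?E y)"
    by (intro osc_integrand(2)[OF \<Omega> K] sm a(2) Da0; assumption)+
  have c: "continuous_on UNIV (D_coord i g)"
    unfolding Dg[abs_def]
    by (intro continuous_on_add continuous_on_diff continuous_on_mult[OF continuous_on_const]
        osc_integrand(3)[OF \<Omega> K] sm a(2) Da0)
  have pdg: "partial_deriv i g y = \<i> * D_coord i g y" for y by (simp add: D_coord_def)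
  have "(LINT y|lborel. partial_deriv i g y) = 0"
  proof (rule integral_partial_deriv_eq_0[OF K(1)])
    show "g y = 0" if "y \<notin> K" for y using a(2)[OF that] by (simp add: g_def)
    show "g differentiable (at y)" for y
      unfolding g_def
      by (rule differentiable_support[OF clK differentiable_mult[OF dau dE]]) (use K a(2) in auto)
    show "continuous_on UNIV (partial_deriv i g)"
      unfolding pdg[abs_def] by (intro continuous_on_mult continuous_on_const c)
  qed
  then have "(LINT y|lborel. D_coord i g y) = 0" unfolding pdg by simp
  then have "osc (D_coord i a) u \<xi> + osc a (D_coord i u) \<xi> - of_real (\<xi> $ i) * osc a u \<xi> = 0"
    unfolding Dg osc_def using i1 i2 i3 by simp
  then show ?thesis by (simp add: algebra_simps)
qed

lemma prod_list_component_le: "\<bar>\<Prod>i\<leftarrow>w. \<xi> $ i\<bar> \<le> (1 + norm \<xi>) ^ length w"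
proof (induction w)
  case (Cons i w)
  have "\<bar>\<xi> $ i\<bar> \<le> 1 + norm \<xi>" using component_le_norm_cart[of \<xi> i] by simp
  then show ?case using Cons by (simp add: abs_mult mult_mono)
qed simp

text \<open>Each derivative of \<open>u\<close> becomes a factor \<open>\<xi> $ i\<close> or falls
  on \<open>a\<close>. If none falls on \<open>a\<close> the result is the main term; every other
  term has lost at least one frequency factor. The function \<open>a\<close> varies in the induction
  since the hypothesis is also used for \<open>D_coord i a\<close>.\<close>

lemma osc_D_word:
  fixes u :: "real ^ 'd \<Rightarrow> complex"
  assumes \<Omega>: "open \<Omega>" and K: "compact K" "K \<subseteq> \<Omega>" and u: "smooth_on \<Omega> u" and S: "S \<ge> 0"
  shows "smooth_on \<Omega> a \<Longrightarrow> (\<And>y. y \<notin> K \<Longrightarrow> a y = 0) \<Longrightarrow>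
    (\<And>v. length v \<le> length w \<Longrightarrow> cmod (osc (D_word v a) u \<xi>) \<le> S) \<Longrightarrow>
    cmod (osc a (D_word w u) \<xi> - of_real (\<Prod>i\<leftarrow>w. \<xi> $ i) * osc a u \<xi>)
      \<le> (2 ^ length w - 1) * (1 + norm \<xi>) ^ (length w - 1) * S"
proof (induction w arbitrary: a)
  case Nil
  show ?case by simp
next
  case (Cons i w)
  let ?x = "1 + norm \<xi>" and ?k = "length w"
  let ?p = "complex_of_real (\<Prod>i\<leftarrow>w. \<xi> $ i)"
  define E where "E = (2 ^ ?k - 1) * ?x ^ (?k - 1) * S"
  have E0: "E \<ge> 0" using S by (auto simp: E_def)
  \<comment> \<open>For \<open>?k = 0\<close> the truncated exponent \<open>?k - 1\<close> does no
    harm, because the factor \<open>2 ^ ?k - 1\<close> vanishes. The same \<open>- 1\<close> makes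
    the recursion close exactly.\<close>
  have E1: "?x * E \<le> (2 ^ ?k - 1) * ?x ^ ?k * S"
    by (cases "?k") (simp_all add: E_def)
  have E2: "E \<le> (2 ^ ?k - 1) * ?x ^ ?k * S"
    unfolding E_def using S by (intro mult_right_mono mult_left_mono power_increasing) auto
  have off: "D_coord i a y = 0" if "y \<notin> K" for y
    using D_word_eq_0_off[OF compact_imp_closed[OF K(1)] Cons.prems(2) that, where w = "[i]"] by simp
  have 1: "cmod (osc a (D_word w u) \<xi> - ?p * osc a u \<xi>) \<le> E"
    unfolding E_def using Cons.prems by (intro Cons.IH) auto
  have 2: "cmod (osc (D_coord i a) (D_word w u) \<xi> - ?p * osc (D_coord i a) u \<xi>) \<le> E"
    unfolding E_def
  proof (intro Cons.IH smooth_on_D_coord \<Omega> Cons.prems(1) off)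
    fix v :: "'d list" assume "length v \<le> length w"
    then show "cmod (osc (D_word v (D_coord i a)) u \<xi>) \<le> S"
      using Cons.prems(3)[of "v @ [i]"] by simp
  qed
  have 3: "cmod (?p * osc (D_coord i a) u \<xi>) \<le> ?x ^ ?k * S"
    unfolding norm_mult norm_of_real
    by (intro mult_mono prod_list_component_le) (use Cons.prems(3)[of "[i]"] in auto)
  have "osc a (D_word (i # w) u) \<xi> = of_real (\<xi> $ i) * osc a (D_word w u) \<xi> - osc (D_coord i a) (D_word w u) \<xi>"
    using osc_D_coord[OF \<Omega> K Cons.prems(1,2) smooth_on_D_word[OF \<Omega> u], where i = i] by simp
  then have "osc a (D_word (i # w) u) \<xi> - of_real (\<Prod>i\<leftarrow>i # w. \<xi> $ i) * osc a u \<xi>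
    = of_real (\<xi> $ i) * (osc a (D_word w u) \<xi> - ?p * osc a u \<xi>)
      - (osc (D_coord i a) (D_word w u) \<xi> - ?p * osc (D_coord i a) u \<xi>) - ?p * osc (D_coord i a) u \<xi>"
    by (simp add: algebra_simps)
  also have "cmod \<dots> \<le> ?x * E + E + ?x ^ ?k * S"
  proof -
    have "\<bar>\<xi> $ i\<bar> \<le> ?x" using component_le_norm_cart[of \<xi> i] by simp
    then have "cmod (of_real (\<xi> $ i) * (osc a (D_word w u) \<xi> - ?p * osc a u \<xi>)) \<le> ?x * E"
      unfolding norm_mult norm_of_real using 1 by (intro mult_mono) auto
    then show ?thesis
      using norm_triangle_ineq4 order_trans[OF norm_triangle_ineq4 add_mono[OF order_trans[OF norm_triangle_ineq4 add_mono[OF _ 2]] 3]]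
      by blast
  qed
  also have "\<dots> \<le> (2 ^ ?k - 1) * ?x ^ ?k * S + (2 ^ ?k - 1) * ?x ^ ?k * S + ?x ^ ?k * S"
    by (intro add_mono E1 E2 order_refl)
  also have "\<dots> = (2 ^ length (i # w) - 1) * ?x ^ (length (i # w) - 1) * S"
    by (simp add: algebra_simps)
  finally show ?case .
qed

lemma osc_diff_op:
  fixes u :: "real ^ 'd \<Rightarrow> complex"
  assumes \<Omega>: "open \<Omega>" and K: "compact K" "K \<subseteq> \<Omega>" and u: "smooth_on \<Omega> u" and S: "S \<ge> 0"
    and a: "smooth_on \<Omega> a" "\<And>y. y \<notin> K \<Longrightarrow> a y = 0"
    and bound: "\<And>v. length v \<le> m \<Longrightarrow> cmod (osc (D_word v a) u \<xi>) \<le> S"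
  shows "cmod (osc a (diff_op m c u) \<xi> - of_real (symbol m c \<xi>) * osc a u \<xi>)
     \<le> coeff_sum m c * 2 ^ m * (1 + norm \<xi>) ^ (m - 1) * S"
proof -
  let ?A = "{\<alpha> :: nat ^ 'd. mi_abs \<alpha> \<le> m}"
  have int: "integrable lborel (\<lambda>y. a y * D_multi \<alpha> u y * cis (- (\<xi> \<bullet> y)))" for \<alpha>
    unfolding D_multi_eq_D_word
    by (rule osc_integrand(2)[OF \<Omega> K]) (use a smooth_on_continuous smooth_on_D_word[OF \<Omega> u] in blast)+
  have "osc a (diff_op m c u) \<xi> = (LINT y|lborel. (\<Sum>\<alpha>\<in>?A. of_real (c \<alpha>) * (a y * D_multi \<alpha> u y * cis (- (\<xi> \<bullet> y)))))"
    by (simp add: osc_def diff_op_def sum_distrib_left sum_distrib_right mult_ac)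
  also have "\<dots> = (\<Sum>\<alpha>\<in>?A. of_real (c \<alpha>) * osc a (D_multi \<alpha> u) \<xi>)"
    by (subst Bochner_Integration.integral_sum) (simp_all add: int osc_def)
  finally have "osc a (diff_op m c u) \<xi> - of_real (symbol m c \<xi>) * osc a u \<xi>
     = (\<Sum>\<alpha>\<in>?A. of_real (c \<alpha>) * (osc a (D_multi \<alpha> u) \<xi> - of_real (mi_power \<xi> \<alpha>) * osc a u \<xi>))"
    by (simp add: symbol_def sum_distrib_right right_diff_distrib sum_subtractf mult.assoc)
  also have "cmod \<dots> \<le> (\<Sum>\<alpha>\<in>?A. \<bar>c \<alpha>\<bar> * (2 ^ m * (1 + norm \<xi>) ^ (m - 1) * S))"
  proof (rule sum_norm_le)
    fix \<alpha> assume "\<alpha> \<in> ?A"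
    then have l: "length (mi_word \<alpha>) \<le> m" by (simp add: length_mi_word)
    have "cmod (osc a (D_multi \<alpha> u) \<xi> - of_real (mi_power \<xi> \<alpha>) * osc a u \<xi>)
       \<le> (2 ^ length (mi_word \<alpha>) - 1) * (1 + norm \<xi>) ^ (length (mi_word \<alpha>) - 1) * S"
      unfolding D_multi_eq_D_word prod_list_mi_word[symmetric]
      using l by (intro osc_D_word[OF \<Omega> K u S a] bound) auto
    also have "\<dots> \<le> 2 ^ m * (1 + norm \<xi>) ^ (m - 1) * S"
    proof (intro mult_right_mono mult_mono power_increasing S)
      have "(2::real) ^ length (mi_word \<alpha>) \<le> 2 ^ m" using l by (intro power_increasing) auto
      then show "(2::real) ^ length (mi_word \<alpha>) - 1 \<le> 2 ^ m" by linarith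
    qed (use l in auto)
    finally show "cmod (of_real (c \<alpha>) * (osc a (D_multi \<alpha> u) \<xi> - of_real (mi_power \<xi> \<alpha>) * osc a u \<xi>))
       \<le> \<bar>c \<alpha>\<bar> * (2 ^ m * (1 + norm \<xi>) ^ (m - 1) * S)"
      unfolding norm_mult norm_of_real by (intro mult_left_mono) auto
  qed
  finally show ?thesis by (simp add: coeff_sum_def sum_distrib_right mult.assoc)
qed

lemma L2_norm_on_eq:
  assumes "closed K"
  shows "L2_norm_on K f = sqrt (LINT y|restrict_space lborel K. (cmod (f y))\<^sup>2)"
  using borel_closed[OF assms] unfolding L2_norm_on_def set_lebesgue_integral_def
  by (subst integral_restrict_space) simp_all

lemma L2_norm_on_nonneg: "L2_norm_on K f \<ge> 0"
  by (simp add: L2_norm_on_def set_lebesgue_integral_def)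

text \<open>Cauchy-Schwarz against a constant, obtained from the nonnegative integral of the squared
  deviation of \<open>cmod (u y)\<close> from its mean.\<close>

lemma integral_cmod_le_L2_norm_on:
  fixes u :: "real ^ 'd \<Rightarrow> complex"
  assumes K: "compact K" and u: "continuous_on K u" and v: "measure lborel K > 0"
  shows "(LINT y|restrict_space lborel K. cmod (u y)) \<le> sqrt (measure lborel K) * L2_norm_on K u"
proof -
  let ?M = "restrict_space lborel K"
  have clK: "closed K" using K compact_imp_closed by blast
  define V where "V = measure lborel K"
  define A where "A = (LINT y|?M. cmod (u y))"
  define Q where "Q = (LINT y|?M. (cmod (u y))\<^sup>2)"
  note int = integrable_restrict_compact[OF K]
  have V: "(LINT y|?M. c) = c * V" for c :: real
    using clK by (simp add: V_def measure_restrict_space space_restrict_space)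
  have i1: "integrable ?M (\<lambda>y. cmod (u y))" and i2: "integrable ?M (\<lambda>y. (cmod (u y))\<^sup>2)" and i3: "integrable ?M (\<lambda>y. c :: real)" for c
    by (intro int continuous_intros u)+
  have "0 \<le> (LINT y|?M. (cmod (u y) - A / V)\<^sup>2)" by simp
  also have "\<dots> = (LINT y|?M. (cmod (u y))\<^sup>2 - 2 * (A / V) * cmod (u y) + (A / V)\<^sup>2)"
    by (intro Bochner_Integration.integral_cong refl) (simp add: power2_diff)
  also have "\<dots> = Q - 2 * (A / V) * A + (A / V)\<^sup>2 * V"
    using i1 i2 i3
    by (simp only: Bochner_Integration.integral_add Bochner_Integration.integral_diff
        Bochner_Integration.integrable_diff integrable_mult_right integral_mult_right_zero V Q_def A_def[symmetric])
  also have "\<dots> = Q - A\<^sup>2 / V" using v by (simp add: V_def[symmetric] power2_eq_square field_simps)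
  finally have "A\<^sup>2 \<le> V * Q" using v by (simp add: V_def[symmetric] field_simps)
  then have "A \<le> sqrt (V * Q)" by (rule real_le_rsqrt)
  then show ?thesis by (simp add: A_def V_def Q_def L2_norm_on_eq[OF clK] real_sqrt_mult)
qed

section \<open>Uniform classes of test functions and the iteration\<close>

text \<open>The sequence \<open>A\<close> is all that later constants see of \<open>a\<close>, which
  makes them independent of the domain, of the centre of the ball and of the individual
  potential.\<close>

definition test_fun :: "(real ^ 'd) set \<Rightarrow> (real ^ 'd) set \<Rightarrow> (nat \<Rightarrow> real) \<Rightarrow> (real ^ 'd \<Rightarrow> complex) \<Rightarrow> bool"
  where "test_fun \<Omega> K A a \<longleftrightarrow> smooth_on \<Omega> a \<and> (\<forall>y. y \<notin> K \<longrightarrow> a y = 0) \<and>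
    (\<forall>w. \<forall>y\<in>K. cmod (D_word w a y) \<le> A (length w))"

lemma cmod_osc_le:
  fixes u :: "real ^ 'd \<Rightarrow> complex"
  assumes \<Omega>: "open \<Omega>" and K: "compact K" "K \<subseteq> \<Omega>" and v: "measure lborel K > 0"
    and a: "test_fun \<Omega> K A a" and u: "smooth_on \<Omega> u" and A: "A 0 \<ge> 0"
  shows "cmod (osc a u \<xi>) \<le> A 0 * sqrt (measure lborel K) * L2_norm_on K u"
proof -
  let ?M = "restrict_space lborel K"
  have clK: "closed K" using K compact_imp_closed by blast
  have a0: "cmod (a y) \<le> A 0" if "y \<in> K" for y
    using a that unfolding test_fun_def by (metis D_word_simps(1) list.size(3))
  have off: "a y = 0" if "y \<notin> K" for y using a that by (simp add: test_fun_def)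
  have uc: "continuous_on K u" and ac: "continuous_on K a"
    using a u K smooth_on_continuous continuous_on_subset unfolding test_fun_def by blast+
  have "osc a u \<xi> = (LINT y|?M. a y * u y * cis (- (\<xi> \<bullet> y)))"
    unfolding osc_def using off by (intro integral_restrict_support[symmetric] clK) simp
  also have "cmod \<dots> \<le> (LINT y|?M. cmod (a y * u y * cis (- (\<xi> \<bullet> y))))" by (rule integral_norm_bound)
  also have "\<dots> \<le> (LINT y|?M. A 0 * cmod (u y))"
  proof (rule integral_mono)
    show "integrable ?M (\<lambda>y. cmod (a y * u y * cis (- (\<xi> \<bullet> y))))" "integrable ?M (\<lambda>y. A 0 * cmod (u y))"
      by (intro integrable_restrict_compact[OF K(1)] continuous_intros uc ac)+
    show "cmod (a y * u y * cis (- (\<xi> \<bullet> y))) \<le> A 0 * cmod (u y)" if "y \<in> space ?M" for y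
      using a0[of y] that by (simp add: space_restrict_space norm_mult mult_right_mono)
  qed
  also have "\<dots> = A 0 * (LINT y|?M. cmod (u y))" by simp
  also have "\<dots> \<le> A 0 * (sqrt (measure lborel K) * L2_norm_on K u)"
    by (intro mult_left_mono integral_cmod_le_L2_norm_on K uc v A)
  finally show ?thesis by (simp add: mult.assoc)
qed

text \<open>The sum over \<open>j\<close> acts as a maximum, so that a single sequence serves all
  derivatives up to order \<open>n\<close>.\<close>

lemma test_fun_D_word:
  assumes "open \<Omega>" "closed K" "test_fun \<Omega> K A a" "length v \<le> n" "\<And>n. A n \<ge> 0"
  shows "test_fun \<Omega> K (\<lambda>l. \<Sum>j\<le>n. A (l + j)) (D_word v a)"
  unfolding test_fun_def
proof (intro conjI allI impI ballI)
  show "smooth_on \<Omega> (D_word v a)" using assms by (intro smooth_on_D_word) (auto simp: test_fun_def)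
  show "D_word v a y = 0" if "y \<notin> K" for y
    using assms that by (intro D_word_eq_0_off[OF assms(2)]) (auto simp: test_fun_def)
  fix w y assume "y \<in> K"
  then have "cmod (D_word (w @ v) a y) \<le> A (length (w @ v))" using assms(3) unfolding test_fun_def by blast
  also have "\<dots> \<le> (\<Sum>j\<le>n. A (length w + j))"
    using assms(4,5) member_le_sum[of "length v" "{..n}" "\<lambda>j. A (length w + j)"] by simp
  finally show "cmod (D_word w (D_word v a) y) \<le> (\<Sum>j\<le>n. A (length w + j))" by simp
qed

lemma test_fun_mult:
  assumes "open \<Omega>" "K \<subseteq> \<Omega>" "test_fun \<Omega> K A a" "smooth_on \<Omega> V" "\<And>n. A n \<ge> 0" "\<And>n. W n \<ge> 0"
    and V: "\<And>w y. y \<in> K \<Longrightarrow> cmod (D_word w V y) \<le> W (length w)"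
  shows "test_fun \<Omega> K (\<lambda>n. 2 ^ n * (\<Sum>j\<le>n. W j) * (\<Sum>j\<le>n. A j)) (\<lambda>y. V y * a y)"
  unfolding test_fun_def
proof (intro conjI allI impI ballI)
  show "smooth_on \<Omega> (\<lambda>y. V y * a y)" using assms by (intro smooth_on_mult) (auto simp: test_fun_def)
  show "V y * a y = 0" if "y \<notin> K" for y using assms(3) that by (simp add: test_fun_def)
  fix w :: "'a list" and y assume y: "y \<in> K"
  have le: "B l \<le> (\<Sum>j\<le>length w. B j)" if "l \<le> length w" "\<And>n. B n \<ge> 0" for l and B :: "nat \<Rightarrow> real"
    using that by (intro member_le_sum) auto
  show "cmod (D_word w (\<lambda>y. V y * a y) y) \<le> 2 ^ length w * (\<Sum>j\<le>length w. W j) * (\<Sum>j\<le>length w. A j)"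
  proof (rule norm_D_word_mult_le[OF assms(1)])
    show "y \<in> \<Omega>" using y assms(2) by auto
    show "smooth_on \<Omega> a" using assms(3) by (simp add: test_fun_def)
    show "cmod (D_word v V y) \<le> (\<Sum>j\<le>length w. W j)" if "length v \<le> length w" for v
      using V[OF y] le[OF that, of W] assms(6) order_trans by blast
    show "cmod (D_word v a y) \<le> (\<Sum>j\<le>length w. A j)" if "length v \<le> length w" for v
    proof -
      have "cmod (D_word v a y) \<le> A (length v)" using assms(3) y by (simp add: test_fun_def)
      then show ?thesis using le[OF that, of A] assms(5) by fastforce
    qed
  qed (use assms in \<open>auto intro: sum_nonneg\<close>)
qed

text \<open>Groups the objects that vary after the constant has been fixed.\<close>

definition eigenfunction_data ::
    "nat \<Rightarrow> (nat ^ 'd \<Rightarrow> real) \<Rightarrow> real \<Rightarrow> (nat ^ 'd \<Rightarrow> real) \<Rightarrow> (real ^ 'd) set \<Rightarrow> (real ^ 'd \<Rightarrow> complex) \<Rightarrow>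
      complex \<Rightarrow> (real ^ 'd \<Rightarrow> complex) \<Rightarrow> real ^ 'd \<Rightarrow> bool"
  where "eigenfunction_data m c r M \<Omega> V lam \<psi> x \<longleftrightarrow>
      open \<Omega> \<and> smooth_on \<Omega> V \<and> smooth_on \<Omega> \<psi> \<and>
      (\<forall>y\<in>\<Omega>. diff_op m c \<psi> y + V y * \<psi> y = lam * \<psi> y) \<and> cball x r \<subseteq> \<Omega> \<and>
      (\<forall>\<beta>. \<forall>y\<in>cball x r. cmod (D_multi \<beta> V y) \<le> M \<beta>)"

text \<open>Transposing the equation turns
  \<open>(symbol m c \<xi> - lam) * osc a \<psi> \<xi>\<close> into transforms with derivatives of
  \<open>a\<close> or with \<open>V * a\<close> as test function. Their classes depend only on
  \<open>A\<close>, \<open>m\<close> and \<open>M\<close>, so the hypothesis for \<open>N\<close>,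
  taken for all \<open>A\<close>, applies to them. Division loses \<open>m - 1\<close> powers and
  gains \<open>m - 1 + \<delta>\<close>.\<close>

lemma osc_decay:
  fixes c :: "nat ^ 'd \<Rightarrow> real"
  assumes m: "m \<ge> 1" and r: "r > 0" and M: "\<And>\<beta>. M \<beta> \<ge> 0"
  shows "(\<And>n. A n \<ge> 0) \<Longrightarrow> \<exists>C\<ge>0. \<forall>\<Omega> V lam \<psi> x a \<xi>. eigenfunction_data m c r M \<Omega> V lam \<psi> x \<longrightarrow>
     test_fun \<Omega> (cball x r) A a \<longrightarrow> \<xi> \<notin> resonant m c \<delta> lam \<longrightarrow>
     cmod (osc a \<psi> \<xi>) \<le> C * (1 + norm \<xi>) powr (- (real N * \<delta>)) * L2_norm_on (cball x r) \<psi>"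
proof (induction N arbitrary: A)
  case 0
  \<comment> \<open>The volume of the ball is the same for every centre, so the constant of the base
    case is uniform in \<open>x\<close>.\<close>
  define v where "v = unit_ball_vol (real CARD('d)) * r ^ CARD('d)"
  have v: "measure lborel (cball x r) = v" for x :: "real ^ 'd"
    using content_cball[of r x] r by (simp add: v_def)
  have v0: "v > 0" using content_cball_pos[OF r, of "0 :: real ^ 'd"] v[of 0] by simp
  have "cmod (osc a \<psi> \<xi>) \<le> (A 0 * sqrt v) * (1 + norm \<xi>) powr (- (real 0 * \<delta>)) * L2_norm_on (cball x r) \<psi>"
    if "eigenfunction_data m c r M \<Omega> V lam \<psi> x" "test_fun \<Omega> (cball x r) A a" for \<Omega> V lam \<psi> x a \<xi>
  proof -
    have "1 + norm \<xi> \<noteq> 0" using norm_ge_zero[of \<xi>] by linarith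
    then show ?thesis
      using cmod_osc_le[OF _ compact_cball _ _ that(2), of \<psi> \<xi>] that(1) v[of x] v0 0[of 0]
      by (simp add: eigenfunction_data_def)
  qed
  then show ?case using 0[of 0] v0 by (intro exI[of _ "A 0 * sqrt v"]) auto
next
  case (Suc N)
  \<comment> \<open>Bounds for all word derivatives of \<open>V\<close> on the ball in terms of
    \<open>M\<close> alone; a word is sent to the multi-index counting its letters.\<close>
  define W where "W n = (\<Sum>w | length w = n. M (\<chi> i. count (mset w) i))" for n
  have W0: "W n \<ge> 0" for n unfolding W_def using M by (intro sum_nonneg)
  define A1 where "A1 l = (\<Sum>j\<le>m. A (l + j))" for l
  define A2 where "A2 n = 2 ^ n * (\<Sum>j\<le>n. W j) * (\<Sum>j\<le>n. A j)" for n
  have "A1 n \<ge> 0" "A2 n \<ge> 0" for n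
    unfolding A1_def A2_def using Suc.prems W0 by (auto intro!: sum_nonneg mult_nonneg_nonneg)
  then obtain C1 C2 where C: "C1 \<ge> 0" "C2 \<ge> 0"
    and C1: "\<And>\<Omega> V lam \<psi> x a \<xi>. eigenfunction_data m c r M \<Omega> V lam \<psi> x \<Longrightarrow>
     test_fun \<Omega> (cball x r) A1 a \<Longrightarrow> \<xi> \<notin> resonant m c \<delta> lam \<Longrightarrow>
     cmod (osc a \<psi> \<xi>) \<le> C1 * (1 + norm \<xi>) powr (- (real N * \<delta>)) * L2_norm_on (cball x r) \<psi>"
    and C2: "\<And>\<Omega> V lam \<psi> x a \<xi>. eigenfunction_data m c r M \<Omega> V lam \<psi> x \<Longrightarrow>
     test_fun \<Omega> (cball x r) A2 a \<Longrightarrow> \<xi> \<notin> resonant m c \<delta> lam \<Longrightarrow>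
     cmod (osc a \<psi> \<xi>) \<le> C2 * (1 + norm \<xi>) powr (- (real N * \<delta>)) * L2_norm_on (cball x r) \<psi>"
    using Suc.IH[of A1] Suc.IH[of A2] by blast
  define C where "C = coeff_sum m c * 2 ^ m * C1 + C2"
  have C0: "C \<ge> 0" using C coeff_sum_nonneg[of m c] by (simp add: C_def)
  have "cmod (osc a \<psi> \<xi>) \<le> C * (1 + norm \<xi>) powr (- (real (Suc N) * \<delta>)) * L2_norm_on (cball x r) \<psi>"
    if data: "eigenfunction_data m c r M \<Omega> V lam \<psi> x" and a: "test_fun \<Omega> (cball x r) A a"
      and \<xi>: "\<xi> \<notin> resonant m c \<delta> lam" for \<Omega> V lam \<psi> x a \<xi>
  proof -
    let ?K = "cball x r"
    have \<Omega>: "open \<Omega>" and V: "smooth_on \<Omega> V" and \<psi>: "smooth_on \<Omega> \<psi>" and K\<Omega>: "?K \<subseteq> \<Omega>"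
      and eq: "\<And>y. y \<in> \<Omega> \<Longrightarrow> diff_op m c \<psi> y = (lam - V y) * \<psi> y"
      and VM: "\<And>\<beta> y. y \<in> ?K \<Longrightarrow> cmod (D_multi \<beta> V y) \<le> M \<beta>"
      using data by (auto simp: eigenfunction_data_def left_diff_distrib eq_diff_eq)
    have a': "smooth_on \<Omega> a" "\<And>y. y \<notin> ?K \<Longrightarrow> a y = 0" using a by (auto simp: test_fun_def)
    define X where "X = 1 + norm \<xi>"
    have X: "X \<ge> 1" by (simp add: X_def)
    define g where "g = X powr (- (real N * \<delta>)) * L2_norm_on ?K \<psi>"
    have g: "g \<ge> 0" unfolding g_def by (intro mult_nonneg_nonneg powr_ge_zero L2_norm_on_nonneg)
    have VW: "cmod (D_word w V y) \<le> W (length w)" if y: "y \<in> ?K" for w y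
    proof -
      have "cmod (D_word w V y) \<le> M (\<chi> i. count (mset w) i)"
        using VM[OF y] D_word_eq_D_multi[OF \<Omega> V, of y w] y K\<Omega> by auto
      also have "\<dots> \<le> W (length w)"
        unfolding W_def using M finite_lists_length_eq[of "UNIV :: 'd set" "length w"]
        by (intro member_le_sum[of w _ "\<lambda>w. M (\<chi> i. count (mset w) i)"]) auto
      finally show ?thesis .
    qed
    have b1: "cmod (osc (D_word v a) \<psi> \<xi>) \<le> C1 * g" if "length v \<le> m" for v
    proof -
      have "test_fun \<Omega> ?K A1 (D_word v a)"
        unfolding A1_def[abs_def] using that Suc.prems by (intro test_fun_D_word \<Omega> a) auto
      from C1[OF data this \<xi>] show ?thesis by (simp add: g_def X_def mult.assoc)
    qed
    have b2: "cmod (osc (\<lambda>y. V y * a y) \<psi> \<xi>) \<le> C2 * g"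
    proof -
      have "test_fun \<Omega> ?K A2 (\<lambda>y. V y * a y)"
        unfolding A2_def[abs_def] by (intro test_fun_mult \<Omega> K\<Omega> a V Suc.prems W0 VW)
      from C2[OF data this \<xi>] show ?thesis by (simp add: g_def X_def mult.assoc)
    qed
    have b3: "cmod (osc a (diff_op m c \<psi>) \<xi> - of_real (symbol m c \<xi>) * osc a \<psi> \<xi>)
       \<le> coeff_sum m c * 2 ^ m * X ^ (m - 1) * (C1 * g)"
      unfolding X_def using C g by (intro osc_diff_op[OF \<Omega> compact_cball K\<Omega> \<psi> _ a'] b1) auto
    have "osc a (diff_op m c \<psi>) \<xi> = lam * osc a \<psi> \<xi> - osc (\<lambda>y. V y * a y) \<psi> \<xi>"
    proof -
      have i1: "integrable lborel (\<lambda>y. a y * \<psi> y * cis (- (\<xi> \<bullet> y)))"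
        by (rule osc_integrand(2)[OF \<Omega> compact_cball K\<Omega>]) (use a' \<psi> smooth_on_continuous in blast)+
      have i2: "integrable lborel (\<lambda>y. (V y * a y) * \<psi> y * cis (- (\<xi> \<bullet> y)))"
        by (rule osc_integrand(2)[OF \<Omega> compact_cball K\<Omega>])
          (use a' \<psi> V smooth_on_mult[OF \<Omega> V a'(1)] smooth_on_continuous in \<open>auto\<close>)
      have "a y * diff_op m c \<psi> y * cis (- (\<xi> \<bullet> y))
          = lam * (a y * \<psi> y * cis (- (\<xi> \<bullet> y))) - (V y * a y) * \<psi> y * cis (- (\<xi> \<bullet> y))" for y
      proof (cases "y \<in> ?K")
        case True
        then have "y \<in> \<Omega>" using K\<Omega> by auto
        show ?thesis unfolding eq[OF \<open>y \<in> \<Omega>\<close>] by (simp add: algebra_simps)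
      qed (simp add: a')
      then show ?thesis unfolding osc_def using i1 i2 by simp
    qed
    then have "(of_real (symbol m c \<xi>) - lam) * osc a \<psi> \<xi>
       = - (osc a (diff_op m c \<psi>) \<xi> - of_real (symbol m c \<xi>) * osc a \<psi> \<xi>) - osc (\<lambda>y. V y * a y) \<psi> \<xi>"
      by (simp add: algebra_simps)
    then have "cmod (of_real (symbol m c \<xi>) - lam) * cmod (osc a \<psi> \<xi>)
       \<le> coeff_sum m c * 2 ^ m * X ^ (m - 1) * (C1 * g) + C2 * g"
      unfolding norm_mult[symmetric] using b2 b3
      by (metis (no_types, lifting) norm_triangle_le_diff add_mono norm_minus_cancel)
    \<comment> \<open>The potential term carries no frequency factor; since \<open>X \<ge> 1\<close>
      it may be given the same power as the commutator terms.\<close>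
    also have "C2 * g \<le> X ^ (m - 1) * (C2 * g)"
      using mult_right_mono[OF one_le_power[OF X, of "m - 1"], of "C2 * g"] C g by simp
    also have "coeff_sum m c * 2 ^ m * X ^ (m - 1) * (C1 * g) + X ^ (m - 1) * (C2 * g) = X ^ (m - 1) * (C * g)"
      by (simp add: C_def algebra_simps)
    finally have 1: "cmod (of_real (symbol m c \<xi>) - lam) * cmod (osc a \<psi> \<xi>) \<le> X ^ (m - 1) * (C * g)" by simp
    have "X powr (real m - 1 + \<delta>) \<le> cmod (of_real (symbol m c \<xi>) - lam)"
      using \<xi> by (simp add: resonant_def X_def)
    moreover have "X powr (real m - 1 + \<delta>) = X ^ (m - 1) * X powr \<delta>"
      using X m by (simp add: powr_add of_nat_diff flip: powr_realpow)
    ultimately have "X ^ (m - 1) * (X powr \<delta> * cmod (osc a \<psi> \<xi>)) \<le> X ^ (m - 1) * (C * g)"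
      using mult_right_mono[of "X powr (real m - 1 + \<delta>)" _ "cmod (osc a \<psi> \<xi>)"] 1
      by (metis (no_types, lifting) mult.assoc norm_ge_zero order_trans)
    then have "X powr \<delta> * cmod (osc a \<psi> \<xi>) \<le> C * g" using X by simp
    then have "X powr (- \<delta>) * (X powr \<delta> * cmod (osc a \<psi> \<xi>)) \<le> X powr (- \<delta>) * (C * g)"
      by (intro mult_left_mono) auto
    then have "cmod (osc a \<psi> \<xi>) \<le> X powr (- \<delta>) * (C * g)"
      using X by (simp add: powr_minus flip: mult.assoc)
    also have "\<dots> = C * (X powr (- \<delta>) * X powr (- (real N * \<delta>))) * L2_norm_on ?K \<psi>" by (simp add: g_def)
    also have "X powr (- \<delta>) * X powr (- (real N * \<delta>)) = X powr (- (real (Suc N) * \<delta>))"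
      unfolding powr_add[symmetric] by (simp add: algebra_simps)
    finally show ?thesis by (simp add: X_def)
  qed
  then show ?case using C0 by blast
qed

section \<open>The pointwise bound\<close>

text \<open>Telescoping: \<open>1 / (u + \<kappa>)\<^sup>2\<close> is at most the difference of
  \<open>1 / u\<close> and \<open>1 / (u + \<kappa>)\<close> divided by \<kappa>. The induction
  needs the sharper bound that keeps the telescoped remainder.\<close>

lemma sum_int_inverse_square_le:
  assumes "\<kappa> > 0"
  shows "(\<Sum>j\<in>{- int n..int n}. 1 / (1 + \<kappa> * \<bar>real_of_int j\<bar>)\<^sup>2) \<le> 1 + 2 / \<kappa>"
proof -
  have "(\<Sum>j\<in>{- int n..int n}. 1 / (1 + \<kappa> * \<bar>real_of_int j\<bar>)\<^sup>2) \<le> 1 + 2 / \<kappa> * (1 - 1 / (1 + \<kappa> * n))"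
  proof (induction n)
    case (Suc n)
    define u where "u = 1 + \<kappa> * real n"
    have u: "u \<ge> 1" using assms by (simp add: u_def)
    have uS: "1 + \<kappa> * real (Suc n) = u + \<kappa>" by (simp add: u_def algebra_simps)
    have set: "{- int (Suc n)..int (Suc n)} = insert (int (Suc n)) (insert (- int (Suc n)) {- int n..int n})" by auto
    have "(\<Sum>j\<in>{- int (Suc n)..int (Suc n)}. 1 / (1 + \<kappa> * \<bar>real_of_int j\<bar>)\<^sup>2)
        = 1 / (u + \<kappa>)\<^sup>2 + (1 / (u + \<kappa>)\<^sup>2 + (\<Sum>j\<in>{- int n..int n}. 1 / (1 + \<kappa> * \<bar>real_of_int j\<bar>)\<^sup>2))"
      unfolding set uS[symmetric] by (simp add: add.commute)
    also have "\<dots> \<le> 1 / (u + \<kappa>)\<^sup>2 + (1 / (u + \<kappa>)\<^sup>2 + (1 + 2 / \<kappa> * (1 - 1 / u)))"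
      using Suc.IH by (simp add: u_def)
    also have "\<dots> \<le> 1 + 2 / \<kappa> * (1 - 1 / (u + \<kappa>))"
    proof -
      have "1 / (u + \<kappa>)\<^sup>2 \<le> 1 / (u * (u + \<kappa>))"
        using u assms by (intro divide_left_mono) (auto simp: power2_eq_square intro!: mult_right_mono mult_pos_pos)
      also have "\<dots> = 1 / \<kappa> * (1 / u - 1 / (u + \<kappa>))" using u assms by (simp add: field_simps)
      finally have "1 / (u + \<kappa>)\<^sup>2 \<le> 1 / \<kappa> * (1 / u - 1 / (u + \<kappa>))" .
      moreover have "2 / \<kappa> * (1 - 1 / (u + \<kappa>)) = 2 / \<kappa> * (1 - 1 / u) + 2 * (1 / \<kappa> * (1 / u - 1 / (u + \<kappa>)))"
        by (simp add: right_diff_distrib)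
      ultimately show ?thesis by linarith
    qed
    finally show ?case unfolding uS .
  qed simp
  also have "\<dots> \<le> 1 + 2 / \<kappa> * 1" using assms by (intro add_left_mono mult_left_mono) auto
  finally show ?thesis by simp
qed

text \<open>The exponent \<open>2 * real CARD('d)\<close> spends a square on each coordinate: the
  norm dominates every component, so the summand is at most a product of one-variable terms and the
  sum factors.\<close>

lemma lattice_sum_bounded:
  fixes F :: "(int ^ 'd) set"
  assumes \<kappa>: "\<kappa> > 0" and "finite F"
  shows "(\<Sum>k\<in>F. (1 + \<kappa> * norm (int_vec k)) powr (- (2 * real CARD('d)))) \<le> (1 + 2 / \<kappa>) ^ CARD('d)"
proof -
  let ?b = "\<lambda>j. 1 / (1 + \<kappa> * \<bar>real_of_int j\<bar>)\<^sup>2"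
  \<comment> \<open>Any number exceeding all components of all members of \<open>F\<close> would do;
    this sum is a convenient one.\<close>
  define n where "n = (\<Sum>k\<in>F. \<Sum>i\<in>UNIV. nat \<bar>k $ i\<bar>)"
  have n: "\<bar>k $ i\<bar> \<le> int n" if "k \<in> F" for k i
  proof -
    have "nat \<bar>k $ i\<bar> \<le> (\<Sum>i\<in>UNIV. nat \<bar>k $ i\<bar>)" by (intro member_le_sum) auto
    also have "\<dots> \<le> n" unfolding n_def using that assms
      by (intro member_le_sum[of k F "\<lambda>k. \<Sum>i\<in>UNIV. nat \<bar>k $ i\<bar>"]) auto
    finally show ?thesis by linarith
  qed
  have "(\<Sum>k\<in>F. (1 + \<kappa> * norm (int_vec k)) powr (- (2 * real CARD('d)))) \<le> (\<Sum>k\<in>F. \<Prod>i\<in>UNIV. ?b (k $ i))"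
  proof (rule sum_mono)
    fix k :: "int ^ 'd"
    define X where "X = 1 + \<kappa> * norm (int_vec k)"
    have X: "X \<ge> 1" using \<kappa> by (simp add: X_def)
    have "X powr (- (2 * real CARD('d))) = 1 / X powr (real (2 * CARD('d)))"
      by (simp add: powr_minus_divide)
    also have "\<dots> = 1 / X ^ (2 * CARD('d))" using X by (subst powr_realpow) auto
    also have "\<dots> = (\<Prod>i\<in>(UNIV :: 'd set). 1 / X\<^sup>2)" by (simp add: power_mult power_one_over)
    also have "\<dots> \<le> (\<Prod>i\<in>UNIV. ?b (k $ i))"
    proof (rule prod_mono)
      fix i
      have "\<bar>real_of_int (k $ i)\<bar> \<le> norm (int_vec k)"
        using component_le_norm_cart[of "int_vec k" i] by (simp add: int_vec_def)
      then have "1 + \<kappa> * \<bar>real_of_int (k $ i)\<bar> \<le> X" using \<kappa> by (simp add: X_def)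
      moreover have "0 < 1 + \<kappa> * \<bar>real_of_int (k $ i)\<bar>" using \<kappa> by (intro add_pos_nonneg) auto
      ultimately show "0 \<le> 1 / X\<^sup>2 \<and> 1 / X\<^sup>2 \<le> ?b (k $ i)"
        using X by (auto intro!: divide_left_mono power_mono)
    qed
    finally show "(1 + \<kappa> * norm (int_vec k)) powr (- (2 * real CARD('d))) \<le> (\<Prod>i\<in>UNIV. ?b (k $ i))"
      by (simp add: X_def)
  qed
  also have "\<dots> = (\<Sum>g\<in>vec_nth ` F. \<Prod>i\<in>UNIV. ?b (g i))"
    by (subst sum.reindex) (auto simp: inj_on_def vec_nth_inject)
  also have "\<dots> \<le> (\<Sum>g\<in>PiE (UNIV :: 'd set) (\<lambda>_. {- int n..int n}). \<Prod>i\<in>UNIV. ?b (g i))"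
  proof (rule sum_mono2)
    show "finite (PiE (UNIV :: 'd set) (\<lambda>_. {- int n..int n}))" by (intro finite_PiE) auto
    show "vec_nth ` F \<subseteq> PiE UNIV (\<lambda>_. {- int n..int n})"
    proof
      fix g assume "g \<in> vec_nth ` F"
      then obtain k where "k \<in> F" "g = vec_nth k" by auto
      then show "g \<in> PiE UNIV (\<lambda>_. {- int n..int n})"
        using n[of k] by (auto simp: abs_le_iff minus_le_iff)
    qed
    show "0 \<le> (\<Prod>i\<in>UNIV. ?b (g i))" for g by (intro prod_nonneg) auto
  qed
  also have "\<dots> = (\<Prod>i\<in>(UNIV :: 'd set). \<Sum>j\<in>{- int n..int n}. ?b j)"
    by (subst prod_sum_PiE) auto
  also have "\<dots> \<le> (1 + 2 / \<kappa>) ^ CARD('d)"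
    using sum_int_inverse_square_le[OF \<kappa>, of n] by (simp add: power_mono sum_nonneg)
  finally show ?thesis .
qed

lemma sum_le_sqrt_card_mult_l2:
  fixes f :: "'a \<Rightarrow> real"
  assumes "finite S"
  shows "(\<Sum>k\<in>S. f k) \<le> sqrt (real (card S)) * sqrt (\<Sum>k\<in>S. (f k)\<^sup>2)"
proof -
  have "(\<Sum>k\<in>S. 1 * f k)\<^sup>2 \<le> (\<Sum>k\<in>S. 1\<^sup>2) * (\<Sum>k\<in>S. (f k)\<^sup>2)" by (rule Cauchy_Schwarz_ineq_sum)
  then have "(\<Sum>k\<in>S. f k)\<^sup>2 \<le> real (card S) * (\<Sum>k\<in>S. (f k)\<^sup>2)" by simp
  then show ?thesis by (simp add: real_le_rsqrt flip: real_sqrt_mult)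
qed

lemma echar_eq_cis_inner: "echar t (- k) y = cis (- ((t *\<^sub>R int_vec k) \<bullet> y))"
  by (simp add: echar_def int_vec_def inner_vec_def sum_distrib_left sum_negf mult.assoc)

theorem mainTheorem3:
  fixes m :: nat and c :: "nat ^ 'd \<Rightarrow> real" and \<epsilon> r :: real and M :: "nat ^ 'd \<Rightarrow> real"
  assumes "m \<ge> 1"
    and "elliptic m c"
    and "\<epsilon> > 0"
    and "r > 0"
    and "\<And>\<beta>. M \<beta> \<ge> 0"
  shows "\<exists>C :: real.
    \<forall>(\<Omega> :: (real ^ 'd) set) (V :: real ^ 'd \<Rightarrow> complex) (lam :: complex)
      (\<psi> :: real ^ 'd \<Rightarrow> complex) (x :: real ^ 'd).
      open \<Omega> \<longrightarrow> smooth_on \<Omega> V \<longrightarrow> cmod lam \<ge> 1 \<longrightarrow> smooth_on \<Omega> \<psi> \<longrightarrow>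
      (\<forall>y\<in>\<Omega>. diff_op m c \<psi> y + V y * \<psi> y = lam * \<psi> y) \<longrightarrow>
      cball x r \<subseteq> \<Omega> \<longrightarrow>
      (\<forall>\<beta>. \<forall>y\<in>cball x r. cmod (D_multi \<beta> V y) \<le> M \<beta>) \<longrightarrow>
      cmod (\<psi> x) \<le> C * cmod lam powr ((real CARD('d) - 1) / (2 * real m) + \<epsilon>)
                     * L2_norm_on (cball x r) \<psi>"
proof -
  let ?d = "CARD('d)"
  \<comment> \<open>The second entry turns the exponent
    \<open>(real ?d - 1 + \<delta>) / (2 * real m)\<close> into at most the one claimed; the first
    keeps \<open>\<delta> < 1\<close>.\<close>
  define \<delta> where "\<delta> = min (1 / 2) (2 * real m * \<epsilon>)"
  have \<delta>: "0 < \<delta>" "\<delta> < 1" "\<delta> \<le> 2 * real m * \<epsilon>" using assms(1,3) by (auto simp: \<delta>_def)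
  \<comment> \<open>Enough iterations for the decay to be summable over the lattice by
    \<open>lattice_sum_bounded\<close>.\<close>
  obtain N where N: "2 * real ?d < real N * \<delta>" using reals_Archimedean3[OF \<delta>(1)] by blast
  \<comment> \<open>Dilations \<open>t\<close> between \<open>\<tau> / 2\<close> and \<tau>
    correspond to half sides \<open>h = pi / t\<close> between \<open>r\<close> and
    \<open>2 * r\<close>, so each admissible cube contains the ball and has comparable
    volume.\<close>
  define \<tau> where "\<tau> = pi / r"
  have \<tau>: "\<tau> > 0" using assms(4) by (simp add: \<tau>_def)
  obtain b :: "real ^ 'd \<Rightarrow> complex" and A where b: "\<And>\<Omega>. smooth_on \<Omega> b" "b 0 = 1"
    "\<And>y. y \<notin> cball 0 r \<Longrightarrow> b y = 0" and A: "\<And>n. A n \<ge> 0" "\<And>w y. cmod (D_word w b y) \<le> A (length w)"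
    using bump_function_exists[OF assms(4)] by metis
  obtain C1 where C1: "C1 \<ge> 0" "\<And>\<Omega> V lam \<psi> x a \<xi>. eigenfunction_data m c r M \<Omega> V lam \<psi> x \<Longrightarrow>
     test_fun \<Omega> (cball x r) A a \<Longrightarrow> \<xi> \<notin> resonant m c \<delta> lam \<Longrightarrow>
     cmod (osc a \<psi> \<xi>) \<le> C1 * (1 + norm \<xi>) powr (- (real N * \<delta>)) * L2_norm_on (cball x r) \<psi>"
    using osc_decay[where N = N and \<delta> = \<delta> and c = c and M = M and A = A and r = r, OF assms(1,4,5) A(1)] by blast
  obtain C2 where C2: "C2 \<ge> 0" "\<And>lam. cmod lam \<ge> 1 \<Longrightarrow> \<exists>t\<in>{\<tau> / 2..\<tau>}.
     finite {k. t *\<^sub>R int_vec k \<in> resonant m c \<delta> lam} \<and>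
     real (card {k. t *\<^sub>R int_vec k \<in> resonant m c \<delta> lam}) \<le> C2 * cmod lam powr ((real ?d - 1 + \<delta>) / m)"
    using exists_dilation_few_resonant[OF assms(1,2) \<delta>(1,2) \<tau>] by blast
  \<comment> \<open>The first summand is for resonant frequencies (root of their number, times
    Bessel on a cube of side at most \<open>4 * r\<close>), the second for the lattice sum of the
    decaying ones.\<close>
  define C3 where "C3 = sqrt C2 * (sqrt ((4 * r) ^ ?d) * A 0) + C1 * (1 + 2 / (\<tau> / 2)) ^ ?d"
  have C3: "C3 \<ge> 0" using C1 C2 A \<tau> assms(4) by (simp add: C3_def)
  define q where "q = (real ?d - 1) / (2 * real m) + \<epsilon>"
  have "cmod (\<psi> x) \<le> (C3 / (2 * r) ^ ?d) * cmod lam powr q * L2_norm_on (cball x r) \<psi>"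
    if data: "eigenfunction_data m c r M \<Omega> V lam \<psi> x" and lam: "cmod lam \<ge> 1" for \<Omega> V lam \<psi> x
  proof -
    let ?K = "cball x r"
    define L where "L = L2_norm_on ?K \<psi>"
    have L: "L \<ge> 0" unfolding L_def by (rule L2_norm_on_nonneg)
    have \<Omega>: "open \<Omega>" and \<psi>: "smooth_on \<Omega> \<psi>" and K\<Omega>: "?K \<subseteq> \<Omega>"
      using data by (auto simp: eigenfunction_data_def)
    \<comment> \<open>A translate of one fixed bump, so the bounds \<open>A\<close> do not depend on
      \<open>x\<close>.\<close>
    define a where "a = (\<lambda>y. b (y - x))"
    have Da: "D_word w a = (\<lambda>y. D_word w b (y - x))" for w unfolding a_def by (rule D_word_shift)
    have sma: "smooth_on \<Omega> a" unfolding a_def by (rule smooth_on_shift[OF b(1)])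
    have off: "a y = 0" if "y \<notin> ?K" for y
      unfolding a_def using that by (intro b(3)) (simp add: dist_norm norm_minus_commute)
    have a: "test_fun \<Omega> ?K A a" using sma off A(2) by (simp add: test_fun_def Da)
    obtain t where t: "t \<in> {\<tau> / 2..\<tau>}" and fin: "finite {k. t *\<^sub>R int_vec k \<in> resonant m c \<delta> lam}"
      and card: "real (card {k. t *\<^sub>R int_vec k \<in> resonant m c \<delta> lam}) \<le> C2 * cmod lam powr ((real ?d - 1 + \<delta>) / m)"
      using C2(2)[OF lam] by blast
    define Bad where "Bad = {k. t *\<^sub>R int_vec k \<in> resonant m c \<delta> lam}"
    define h where "h = pi / t"
    have t0: "t > 0" using t \<tau> by simp
    have h0: "h > 0" and th: "pi / h = t" using t0 by (auto simp: h_def)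
    have h: "r \<le> h" "h \<le> 2 * r"
      using t t0 assms(4) by (auto simp: h_def \<tau>_def field_simps)
    define f where "f = (\<lambda>y. a y * \<psi> y)"
    have fc: "continuous_on UNIV f"
      unfolding f_def using sma \<psi> off
      by (intro osc_integrand(1)[OF \<Omega> compact_cball K\<Omega>] smooth_on_continuous) auto
    have fK: "f y = 0" if "y \<notin> ?K" for y using off[OF that] by (simp add: f_def)
    have sub: "?K \<subseteq> cube x h"
      using cball_subset_cube[of x h] h subset_cball[of r h x] by auto
    have foff: "f y = 0" if "y \<notin> cube x h" for y using fK sub that by blast
    define fh where "fh k = cmod (LINT y|lborel. f y * echar (pi / h) (- k) y)" for k
    have fh: "fh k = cmod (osc a \<psi> (t *\<^sub>R int_vec k))" for k
      unfolding fh_def osc_def th echar_eq_cis_inner f_def by simp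
    have f2: "(LINT y|lborel. (cmod (f y))\<^sup>2) \<le> (A 0)\<^sup>2 * L\<^sup>2"
    proof -
      let ?M = "restrict_space lborel ?K"
      have \<psi>c: "continuous_on ?K \<psi>" using \<psi> K\<Omega> smooth_on_continuous continuous_on_subset by blast
      have "(LINT y|lborel. (cmod (f y))\<^sup>2) = (LINT y|?M. (cmod (f y))\<^sup>2)"
        using fK by (intro integral_restrict_support[symmetric]) auto
      also have "\<dots> \<le> (LINT y|?M. (A 0)\<^sup>2 * (cmod (\<psi> y))\<^sup>2)"
      proof (rule integral_mono)
        show "integrable ?M (\<lambda>y. (cmod (f y))\<^sup>2)" "integrable ?M (\<lambda>y. (A 0)\<^sup>2 * (cmod (\<psi> y))\<^sup>2)"
          by (intro integrable_restrict_compact compact_cball continuous_intros continuous_on_subset[OF fc] \<psi>c subset_UNIV)+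
        show "(cmod (f y))\<^sup>2 \<le> (A 0)\<^sup>2 * (cmod (\<psi> y))\<^sup>2" for y
        proof -
          have "cmod (a y) \<le> A 0" using A(2)[of "[]" "y - x"] by (simp add: a_def)
          then have "cmod (f y) \<le> A 0 * cmod (\<psi> y)"
            unfolding f_def norm_mult by (intro mult_right_mono) auto
          from power_mono[OF this, of 2] show ?thesis by (simp add: power_mult_distrib)
        qed
      qed
      also have "\<dots> = (A 0)\<^sup>2 * L\<^sup>2"
        unfolding L_def by (simp add: L2_norm_on_eq)
      finally show ?thesis .
    qed
    have "cmod (f x) \<le> (C3 * cmod lam powr q * L) / (2 * h) ^ ?d"
    proof (rule pointwise_le_Fourier_sum[OF h0 fc foff])
      fix F :: "(int ^ 'd) set" assume F: "finite F"
      define p where "p = (real ?d - 1 + \<delta>) / m"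
      have d1: "real ?d \<ge> 1" by (simp add: Suc_leI)
      have pq: "p / 2 \<le> q" using \<delta>(3) assms(1) by (simp add: p_def q_def field_simps)
      have q0: "q \<ge> 0" using d1 assms(1,3) by (simp add: q_def)
      \<comment> \<open>Resonant frequencies are few but have only square-summable control; the
        others are many but decay.\<close>
      have "(\<Sum>k\<in>F. fh k) = (\<Sum>k\<in>F \<inter> Bad. fh k) + (\<Sum>k\<in>F - Bad. fh k)"
        using F by (rule sum.Int_Diff)
      also have "(\<Sum>k\<in>F \<inter> Bad. fh k) \<le> sqrt (real (card (F \<inter> Bad))) * sqrt (\<Sum>k\<in>F \<inter> Bad. (fh k)\<^sup>2)"
        using F by (intro sum_le_sqrt_card_mult_l2) auto
      also have "\<dots> \<le> sqrt (C2 * cmod lam powr p) * sqrt ((4 * r) ^ ?d * ((A 0)\<^sup>2 * L\<^sup>2))"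
      proof (intro mult_mono real_sqrt_le_mono)
        have "card (F \<inter> Bad) \<le> card Bad" using fin unfolding Bad_def by (intro card_mono) auto
        then show "real (card (F \<inter> Bad)) \<le> C2 * cmod lam powr p"
          using card unfolding Bad_def p_def by linarith
        have "(\<Sum>k\<in>F \<inter> Bad. (fh k)\<^sup>2) \<le> (2 * h) ^ ?d * (LINT y|lborel. (cmod (f y))\<^sup>2)"
          unfolding fh_def using F by (intro Bessel_inequality_cube h0 fc foff) auto
        also have "\<dots> \<le> (4 * r) ^ ?d * ((A 0)\<^sup>2 * L\<^sup>2)"
        proof (rule mult_mono[OF _ f2])
          show "(2 * h) ^ ?d \<le> (4 * r) ^ ?d" using h h0 by (intro power_mono) auto
        qed (use assms(4) in auto)
        finally show "(\<Sum>k\<in>F \<inter> Bad. (fh k)\<^sup>2) \<le> (4 * r) ^ ?d * ((A 0)\<^sup>2 * L\<^sup>2)" .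
      qed (use C2(1) in \<open>auto intro: sum_nonneg\<close>)
      also have "\<dots> = sqrt C2 * (sqrt ((4 * r) ^ ?d) * A 0) * cmod lam powr (p / 2) * L"
        using A(1)[of 0] L lam by (simp add: real_sqrt_mult powr_half_sqrt[symmetric] powr_powr)
      also have "\<dots> \<le> sqrt C2 * (sqrt ((4 * r) ^ ?d) * A 0) * cmod lam powr q * L"
        using A(1)[of 0] L lam pq C2(1) assms(4) by (intro mult_right_mono mult_left_mono powr_mono) auto
      also have "(\<Sum>k\<in>F - Bad. fh k) \<le> (\<Sum>k\<in>F - Bad. C1 * L * (1 + \<tau> / 2 * norm (int_vec k)) powr (- (2 * real ?d)))"
      proof (rule sum_mono)
        fix k assume "k \<in> F - Bad"
        then have "fh k \<le> C1 * (1 + norm (t *\<^sub>R int_vec k)) powr (- (real N * \<delta>)) * L"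
          unfolding fh L_def by (intro C1(2)[OF data a]) (simp add: Bad_def)
        also have "(1 + norm (t *\<^sub>R int_vec k)) powr (- (real N * \<delta>)) \<le> (1 + norm (t *\<^sub>R int_vec k)) powr (- (2 * real ?d))"
          using N by (intro powr_mono) auto
        \<comment> \<open>Replacing \<open>t\<close> by its lower bound makes the lattice sum
          independent of the dilation, which varies with \<open>lam\<close>.\<close>
        also have "\<dots> \<le> (1 + \<tau> / 2 * norm (int_vec k)) powr (- (2 * real ?d))"
        proof (rule powr_mono2')
          show "1 + \<tau> / 2 * norm (int_vec k) \<le> 1 + norm (t *\<^sub>R int_vec k)"
            using mult_right_mono[of "\<tau> / 2" t "norm (int_vec k)"] t t0 by simp
          show "0 < 1 + \<tau> / 2 * norm (int_vec k)" using \<tau> by (intro add_pos_nonneg) auto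
        qed simp
        finally show "fh k \<le> C1 * L * (1 + \<tau> / 2 * norm (int_vec k)) powr (- (2 * real ?d))"
          using C1(1) L by (simp add: mult_ac mult_left_mono mult_right_mono)
      qed
      also have "\<dots> = C1 * L * (\<Sum>k\<in>F - Bad. (1 + \<tau> / 2 * norm (int_vec k)) powr (- (2 * real ?d)))"
        by (simp add: sum_distrib_left)
      also have "\<dots> \<le> C1 * L * (1 + 2 / (\<tau> / 2)) ^ ?d"
        using C1(1) L \<tau> F by (intro mult_left_mono lattice_sum_bounded) auto
      also have "\<dots> \<le> C1 * L * (1 + 2 / (\<tau> / 2)) ^ ?d * cmod lam powr q"
      proof -
        have "1 \<le> cmod lam powr q" using lam q0 by (intro ge_one_powr_ge_zero)
        moreover have "0 \<le> C1 * L * (1 + 2 / (\<tau> / 2)) ^ ?d" using C1(1) L \<tau> by simp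
        ultimately show ?thesis using mult_left_mono by fastforce
      qed
      finally have "(\<Sum>k\<in>F. fh k) \<le> C3 * cmod lam powr q * L" by (simp add: C3_def algebra_simps)
      then show "(\<Sum>k\<in>F. cmod (LINT y|lborel. f y * echar (pi / h) (- k) y)) \<le> C3 * cmod lam powr q * L"
        by (simp add: fh_def)
    qed
    also have "\<dots> \<le> (C3 * cmod lam powr q * L) / (2 * r) ^ ?d"
      using h assms(4) C3 L by (intro divide_left_mono power_mono) auto
    also have "f x = \<psi> x" by (simp add: f_def a_def b(2))
    finally show ?thesis by (simp add: L_def)
  qed
  then show ?thesis
    unfolding q_def eigenfunction_data_def by (intro exI[of _ "C3 / (2 * r) ^ ?d"]) blast
qed

end
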